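(* Let $F$ be a field of characteristic $2$, and let $S=\{\varphi_1,\dots,\varphi_s\}$ be a set of quadratic $2$-fold Pfister forms over $F$ whose image generates a subgroup of order $2^s$ in $I_q^2F/I_q^3F$. Assume that $S$ is right-linked, and that some pair of forms in the group generated by $S$ is left-linked. Then $\Sigma_S=0$.
   Context: $[a,b]$ denotes the quadratic form $ax^2+xy+by^2$. $I_q^1F$ is the group of Witt classes of even-dimensional nonsingular quadratic forms over $F$ under orthogonal sum. Quadratic Pfister forms: $\langle\langle\alpha]]=[1,\alpha]$ and $\langle\langle\beta_1,\dots,\beta_{n-1},\alpha]]=\langle 1,\beta_1\rangle\otimes\cdots\otimes\langle 1,\beta_{n-1}\rangle\otimes[1,\alpha]$, $\beta_i\in F^\times$, $\alpha\in F$, where $\langle 1,\beta\rangle$ is the diagonal symmetric bilinear form. $I_q^nF$ is the subgroup of $I_q^1F$ generated by scalar multiples of quadratic $n$-fold Pfister forms. A set of quadratic $2$-fold Pfister forms is right-linked if there is a fixed $\alpha\in F$ such that every form in the set is isometric to $\langle\langle\beta,\alpha]]$ for some $\beta\in F^\times$; it is left-linked if there is a fixed $\beta\in F^\times$ such that every form in the set is isometric to $\langle\langle\beta,\alpha]]$ for some $\alpha\in F$. It is tight if every element of the subgroup it generates in $I_q^2F/I_q^3F$ is represented by a quadratic $2$-fold Pfister form (unique up to isometry); right-linked sets are tight. The forms in the group generated by a tight set $S$ are the $2$-fold Pfister forms representing the elements of the subgroup generated by $S$ in $I_q^2F/I_q^3F$. For a finite tight set $S$ of more than one form, $\Sigma_S\in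 I_q^2F$ is the sum in $I_q^2F$ of the unique $2$-fold Pfister representatives of all the elements of that subgroup.
   Formalization: The left-linked pair is required to consist of two non-isometric, non-hyperbolic forms; otherwise the hyperbolic form, which is left-linked to every form, makes the condition void and the claim false (s = 2 with ⟨⟨β1,β2,α]] anisotropic). *)

theory Defs
  imports
    "HOL-Algebra.Generated_Groups"
    "HOL-Algebra.FiniteProduct"
    "HOL-Computational_Algebra.Primes"
    "Jordan_Normal_Form.Matrix"
begin

text \<open>
  A quadratic form in \<open>n\<close> variables is given by an \<open>n \<times> n\<close> matrix \<open>A\<close> of coefficients, as the
  form \<open>v \<mapsto> \<Sum>\<^sub>i\<^sub>j A\<^sub>i\<^sub>j v\<^sub>i v\<^sub>j\<close>. The matrix is not symmetric in general (in characteristic 2 a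
  symmetric one would only give diagonal forms), and it is not determined by the form; only forms
  up to isometry matter below.
\<close>

definition qval :: "'a::field mat \<Rightarrow> 'a vec \<Rightarrow> 'a" where
  "qval A v = v \<bullet> (A *\<^sub>v v)"

definition polar :: "'a::field mat \<Rightarrow> 'a vec \<Rightarrow> 'a vec \<Rightarrow> 'a" where
  "polar A v w = qval A (v + w) - qval A v - qval A w"

definition nonsingular_form :: "'a::field mat \<Rightarrow> bool" where
  "nonsingular_form A \<longleftrightarrow> square_mat A \<and>
     (\<forall>v \<in> carrier_vec (dim_row A).
        (\<forall>w \<in> carrier_vec (dim_row A). polar A v w = 0) \<longrightarrow> v = 0\<^sub>v (dim_row A))"

definition isometric :: "'a::field mat \<Rightarrow> 'a mat \<Rightarrow> bool" where
  "isometric A B \<longleftrightarrow> square_mat A \<and> square_mat B \<and> dim_row A = dim_row B \<and>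
     (\<exists>P \<in> carrier_mat (dim_row A) (dim_row A). invertible_mat P \<and>
        (\<forall>v \<in> carrier_vec (dim_row A). qval B v = qval A (P *\<^sub>v v)))"

definition orth_sum :: "'a::field mat \<Rightarrow> 'a mat \<Rightarrow> 'a mat" where
  "orth_sum A B =
     four_block_mat A (0\<^sub>m (dim_row A) (dim_col B)) (0\<^sub>m (dim_row B) (dim_col A)) B"

definition binary_form :: "'a::field \<Rightarrow> 'a \<Rightarrow> 'a mat" where
  "binary_form a b = mat_of_rows_list 2 [[a, 1], [0, b]]"

lemma qval_binary_form:
  "qval (binary_form a b) (vec_of_list [x, y]) = a * x\<^sup>2 + x * y + b * y\<^sup>2"
  by (simp add: qval_def binary_form_def mat_of_rows_list_def scalar_prod_def mult_mat_vec_def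
      row_def numeral_2_eq_2 algebra_simps)

text \<open>\<open>hyperbolic_sum m\<close> is the orthogonal sum of \<open>m\<close> hyperbolic planes.\<close>

definition hyperbolic_sum :: "nat \<Rightarrow> 'a::field mat" where
  "hyperbolic_sum m = (orth_sum (binary_form 0 0) ^^ m) (0\<^sub>m 0 0)"

definition hyperbolic :: "'a::field mat \<Rightarrow> bool" where
  "hyperbolic A \<longleftrightarrow> (\<exists>m. isometric A (hyperbolic_sum m))"

text \<open>The group of Witt classes of even-dimensional nonsingular forms, written multiplicatively.\<close>

definition even_forms :: "'a::field mat set" where
  "even_forms = {A. nonsingular_form A \<and> even (dim_row A)}"

definition witt_rel :: "('a::field mat \<times> 'a mat) set" where
  "witt_rel = {(A, B). A \<in> even_forms \<and> B \<in> even_forms \<and>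
     (\<exists>m n. isometric (orth_sum A (hyperbolic_sum m)) (orth_sum B (hyperbolic_sum n)))}"

definition witt_class :: "'a::field mat \<Rightarrow> 'a mat set" where
  "witt_class A = witt_rel `` {A}"

definition Iq1 :: "'a::field mat set monoid" where
  "Iq1 = \<lparr>carrier = even_forms // witt_rel,
          monoid.mult = (\<lambda>X Y. \<Union>A\<in>X. \<Union>B\<in>Y. witt_class (orth_sum A B)),
          one = witt_class (0\<^sub>m 0 0)\<rparr>"

text \<open>
  \<open>pfister [\<beta>\<^sub>1, \<dots>, \<beta>\<^sub>k] \<alpha>\<close> is \<open>\<langle>1, \<beta>\<^sub>1\<rangle> \<otimes> \<cdots> \<otimes> \<langle>1, \<beta>\<^sub>k\<rangle> \<otimes> [1, \<alpha>]\<close>, using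
  \<open>\<langle>1, \<beta>\<rangle> \<otimes> q = q \<bottom> \<beta> q\<close>. It is a \<open>(k + 1)\<close>-fold Pfister form.
\<close>

fun pfister :: "'a::field list \<Rightarrow> 'a \<Rightarrow> 'a mat" where
  "pfister [] \<alpha> = binary_form 1 \<alpha>"
| "pfister (\<beta> # \<beta>s) \<alpha> = orth_sum (pfister \<beta>s \<alpha>) (\<beta> \<cdot>\<^sub>m pfister \<beta>s \<alpha>)"

definition pfister_form :: "nat \<Rightarrow> 'a::field mat \<Rightarrow> bool" where
  "pfister_form n A \<longleftrightarrow>
     (\<exists>\<beta>s \<alpha>. Suc (length \<beta>s) = n \<and> 0 \<notin> set \<beta>s \<and> isometric A (pfister \<beta>s \<alpha>))"

definition Iq_set :: "nat \<Rightarrow> 'a::field mat set set" where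
  "Iq_set n = generate Iq1 {witt_class (c \<cdot>\<^sub>m A) | c A. c \<noteq> 0 \<and> pfister_form n A}"

definition Iq :: "nat \<Rightarrow> 'a::field mat set monoid" where
  "Iq n = Iq1\<lparr>carrier := Iq_set n\<rparr>"

definition Iq2_mod_Iq3 :: "'a::field mat set set monoid" where
  "Iq2_mod_Iq3 = Iq 2 Mod Iq_set 3"

definition class_mod_Iq3 :: "'a::field mat \<Rightarrow> 'a mat set set" where
  "class_mod_Iq3 A = Iq_set 3 #>\<^bsub>Iq 2\<^esub> witt_class A"

definition right_linked :: "'a::field mat set \<Rightarrow> bool" where
  "right_linked S \<longleftrightarrow> (\<exists>\<alpha>. \<forall>A \<in> S. \<exists>\<beta>. \<beta> \<noteq> 0 \<and> isometric A (pfister [\<beta>] \<alpha>))"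

definition left_linked :: "'a::field mat set \<Rightarrow> bool" where
  "left_linked S \<longleftrightarrow> (\<exists>\<beta>. \<beta> \<noteq> 0 \<and> (\<forall>A \<in> S. \<exists>\<alpha>. isometric A (pfister [\<beta>] \<alpha>)))"

definition generated_subgroup :: "'a::field mat set \<Rightarrow> 'a mat set set set" where
  "generated_subgroup S = generate Iq2_mod_Iq3 (class_mod_Iq3 ` S)"

text \<open>
  The next two definitions are meant for a tight set \<open>S\<close>. Then each element of the subgroup has
  a representing 2-fold Pfister form that is unique up to isometry, so \<open>pfister_rep x\<close> is a
  well-defined Witt class.
\<close>

definition generated_forms :: "'a::field mat set \<Rightarrow> 'a mat set" where
  "generated_forms S = {A. pfister_form 2 A \<and> class_mod_Iq3 A \<in> generated_subgroup S}"

definition pfister_rep :: "'a::field mat set set \<Rightarrow> 'a mat set" where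
  "pfister_rep x = (THE w. \<exists>A. pfister_form 2 A \<and> class_mod_Iq3 A = x \<and> w = witt_class A)"

definition Sigma_form :: "'a::field mat set \<Rightarrow> 'a mat set" where
  "Sigma_form S = finprod (Iq 2) pfister_rep (generated_subgroup S)"

text \<open>
  The trivial element of the generated group is represented by the hyperbolic form, which is
  left-linked to every 2-fold Pfister form (it is isometric to \<open>pfister [\<beta>] 0\<close> for every nonzero
  \<open>\<beta>\<close>). A left-linked pair is therefore understood to consist of two non-isometric forms that are
  both non-hyperbolic; otherwise the condition would be void.
\<close>

definition has_left_linked_pair :: "'a::field mat set \<Rightarrow> bool" where
  "has_left_linked_pair T \<longleftrightarrow>
     (\<exists>A \<in> T. \<exists>B \<in> T. \<not> isometric A B \<and> \<not> hyperbolic A \<and> \<not> hyperbolic B \<and> left_linked {A, B})"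

end

theory Submission
  imports Defs "Jordan_Normal_Form.Determinant"
begin

text \<open>
  If \<open>S\<close> consists of the forms \<open>\<langle>\<langle>\<beta>\<^sub>i, \<alpha>]]\<close>, then \<open>\<Sigma>\<^sub>S\<close> is the sum of the classes of all
  \<open>\<langle>\<langle>\<beta>\<^sub>T, \<alpha>]]\<close>, where \<open>\<beta>\<^sub>T\<close> is the product of the \<open>\<beta>\<^sub>i\<close> with \<open>i \<in> T\<close>. Given a left-linked pair
  \<open>\<langle>\<langle>b, \<alpha>]] = \<langle>\<langle>\<gamma>, p]]\<close> and \<open>\<langle>\<langle>c, \<alpha>]] = \<langle>\<langle>\<gamma>, q]]\<close>, the identity \<open>[1, p] + [1, q] = [1, p + q]\<close> in the
  Witt group makes the 3-fold Pfister form \<open>\<langle>\<langle>b, c, \<alpha>]]\<close> Witt equivalent to a form of dimension 6. By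
  cancellation it is isotropic, hence hyperbolic, and so are its scalar multiples. The sum
  decomposes into such multiples.

  The Pfister representatives are well defined because two 2-fold Pfister forms \<open>A\<close> and \<open>B\<close> that are
  congruent modulo \<open>I\<^sub>q\<^sup>3\<close> are Witt equivalent. Forms of dimension \<open>2 N\<close> representing
  elements of \<open>I\<^sub>q\<^sup>3\<close> have a Clifford module of dimension \<open>2 ^ N\<close>. Hence the 6-dimensional form
  representing \<open>A + B\<close> has a Clifford module of dimension 8; its Arf invariant is trivial,
  so the module splits into two halves of dimension 4 interchanged by the vectors of the form. As
  \<open>6 > 4\<close>, some vector kills a nonzero spinor and is therefore isotropic. The remaining 4-dimensional
  form is treated in the same way, with \<open>4 > 2\<close>.
\<close>

section \<open>Quadratic forms and isometries\<close>

text \<open>The obstacle is that \<open>pfister_rep\<close> is a definite description: before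
  anything can be summed, a 2-fold Pfister form must be determined by its class modulo
  \<open>Iq_set 3\<close>. Neither Clifford algebras nor Brauer groups are built for this; a
  Clifford module is a space of functions with operators that square to the values of the form. The
  block c[1, a] belongs to the quaternion algebra [a, c), and k \<langle>\<langle>b, c, a]] has
  blocks with scalars k, k b, k c, k b c, whose product is a square. So the four quaternion algebras
  cancel, and four tensor factors carry the 8-dimensional form. The spinor count for l blocks needs
  2 ^ (l - 1) < 2 l, that is l \<le> 3; it has to fail at dimension 8, since 3-fold Pfister forms
  can be anisotropic. Once representatives are unique, the order hypothesis identifies the generated
  subgroup with the subsets of S under symmetric difference. A left-linked pair gives two distinct
  nonempty subsets T and U, and the sum is taken coset by coset of the group of order 4 that they
  generate.\<close>

lemma polar_eq:
  assumes "A \<in> carrier_mat n n" "v \<in> carrier_vec n" "w \<in> carrier_vec n"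
  shows "polar A v w = v \<bullet> (A *\<^sub>v w) + w \<bullet> (A *\<^sub>v v)"
proof -
  have [simp]: "A *\<^sub>v v \<in> carrier_vec n" "A *\<^sub>v w \<in> carrier_vec n" using assms by auto
  show ?thesis
    unfolding polar_def qval_def
    using assms
    by (simp add: mult_add_distrib_mat_vec[of A n n] add_scalar_prod_distrib[of _ n]
        scalar_prod_add_distrib[of _ n])
qed

lemma qval_add:
  "qval A (v + w) = qval A v + qval A w + polar A v w"
  by (simp add: polar_def)

lemma qval_smult:
  assumes "A \<in> carrier_mat n n" "v \<in> carrier_vec n"
  shows "qval A (c \<cdot>\<^sub>v v) = c\<^sup>2 * qval A v"
proof -
  have "A *\<^sub>v v \<in> carrier_vec n" using assms by auto
  then show ?thesis
    using assms by (simp add: qval_def mult_mat_vec[of A n n] power2_eq_square mult.assoc)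
qed

lemma qval_zero [simp]: "A \<in> carrier_mat n n \<Longrightarrow> qval A (0\<^sub>v n) = 0"
  by (auto simp: qval_def)

lemma qval_smult_mat:
  assumes "A \<in> carrier_mat n n" "v \<in> carrier_vec n"
  shows "qval (c \<cdot>\<^sub>m A) v = c * qval A v"
proof -
  have "(c \<cdot>\<^sub>m A) *\<^sub>v v = c \<cdot>\<^sub>v (A *\<^sub>v v)"
    using assms by (intro eq_vecI) (auto simp: scalar_prod_def sum_distrib_left mult.assoc)
  moreover have "A *\<^sub>v v \<in> carrier_vec n" using assms by auto
  ultimately show ?thesis using assms by (simp add: qval_def)
qed

lemma polar_commute: "v \<in> carrier_vec n \<Longrightarrow> w \<in> carrier_vec n \<Longrightarrow> polar A v w = polar A w v"
  by (simp add: polar_def comm_add_vec[of v n])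

lemma polar_add_left:
  assumes "A \<in> carrier_mat n n" "u \<in> carrier_vec n" "v \<in> carrier_vec n" "w \<in> carrier_vec n"
  shows "polar A (u + v) w = polar A u w + polar A v w"
proof -
  have [simp]: "A *\<^sub>v v \<in> carrier_vec n" "A *\<^sub>v w \<in> carrier_vec n" "A *\<^sub>v u \<in> carrier_vec n"
    using assms by auto
  show ?thesis
    using assms
    by (simp add: polar_eq[of A n] mult_add_distrib_mat_vec[of A n n] add_scalar_prod_distrib[of _ n]
        scalar_prod_add_distrib[of _ n])
qed

lemma polar_smult_left:
  assumes "A \<in> carrier_mat n n" "v \<in> carrier_vec n" "w \<in> carrier_vec n"
  shows "polar A (c \<cdot>\<^sub>v v) w = c * polar A v w"
proof -
  have [simp]: "A *\<^sub>v v \<in> carrier_vec n" "A *\<^sub>v w \<in> carrier_vec n"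
    using assms by auto
  show ?thesis
    using assms by (simp add: polar_eq[of A n] mult_mat_vec[of A n n] algebra_simps)
qed

lemma polar_add_right:
  assumes "A \<in> carrier_mat n n" "u \<in> carrier_vec n" "v \<in> carrier_vec n" "w \<in> carrier_vec n"
  shows "polar A w (u + v) = polar A w u + polar A w v"
  using polar_add_left[OF assms] assms by (simp add: polar_commute[of w n])

lemma polar_smult_right:
  assumes "A \<in> carrier_mat n n" "v \<in> carrier_vec n" "w \<in> carrier_vec n"
  shows "polar A w (c \<cdot>\<^sub>v v) = c * polar A w v"
  using polar_smult_left[OF assms] assms by (simp add: polar_commute[of w n])

lemma polar_zero_left:
  assumes "A \<in> carrier_mat n n" "w \<in> carrier_vec n"
  shows "polar A (0\<^sub>v n) w = 0"
  using assms by (simp add: polar_def)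

lemma polar_zero_right:
  assumes "A \<in> carrier_mat n n" "w \<in> carrier_vec n"
  shows "polar A w (0\<^sub>v n) = 0"
  using assms by (simp add: polar_def)

lemma nonsingular_formI:
  assumes "A \<in> carrier_mat n n"
    and "\<And>v. v \<in> carrier_vec n \<Longrightarrow> (\<And>w. w \<in> carrier_vec n \<Longrightarrow> polar A v w = 0) \<Longrightarrow> v = 0\<^sub>v n"
  shows "nonsingular_form A"
  using assms by (auto simp: nonsingular_form_def)

lemma nonsingular_formD:
  assumes "nonsingular_form A" "A \<in> carrier_mat n n" "v \<in> carrier_vec n"
    "\<And>w. w \<in> carrier_vec n \<Longrightarrow> polar A v w = 0"
  shows "v = 0\<^sub>v n"
  using assms by (auto simp: nonsingular_form_def)

lemma nonsingular_form_carrier: "nonsingular_form A \<Longrightarrow> A \<in> carrier_mat (dim_row A) (dim_row A)"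
  by (auto simp: nonsingular_form_def)

lemma injective_inverse_mat:
  fixes P :: "'a::field mat"
  assumes P: "P \<in> carrier_mat n n"
    and inj: "\<And>v. v \<in> carrier_vec n \<Longrightarrow> P *\<^sub>v v = 0\<^sub>v n \<Longrightarrow> v = 0\<^sub>v n"
  obtains Q where "Q \<in> carrier_mat n n" "P * Q = 1\<^sub>m n" "Q * P = 1\<^sub>m n"
proof -
  have "det P \<noteq> 0" using det_0_iff_vec_prod_zero_field[OF P] inj by blast
  from det_non_zero_imp_unit[OF P this, of "()"] obtain Q
    where "Q \<in> carrier_mat n n" "P * Q = 1\<^sub>m n" "Q * P = 1\<^sub>m n"
    by (auto simp: Units_def ring_mat_def)
  then show ?thesis using that by blast
qed

lemma isometric_invI:
  assumes "A \<in> carrier_mat n n" "B \<in> carrier_mat n n" "P \<in> carrier_mat n n" "Q \<in> carrier_mat n n"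
    "P * Q = 1\<^sub>m n" "Q * P = 1\<^sub>m n"
    and q: "\<And>v. v \<in> carrier_vec n \<Longrightarrow> qval B v = qval A (P *\<^sub>v v)"
  shows "isometric A B"
proof -
  have "square_mat P" "inverts_mat P Q" "inverts_mat Q P"
    using assms(1-6) by (simp_all add: inverts_mat_def)
  then have "invertible_mat P" unfolding invertible_mat_def by blast
  moreover have dims: "dim_row A = n" "square_mat A" "square_mat B" "dim_row B = n"
    using assms(1-6) by simp_all
  ultimately show ?thesis
    unfolding isometric_def dims(1) dims(4) using assms(3) q dims(2,3)
    by (intro conjI bexI[of _ P] ballI) simp_all
qed

text \<open>A kernel vector of \<open>P\<close> is orthogonal to everything for \<open>B\<close>, so
  the nonsingularity of \<open>B\<close> already makes \<open>P\<close> invertible. Explicit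
  substitutions can thus be given without an inverse.\<close>

lemma isometric_matI:
  assumes A: "A \<in> carrier_mat n n" and B: "B \<in> carrier_mat n n" and nsB: "nonsingular_form B"
    and P: "P \<in> carrier_mat n n"
    and q: "\<And>v. v \<in> carrier_vec n \<Longrightarrow> qval B v = qval A (P *\<^sub>v v)"
  shows "isometric A B"
proof -
  have "v = 0\<^sub>v n" if v: "v \<in> carrier_vec n" and 0: "P *\<^sub>v v = 0\<^sub>v n" for v
  proof (rule nonsingular_formD[OF nsB B v])
    fix w :: "'a vec" assume w: "w \<in> carrier_vec n"
    have "P *\<^sub>v w \<in> carrier_vec n" using P w by auto
    moreover have "P *\<^sub>v (v + w) = P *\<^sub>v v + P *\<^sub>v w" using P v w by (simp add: mult_add_distrib_mat_vec)
    ultimately show "polar B v w = 0"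
      unfolding polar_def using q[of "v + w"] q[OF v] q[OF w] v w A 0 by simp
  qed
  from injective_inverse_mat[OF P this] obtain Q
    where "Q \<in> carrier_mat n n" "P * Q = 1\<^sub>m n" "Q * P = 1\<^sub>m n" by blast
  then show ?thesis using isometric_invI[OF A B P _ _ _ q] by blast
qed

lemma isometricE:
  assumes "isometric A B" "A \<in> carrier_mat n n"
  obtains P Q where "P \<in> carrier_mat n n" "Q \<in> carrier_mat n n" "P * Q = 1\<^sub>m n" "Q * P = 1\<^sub>m n"
    "B \<in> carrier_mat n n" "\<And>v. v \<in> carrier_vec n \<Longrightarrow> qval B v = qval A (P *\<^sub>v v)"
proof -
  have dims: "dim_row A = n" "B \<in> carrier_mat n n"
    using assms unfolding isometric_def by auto
  obtain P where P: "P \<in> carrier_mat n n" "invertible_mat P"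
    "\<forall>v \<in> carrier_vec n. qval B v = qval A (P *\<^sub>v v)"
    using assms(1) unfolding isometric_def dims(1) by (elim conjE bexE) (rule that)
  obtain Q where Q: "P * Q = 1\<^sub>m (dim_row P)" "Q * P = 1\<^sub>m (dim_row Q)"
    using P(2) unfolding invertible_mat_def inverts_mat_def by blast
  have "dim_col Q = n" using arg_cong[OF Q(1), of dim_col] P(1) by simp
  moreover have "dim_row Q = n" using arg_cong[OF Q(2), of dim_col] P(1) by simp
  ultimately have "Q \<in> carrier_mat n n" by auto
  then show ?thesis using that[of P Q] P Q dims by simp
qed

lemma isometric_dim: "isometric A B \<Longrightarrow> dim_row B = dim_row A"
  by (auto simp: isometric_def)

lemma isometric_sym: assumes "isometric A B" shows "isometric B A"
proof -
  define n where "n = dim_row A"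
  have A: "A \<in> carrier_mat n n" using assms by (auto simp: isometric_def n_def)
  from isometricE[OF assms A] obtain P Q where *: "P \<in> carrier_mat n n" "Q \<in> carrier_mat n n"
    "P * Q = 1\<^sub>m n" "Q * P = 1\<^sub>m n" and B: "B \<in> carrier_mat n n"
    "\<And>v. v \<in> carrier_vec n \<Longrightarrow> qval B v = qval A (P *\<^sub>v v)" by metis
  have "qval A v = qval B (Q *\<^sub>v v)" if "v \<in> carrier_vec n" for v
  proof -
    have "Q *\<^sub>v v \<in> carrier_vec n" using * that by auto
    then have "qval B (Q *\<^sub>v v) = qval A (P *\<^sub>v (Q *\<^sub>v v))" using B by blast
    also have "P *\<^sub>v (Q *\<^sub>v v) = v"
      using assoc_mult_mat_vec[OF *(1,2) that] *(3) that by simp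
    finally show ?thesis by simp
  qed
  then show ?thesis using isometric_invI[of B n A Q P] A B(1) * by blast
qed

lemma isometric_refl: assumes "A \<in> carrier_mat n n" shows "isometric A A"
  using assms by (intro isometric_invI[of A n A "1\<^sub>m n" "1\<^sub>m n"]) simp_all

lemma isometric_trans: assumes "isometric A B" "isometric B C" shows "isometric A C"
proof -
  define n where "n = dim_row A"
  have A: "A \<in> carrier_mat n n" using assms by (auto simp: isometric_def n_def)
  from isometricE[OF assms(1) A] obtain P Q where P: "P \<in> carrier_mat n n" "Q \<in> carrier_mat n n"
    "P * Q = 1\<^sub>m n" "Q * P = 1\<^sub>m n" and B: "B \<in> carrier_mat n n"
    "\<And>v. v \<in> carrier_vec n \<Longrightarrow> qval B v = qval A (P *\<^sub>v v)" by metis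
  from isometricE[OF assms(2) B(1)] obtain P' Q' where P': "P' \<in> carrier_mat n n" "Q' \<in> carrier_mat n n"
    "P' * Q' = 1\<^sub>m n" "Q' * P' = 1\<^sub>m n" and C: "C \<in> carrier_mat n n"
    "\<And>v. v \<in> carrier_vec n \<Longrightarrow> qval C v = qval B (P' *\<^sub>v v)" by metis
  have "(P * P') * (Q' * Q) = P * (P' * (Q' * Q))" using P P' by (simp add: assoc_mult_mat[of _ n n _ n _ n])
  also have "P' * (Q' * Q) = (P' * Q') * Q" using P P' assoc_mult_mat[of P' n n Q' n Q n] by simp
  also have "\<dots> = Q" using P P' by simp
  finally have 1: "(P * P') * (Q' * Q) = 1\<^sub>m n" using P P' by simp
  have "(Q' * Q) * (P * P') = Q' * (Q * (P * P'))" using P P' by (simp add: assoc_mult_mat[of _ n n _ n _ n])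
  also have "Q * (P * P') = (Q * P) * P'" using P P' assoc_mult_mat[of Q n n P n P' n] by simp
  also have "\<dots> = P'" using P P' by simp
  finally have 2: "(Q' * Q) * (P * P') = 1\<^sub>m n" using P P' by simp
  have "qval C v = qval A ((P * P') *\<^sub>v v)" if v: "v \<in> carrier_vec n" for v
  proof -
    have "P' *\<^sub>v v \<in> carrier_vec n" using P' v by auto
    then show ?thesis using C(2)[OF v] B(2) assoc_mult_mat_vec[OF P(1) P'(1) v] by simp
  qed
  moreover have "P * P' \<in> carrier_mat n n" "Q' * Q \<in> carrier_mat n n" using P P' by simp_all
  ultimately show ?thesis using isometric_invI[of A n C "P * P'" "Q' * Q"] 1 2 A C(1) by blast
qed

lemma isometric_nonsingular: assumes "isometric A B" "nonsingular_form A" shows "nonsingular_form B"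
proof -
  define n where "n = dim_row A"
  have A: "A \<in> carrier_mat n n" using assms by (auto simp: isometric_def n_def)
  from isometricE[OF assms(1) A] obtain P Q where P: "P \<in> carrier_mat n n" "Q \<in> carrier_mat n n"
    "P * Q = 1\<^sub>m n" "Q * P = 1\<^sub>m n" and B: "B \<in> carrier_mat n n"
    "\<And>v. v \<in> carrier_vec n \<Longrightarrow> qval B v = qval A (P *\<^sub>v v)" by metis
  show ?thesis
  proof (rule nonsingular_formI[OF B(1)])
    fix v assume v: "v \<in> carrier_vec n" and 0: "\<And>w. w \<in> carrier_vec n \<Longrightarrow> polar B v w = 0"
    have Pv: "P *\<^sub>v v \<in> carrier_vec n" using P v by auto
    have "P *\<^sub>v v = 0\<^sub>v n"
    proof (rule nonsingular_formD[OF assms(2) A Pv])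
      fix w :: "'a vec" assume w: "w \<in> carrier_vec n"
      have Qw: "Q *\<^sub>v w \<in> carrier_vec n" using P w by auto
      have PQ: "P *\<^sub>v (Q *\<^sub>v w) = w"
        using assoc_mult_mat_vec[OF P(1,2) w] P(3) w by simp
      have "polar A (P *\<^sub>v v) w = polar B v (Q *\<^sub>v w)"
        unfolding polar_def
        using B(2)[OF v] B(2)[OF Qw] B(2)[of "v + Q *\<^sub>v w"] v Qw PQ
          mult_add_distrib_mat_vec[OF P(1) v Qw] by simp
      then show "polar A (P *\<^sub>v v) w = 0" using 0 Qw by simp
    qed
    then have "Q *\<^sub>v (P *\<^sub>v v) = 0\<^sub>v n" using P(2) by auto
    then show "v = 0\<^sub>v n" using assoc_mult_mat_vec[OF P(2,1) v] P(4) v by simp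
  qed
qed

lemma linear_map_mat:
  fixes T :: "'a::field vec \<Rightarrow> 'a vec"
  assumes T: "\<And>v. v \<in> carrier_vec n \<Longrightarrow> T v \<in> carrier_vec m"
    and add: "\<And>v w. v \<in> carrier_vec n \<Longrightarrow> w \<in> carrier_vec n \<Longrightarrow> T (v + w) = T v + T w"
    and smult: "\<And>c v. v \<in> carrier_vec n \<Longrightarrow> T (c \<cdot>\<^sub>v v) = c \<cdot>\<^sub>v T v"
  obtains P where "P \<in> carrier_mat m n" "\<And>v. v \<in> carrier_vec n \<Longrightarrow> P *\<^sub>v v = T v"
proof -
  define P where "P = mat m n (\<lambda>(i, j). T (unit_vec n j) $ i)"
  have P: "P \<in> carrier_mat m n" by (simp add: P_def)
  have unit: "P *\<^sub>v unit_vec n j = T (unit_vec n j)" if "j < n" for j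
    using T[of "unit_vec n j"] that by (intro eq_vecI) (auto simp: P_def)
  have zero: "T (0\<^sub>v n) = 0\<^sub>v m"
  proof -
    have "T (0 \<cdot>\<^sub>v 0\<^sub>v n) = 0 \<cdot>\<^sub>v T (0\<^sub>v n)" by (rule smult) simp
    moreover have "0 \<cdot>\<^sub>v 0\<^sub>v n = (0\<^sub>v n :: 'a vec)" by (intro eq_vecI) auto
    moreover have "0 \<cdot>\<^sub>v T (0\<^sub>v n) = 0\<^sub>v m" using T[of "0\<^sub>v n"] by (intro eq_vecI) auto
    ultimately show ?thesis by simp
  qed
  \<comment> \<open>\<open>k\<close> bounds the coordinates that may be nonzero; the induction
    splits off the last of them.\<close>
  have "P *\<^sub>v v = T v" if "v \<in> carrier_vec n" "\<And>i. k \<le> i \<Longrightarrow> i < n \<Longrightarrow> v $ i = 0" "k \<le> n" for v k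
    using that
  proof (induction k arbitrary: v)
    case 0
    then have "v = 0\<^sub>v n" by (intro eq_vecI) auto
    moreover have "P *\<^sub>v 0\<^sub>v n = 0\<^sub>v m" using P by (intro eq_vecI) auto
    ultimately show ?case using zero by simp
  next
    case (Suc k)
    define w where "w = v + (- (v $ k)) \<cdot>\<^sub>v unit_vec n k"
    have w: "w \<in> carrier_vec n" using Suc.prems by (simp add: w_def)
    have "P *\<^sub>v w = T w"
    proof (rule Suc.IH[OF w])
      fix i assume "k \<le> i" "i < n"
      then show "w $ i = 0" using Suc.prems by (cases "i = k") (auto simp: w_def)
    qed (use Suc.prems in simp)
    moreover have v: "v = w + (v $ k) \<cdot>\<^sub>v unit_vec n k"
      using Suc.prems by (intro eq_vecI) (auto simp: w_def)
    ultimately have "T v = P *\<^sub>v w + (v $ k) \<cdot>\<^sub>v (P *\<^sub>v unit_vec n k)"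
      using add[of w "(v $ k) \<cdot>\<^sub>v unit_vec n k"] smult[of "unit_vec n k" "v $ k"] w unit[of k] Suc.prems
      by simp
    also have "\<dots> = P *\<^sub>v (w + (v $ k) \<cdot>\<^sub>v unit_vec n k)"
      using mult_add_distrib_mat_vec[OF P w, of "(v $ k) \<cdot>\<^sub>v unit_vec n k"]
        mult_mat_vec[OF P, of "unit_vec n k" "v $ k"] by simp
    finally show ?case using v by simp
  qed
  from this[where k = n] P show ?thesis using that by auto
qed

lemma isometric_linI:
  fixes T :: "'a::field vec \<Rightarrow> 'a vec"
  assumes "A \<in> carrier_mat n n" "B \<in> carrier_mat n n" "nonsingular_form B"
    and "\<And>v. v \<in> carrier_vec n \<Longrightarrow> T v \<in> carrier_vec n"
    and "\<And>v w. v \<in> carrier_vec n \<Longrightarrow> w \<in> carrier_vec n \<Longrightarrow> T (v + w) = T v + T w"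
    and "\<And>c v. v \<in> carrier_vec n \<Longrightarrow> T (c \<cdot>\<^sub>v v) = c \<cdot>\<^sub>v T v"
    and "\<And>v. v \<in> carrier_vec n \<Longrightarrow> qval B v = qval A (T v)"
  shows "isometric A B"
proof -
  obtain P where "P \<in> carrier_mat n n" "\<And>v. v \<in> carrier_vec n \<Longrightarrow> P *\<^sub>v v = T v"
    using linear_map_mat[of n T n] assms by metis
  then show ?thesis using assms by (intro isometric_matI[of A n B P]) auto
qed

text \<open>Dimensions must keep the shape \<open>2 + n\<close> or \<open>n + 2\<close> to match the
  carrier facts of orthogonal sums.\<close>

declare add_2_eq_Suc [simp del] add_2_eq_Suc' [simp del]

section \<open>Orthogonal sums\<close>

lemma orth_sum_carrier [simp, intro]:
  "A \<in> carrier_mat n n \<Longrightarrow> B \<in> carrier_mat m m \<Longrightarrow> orth_sum A B \<in> carrier_mat (n + m) (n + m)"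
  by (auto simp: orth_sum_def)

lemma dim_orth_sum [simp]:
  "dim_row (orth_sum A B) = dim_row A + dim_row B" "dim_col (orth_sum A B) = dim_col A + dim_col B"
  by (auto simp: orth_sum_def)

lemma orth_sum_assoc: "orth_sum A (orth_sum B C) = orth_sum (orth_sum A B) C"
  unfolding orth_sum_def by (rule assoc_four_block_mat)

lemma orth_sum_empty_left [simp]: "orth_sum (0\<^sub>m 0 0) A = A"
  by (intro eq_matI) (auto simp: orth_sum_def)

lemma orth_sum_empty_right [simp]: "orth_sum A (0\<^sub>m 0 0) = A"
  by (intro eq_matI) (auto simp: orth_sum_def)

lemma smult_orth_sum: "c \<cdot>\<^sub>m orth_sum A B = orth_sum (c \<cdot>\<^sub>m A) (c \<cdot>\<^sub>m B)"
  by (intro eq_matI) (auto simp: orth_sum_def)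

lemma qval_orth_sum:
  assumes "A \<in> carrier_mat n n" "B \<in> carrier_mat m m" "v \<in> carrier_vec n" "w \<in> carrier_vec m"
  shows "qval (orth_sum A B) (v @\<^sub>v w) = qval A v + qval B w"
proof -
  have "orth_sum A B *\<^sub>v (v @\<^sub>v w) = A *\<^sub>v v @\<^sub>v B *\<^sub>v w"
    using mult_mat_vec_split[OF assms] assms by (simp add: orth_sum_def)
  moreover have "A *\<^sub>v v \<in> carrier_vec n" "B *\<^sub>v w \<in> carrier_vec m" using assms by auto
  ultimately show ?thesis using assms by (simp add: qval_def scalar_prod_append[of _ n _ m])
qed

lemma polar_orth_sum:
  assumes "A \<in> carrier_mat n n" "B \<in> carrier_mat m m" "v \<in> carrier_vec n" "w \<in> carrier_vec m"
    "v' \<in> carrier_vec n" "w' \<in> carrier_vec m"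
  shows "polar (orth_sum A B) (v @\<^sub>v w) (v' @\<^sub>v w') = polar A v v' + polar B w w'"
  using assms by (simp add: polar_def append_vec_add[of _ n _ _ m] qval_orth_sum[of A n B m])

lemma append_vecE:
  assumes "v \<in> carrier_vec (n + m)"
  obtains a b where "a \<in> carrier_vec n" "b \<in> carrier_vec m" "v = a @\<^sub>v b"
  using vec_first_last_append[OF assms] by (metis vec_first_carrier vec_last_carrier)

lemma append_zero_vec: "0\<^sub>v n @\<^sub>v 0\<^sub>v m = 0\<^sub>v (n + m)"
  by (intro eq_vecI) auto

lemma orth_sum_nonsingular:
  assumes "nonsingular_form A" "nonsingular_form B"
  shows "nonsingular_form (orth_sum A B)"
proof -
  define n m where nm: "n = dim_row A" "m = dim_row B"
  have A: "A \<in> carrier_mat n n" and B: "B \<in> carrier_mat m m"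
    using assms nonsingular_form_carrier nm by auto
  show ?thesis
  proof (rule nonsingular_formI[of _ "n + m"])
    fix v assume "v \<in> carrier_vec (n + m)" and
      0: "\<And>w. w \<in> carrier_vec (n + m) \<Longrightarrow> polar (orth_sum A B) v w = 0"
    then obtain a b where ab: "a \<in> carrier_vec n" "b \<in> carrier_vec m" "v = a @\<^sub>v b"
      by (elim append_vecE)
    have "a = 0\<^sub>v n"
    proof (rule nonsingular_formD[OF assms(1) A ab(1)])
      fix w :: "'a vec" assume w: "w \<in> carrier_vec n"
      have "polar (orth_sum A B) v (w @\<^sub>v 0\<^sub>v m) = 0" using w by (intro 0) auto
      then show "polar A a w = 0"
        using polar_orth_sum[OF A B ab(1,2) w, of "0\<^sub>v m"] ab B
          polar_zero_right[OF B ab(2)] by simp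
    qed
    moreover have "b = 0\<^sub>v m"
    proof (rule nonsingular_formD[OF assms(2) B ab(2)])
      fix w :: "'a vec" assume w: "w \<in> carrier_vec m"
      have "polar (orth_sum A B) v (0\<^sub>v n @\<^sub>v w) = 0" using w by (intro 0) auto
      then show "polar B b w = 0"
        using polar_orth_sum[OF A B ab(1,2) _ w, of "0\<^sub>v n"] ab A
          polar_zero_right[OF A ab(1)] by simp
    qed
    ultimately show "v = 0\<^sub>v (n + m)" using ab by (simp add: append_zero_vec)
  qed (use A B in auto)
qed

lemma orth_sum_isometric_cong:
  assumes "isometric A A'" "isometric B B'"
  shows "isometric (orth_sum A B) (orth_sum A' B')"
proof -
  define n m where nm: "n = dim_row A" "m = dim_row B"
  have A: "A \<in> carrier_mat n n" and B: "B \<in> carrier_mat m m"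
    using assms nm by (auto simp: isometric_def)
  obtain P Q where P: "P \<in> carrier_mat n n" "Q \<in> carrier_mat n n" "P * Q = 1\<^sub>m n" "Q * P = 1\<^sub>m n"
    "A' \<in> carrier_mat n n" "\<And>v. v \<in> carrier_vec n \<Longrightarrow> qval A' v = qval A (P *\<^sub>v v)"
    using isometricE[OF assms(1) A] by blast
  obtain R S where R: "R \<in> carrier_mat m m" "S \<in> carrier_mat m m" "R * S = 1\<^sub>m m" "S * R = 1\<^sub>m m"
    "B' \<in> carrier_mat m m" "\<And>v. v \<in> carrier_vec m \<Longrightarrow> qval B' v = qval B (R *\<^sub>v v)"
    using isometricE[OF assms(2) B] by blast
  define PR where "PR = four_block_mat P (0\<^sub>m n m) (0\<^sub>m m n) R"
  define QS where "QS = four_block_mat Q (0\<^sub>m n m) (0\<^sub>m m n) S"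
  have "PR * QS = 1\<^sub>m (n + m)"
    unfolding PR_def QS_def using P R by (subst mult_four_block_mat[of _ n n _ m _ m]) auto
  moreover have "QS * PR = 1\<^sub>m (n + m)"
    unfolding PR_def QS_def using P R by (subst mult_four_block_mat[of _ n n _ m _ m]) auto
  moreover have "PR \<in> carrier_mat (n + m) (n + m)" "QS \<in> carrier_mat (n + m) (n + m)"
    using P R by (auto simp: PR_def QS_def)
  moreover have "qval (orth_sum A' B') v = qval (orth_sum A B) (PR *\<^sub>v v)"
    if v: "v \<in> carrier_vec (n + m)" for v
  proof -
    obtain a b where ab: "a \<in> carrier_vec n" "b \<in> carrier_vec m" "v = a @\<^sub>v b"
      by (rule append_vecE[OF v])
    have "PR *\<^sub>v v = P *\<^sub>v a @\<^sub>v R *\<^sub>v b"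
      unfolding PR_def ab(3) using mult_mat_vec_split[OF P(1) R(1) ab(1,2)] .
    moreover have "P *\<^sub>v a \<in> carrier_vec n" "R *\<^sub>v b \<in> carrier_vec m" using P R ab by auto
    ultimately show ?thesis
      using ab P R by (simp add: qval_orth_sum[of A n B m, OF A B] qval_orth_sum[of A' n B' m])
  qed
  ultimately show ?thesis
    using isometric_invI[of "orth_sum A B" "n + m" "orth_sum A' B'" PR QS] A B P(5) R(5) by blast
qed

lemma zero_mat_mult_vec: "v \<in> carrier_vec m \<Longrightarrow> 0\<^sub>m n m *\<^sub>v v = 0\<^sub>v n"
  by (intro eq_vecI) auto

lemma orth_sum_isometric_commute:
  assumes "A \<in> carrier_mat n n" "B \<in> carrier_mat m m"
  shows "isometric (orth_sum A B) (orth_sum B A)"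
proof -
  define P :: "'a mat" where "P = four_block_mat (0\<^sub>m n m) (1\<^sub>m n) (1\<^sub>m m) (0\<^sub>m m n)"
  define Q :: "'a mat" where "Q = four_block_mat (0\<^sub>m m n) (1\<^sub>m m) (1\<^sub>m n) (0\<^sub>m n m)"
  have P: "P \<in> carrier_mat (n + m) (m + n)" and Q: "Q \<in> carrier_mat (m + n) (n + m)"
    unfolding P_def Q_def by (rule four_block_carrier_mat; simp)+
  have "P * Q = 1\<^sub>m (n + m)" unfolding P_def Q_def
    by (subst mult_four_block_mat[of _ n m _ n _ m]) auto
  moreover have "Q * P = 1\<^sub>m (m + n)" unfolding P_def Q_def
    by (subst mult_four_block_mat[of _ m n _ m _ n]) auto
  moreover have "qval (orth_sum B A) v = qval (orth_sum A B) (P *\<^sub>v v)"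
    if "v \<in> carrier_vec (n + m)" for v
  proof -
    have v: "v \<in> carrier_vec (m + n)" using that by (simp add: add.commute)
    obtain b a where ab: "b \<in> carrier_vec m" "a \<in> carrier_vec n" "v = b @\<^sub>v a"
      by (rule append_vecE[OF v])
    have "P *\<^sub>v v = a @\<^sub>v b"
      unfolding P_def ab(3) using four_block_mat_mult_vec[of "0\<^sub>m n m :: 'a mat" n m "1\<^sub>m n" n "1\<^sub>m m" m "0\<^sub>m m n" b a] ab
      by (simp add: zero_mat_mult_vec)
    then show ?thesis
      using ab assms by (simp add: qval_orth_sum[of A n B m] qval_orth_sum[of B m A n])
  qed
  moreover have "orth_sum B A \<in> carrier_mat (n + m) (n + m)"
    using assms by (metis add.commute orth_sum_carrier)
  moreover have "P \<in> carrier_mat (n + m) (n + m)" "Q \<in> carrier_mat (n + m) (n + m)"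
    using P Q by (simp_all add: add.commute)
  ultimately show ?thesis
    using isometric_invI[of "orth_sum A B" "n + m" "orth_sum B A" P Q] assms
    by (simp add: add.commute[of m n])
qed

section \<open>Hyperbolic planes\<close>

lemma dim_binary_form [simp]: "dim_row (binary_form a b) = 2" "dim_col (binary_form a b) = 2"
  by (simp_all add: binary_form_def mat_of_rows_list_def)

lemma binary_form_carrier [simp, intro]: "binary_form a b \<in> carrier_mat 2 2"
  by (intro carrier_matI) simp_all

lemma vec2_eq: "v \<in> carrier_vec 2 \<Longrightarrow> v = vec_of_list [v $ 0, v $ 1]"
  by (intro eq_vecI) (auto simp: less_Suc_eq)

lemma qval_binary:
  assumes "v \<in> carrier_vec 2"
  shows "qval (binary_form a b) v = a * (v $ 0)\<^sup>2 + v $ 0 * v $ 1 + b * (v $ 1)\<^sup>2"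
  using qval_binary_form[of a b "v $ 0" "v $ 1"] vec2_eq[OF assms] by simp

lemma polar_binary:
  assumes "v \<in> carrier_vec 2" "w \<in> carrier_vec 2"
  shows "polar (binary_form a b) v w =
    2 * a * v $ 0 * w $ 0 + v $ 0 * w $ 1 + v $ 1 * w $ 0 + 2 * b * v $ 1 * w $ 1"
  using assms by (simp add: polar_def qval_binary power2_eq_square algebra_simps)

lemma hyperbolic_plane_nonsingular: "nonsingular_form (binary_form 0 0 :: 'a::field mat)"
proof (rule nonsingular_formI[of _ 2])
  fix v :: "'a vec" assume v: "v \<in> carrier_vec 2"
    and 0: "\<And>w. w \<in> carrier_vec 2 \<Longrightarrow> polar (binary_form 0 0) v w = 0"
  have "v $ 1 = 0" using 0[of "unit_vec 2 0"] v by (simp add: polar_binary)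
  moreover have "v $ 0 = 0" using 0[of "unit_vec 2 1"] v by (simp add: polar_binary)
  ultimately show "v = 0\<^sub>v 2" using v by (intro eq_vecI) (auto simp: less_2_cases_iff)
qed auto

lemma hyperbolic_sum_0 [simp]: "hyperbolic_sum 0 = 0\<^sub>m 0 0"
  by (simp add: hyperbolic_sum_def)

lemma hyperbolic_sum_Suc: "hyperbolic_sum (Suc m) = orth_sum (binary_form 0 0) (hyperbolic_sum m)"
  by (simp add: hyperbolic_sum_def)

lemma hyperbolic_sum_add: "hyperbolic_sum (m + k) = orth_sum (hyperbolic_sum m) (hyperbolic_sum k)"
  by (induction m) (simp_all add: hyperbolic_sum_Suc orth_sum_assoc)

lemma hyperbolic_sum_Suc': "hyperbolic_sum (Suc m) = orth_sum (hyperbolic_sum m) (binary_form 0 0)"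
  using hyperbolic_sum_add[of m 1] by (simp add: hyperbolic_sum_Suc)

lemma dim_hyperbolic_sum [simp]: "dim_row (hyperbolic_sum m) = 2 * m" "dim_col (hyperbolic_sum m) = 2 * m"
  by (induction m) (simp_all add: hyperbolic_sum_Suc)

lemma hyperbolic_sum_carrier [simp, intro]: "hyperbolic_sum m \<in> carrier_mat (2 * m) (2 * m)"
  by (intro carrier_matI) auto

lemma hyperbolic_sum_nonsingular: "nonsingular_form (hyperbolic_sum m)"
proof (induction m)
  case 0
  show ?case by (rule nonsingular_formI[of _ 0]) auto
next
  case (Suc m)
  then show ?case unfolding hyperbolic_sum_Suc
    by (intro orth_sum_nonsingular hyperbolic_plane_nonsingular)
qed

section \<open>Cancellation of hyperbolic planes\<close>

text \<open>The isometry is the reflection in \<open>x - y\<close>.\<close>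

lemma isotropic_transport:
  assumes C: "C \<in> carrier_mat n n" and x: "x \<in> carrier_vec n" and y: "y \<in> carrier_vec n"
    and 0: "qval C x = 0" "qval C y = 0" and xy: "polar C x y \<noteq> 0"
  obtains R where "R \<in> carrier_mat n n" "R *\<^sub>v x = y"
    "\<And>v. v \<in> carrier_vec n \<Longrightarrow> qval C (R *\<^sub>v v) = qval C v"
proof -
  define u where "u = x + (-1) \<cdot>\<^sub>v y"
  define p where "p = polar C x y"
  have u: "u \<in> carrier_vec n" using x y by (simp add: u_def)
  have qu: "qval C u = - p"
    using 0 x y polar_smult_right[OF C y x, of "-1"] qval_smult[OF C y, of "-1"] by (simp add: u_def qval_add p_def)
  have xu: "polar C x u = - p"
  proof -
    have "polar C u x = polar C x x + polar C ((-1) \<cdot>\<^sub>v y) x"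
      unfolding u_def using polar_add_left[OF C x _ x] y by simp
    also have "polar C x x = 0"
      using 0 polar_eq[OF C x x] by (simp add: qval_def)
    also have "polar C ((-1) \<cdot>\<^sub>v y) x = - p"
      using polar_smult_left[OF C y x, of "-1"] polar_commute[OF x y, of C] by (simp add: p_def)
    finally show ?thesis using polar_commute[OF x u, of C] by simp
  qed
  \<comment> \<open>The reflection v - b(v, u) / q(u) u; the sign turns because q(u) = - p.\<close>
  define T where "T = (\<lambda>v. v + (polar C v u / p) \<cdot>\<^sub>v u)"
  have T1: "T v \<in> carrier_vec n" if "v \<in> carrier_vec n" for v using that u by (simp add: T_def)
  have T2: "T (v + w) = T v + T w" if "v \<in> carrier_vec n" "w \<in> carrier_vec n" for v w
    using that u by (intro eq_vecI) (auto simp: T_def polar_add_left[OF C] add_divide_distrib algebra_simps)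
  have T3: "T (c \<cdot>\<^sub>v v) = c \<cdot>\<^sub>v T v" if "v \<in> carrier_vec n" for c v
    using that u by (intro eq_vecI) (auto simp: T_def polar_smult_left[OF C] algebra_simps)
  obtain R where R: "R \<in> carrier_mat n n" "\<And>v. v \<in> carrier_vec n \<Longrightarrow> R *\<^sub>v v = T v"
    by (rule linear_map_mat[of n T n, OF T1 T2 T3]) auto
  have "R *\<^sub>v x = y"
    using x y xy by (simp add: R T_def xu flip: p_def) (intro eq_vecI, auto simp: u_def)
  moreover have "qval C (R *\<^sub>v v) = qval C v" if v: "v \<in> carrier_vec n" for v
    using v u xy polar_smult_right[OF C u v] qval_smult[OF C u]
    by (simp add: R T_def qval_add qu power2_eq_square field_simps flip: p_def)
  ultimately show ?thesis using that R(1) by blast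
qed

text \<open>A single reflection fails when \<open>x\<close> and \<open>y\<close> are orthogonal.
  Then two reflections are composed, through an isotropic vector \<open>h\<close> that is orthogonal
  to neither.\<close>

lemma isotropic_transitive:
  fixes C :: "'a::field mat"
  assumes C: "C \<in> carrier_mat n n" and ns: "nonsingular_form C"
    and x: "x \<in> carrier_vec n" "x \<noteq> 0\<^sub>v n" "qval C x = 0"
    and y: "y \<in> carrier_vec n" "y \<noteq> 0\<^sub>v n" "qval C y = 0"
  obtains R where "R \<in> carrier_mat n n" "R *\<^sub>v x = y"
    "\<And>v. v \<in> carrier_vec n \<Longrightarrow> qval C (R *\<^sub>v v) = qval C v"
proof (cases "polar C x y = 0")
  case False
  then show ?thesis using isotropic_transport[OF C x(1) y(1) x(3) y(3)] that by blast
next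
  case True
  obtain u where u: "u \<in> carrier_vec n" "polar C x u \<noteq> 0"
    using nonsingular_formD[OF ns C x(1)] x(2) by blast
  obtain w where w: "w \<in> carrier_vec n" "polar C y w \<noteq> 0"
    using nonsingular_formD[OF ns C y(1)] y(2) by blast
  \<comment> \<open>A space is not the union of two proper subspaces, here the orthogonal
    complements of \<open>x\<close> and \<open>y\<close>.\<close>
  have "\<exists>g \<in> carrier_vec n. polar C x g \<noteq> 0 \<and> polar C y g \<noteq> 0"
  proof (cases "polar C y u = 0 \<and> polar C x w = 0")
    case True
    then show ?thesis
      using u w polar_add_right[OF C u(1) w(1)] x(1) y(1) by (intro bexI[of _ "u + w"]) auto
  qed (use u w in blast)
  then obtain g where g: "g \<in> carrier_vec n" "polar C x g \<noteq> 0" "polar C y g \<noteq> 0" by blast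
  \<comment> \<open>This multiple of \<open>x\<close> makes the vector isotropic. It does not change
    the pairings with \<open>x\<close> and \<open>y\<close>, which are both orthogonal to
    \<open>x\<close>.\<close>
  define h where "h = g + (- qval C g / polar C x g) \<cdot>\<^sub>v x"
  have h: "h \<in> carrier_vec n" using g x by (simp add: h_def)
  have qh: "qval C h = 0"
    using g x polar_smult_right[OF C x(1) g(1)] polar_commute[OF g(1) x(1), of C]
    by (simp add: h_def qval_add qval_smult[OF C x(1)])
  have pol: "polar C z h = polar C z g" if "z \<in> carrier_vec n" "polar C z x = 0" for z
    using that g x polar_add_right[OF C g(1) _ that(1)] polar_smult_right[OF C x(1) that(1)]
    by (simp add: h_def)
  have "polar C x x = 0" using x polar_eq[OF C x(1) x(1)] by (simp add: qval_def)
  then have xh: "polar C x h \<noteq> 0" using pol[OF x(1)] g by simp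
  have hy: "polar C h y \<noteq> 0"
    using pol[OF y(1)] True g polar_commute[OF x(1) y(1), of C] polar_commute[OF h y(1), of C] by simp
  obtain R where R: "R \<in> carrier_mat n n" "R *\<^sub>v x = h"
    "\<And>v. v \<in> carrier_vec n \<Longrightarrow> qval C (R *\<^sub>v v) = qval C v"
    using isotropic_transport[OF C x(1) h x(3) qh xh] by blast
  obtain S where S: "S \<in> carrier_mat n n" "S *\<^sub>v h = y"
    "\<And>v. v \<in> carrier_vec n \<Longrightarrow> qval C (S *\<^sub>v v) = qval C v"
    using isotropic_transport[OF C h y(1) qh y(3) hy] by blast
  have SR: "(S * R) *\<^sub>v v = S *\<^sub>v (R *\<^sub>v v)" if "v \<in> carrier_vec n" for v
    using assoc_mult_mat_vec[OF S(1) R(1) that] .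
  show ?thesis
  proof (rule that[of "S * R"])
    show "S * R \<in> carrier_mat n n" using S(1) R(1) by simp
    show "(S * R) *\<^sub>v x = y" using SR[OF x(1)] R(2) S(2) by simp
    show "qval C ((S * R) *\<^sub>v v) = qval C v" if v: "v \<in> carrier_vec n" for v
    proof -
      have "R *\<^sub>v v \<in> carrier_vec n" using R(1) v by simp
      then show ?thesis using S(3) R(3)[OF v] SR[OF v] by simp
    qed
  qed
qed

text \<open>Up to an isometry of \<open>A \<bottom> H\<close>, the given isometry fixes the first basis vector \<open>E\<close> of \<open>H\<close>. Then it
  maps \<open>B\<close> into the orthogonal complement \<open>A \<bottom> \<langle>E\<rangle>\<close> of \<open>E\<close>, and \<open>E\<close> does not contribute to the value of
  the form.\<close>

lemma hyperbolic_plane_cancel: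
  fixes A B :: "'a::field mat"
  assumes A: "A \<in> carrier_mat n n" and B: "B \<in> carrier_mat n n"
    and ns: "nonsingular_form A" "nonsingular_form B"
    and iso: "isometric (orth_sum A (binary_form 0 0)) (orth_sum B (binary_form 0 0))"
  shows "isometric A B"
proof -
  define H :: "'a mat" where "H = binary_form 0 0"
  have H: "H \<in> carrier_mat 2 2" by (simp add: H_def)
  define C where "C = orth_sum A H"
  define D where "D = orth_sum B H"
  have C: "C \<in> carrier_mat (n + 2) (n + 2)" and D: "D \<in> carrier_mat (n + 2) (n + 2)"
    using A B H by (auto simp: C_def D_def)
  define e :: "'a vec" where "e = unit_vec 2 0"
  have ec: "e \<in> carrier_vec 2" by (simp add: e_def)
  have qH: "qval H v = v $ 0 * v $ 1" if "v \<in> carrier_vec 2" for v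
    using that by (simp add: H_def qval_binary)
  have pH: "polar H v w = v $ 0 * w $ 1 + v $ 1 * w $ 0" if "v \<in> carrier_vec 2" "w \<in> carrier_vec 2" for v w
    using that by (simp add: H_def polar_binary)
  define E where "E = 0\<^sub>v n @\<^sub>v e"
  have E: "E \<in> carrier_vec (n + 2)" "qval C E = 0" "E \<noteq> 0\<^sub>v (n + 2)"
  proof -
    show "E \<in> carrier_vec (n + 2)" using ec by (simp add: E_def)
    show "qval C E = 0" unfolding C_def E_def using A H ec by (simp add: qval_orth_sum[of A n H 2] qH e_def)
    have "E $ n = 1" by (simp add: E_def e_def)
    then show "E \<noteq> 0\<^sub>v (n + 2)" by auto
  qed
  from isometricE[OF iso[folded H_def C_def, folded D_def] C] obtain P Q
    where P: "P \<in> carrier_mat (n + 2) (n + 2)" and Q: "Q \<in> carrier_mat (n + 2) (n + 2)"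
      and QP: "Q * P = 1\<^sub>m (n + 2)"
      and qP: "\<And>v. v \<in> carrier_vec (n + 2) \<Longrightarrow> qval D v = qval C (P *\<^sub>v v)"
    by metis
  define E' where "E' = P *\<^sub>v E"
  have E': "E' \<in> carrier_vec (n + 2)" using P E by (simp add: E'_def)
  have qE': "qval C E' = 0"
  proof -
    have "qval C E' = qval D E" using qP E by (simp add: E'_def)
    also have "\<dots> = 0" unfolding D_def E_def using B H ec by (simp add: qval_orth_sum[of B n H 2] qH e_def)
    finally show ?thesis .
  qed
  have E'0: "E' \<noteq> 0\<^sub>v (n + 2)"
  proof
    assume "E' = 0\<^sub>v (n + 2)"
    moreover have "Q *\<^sub>v 0\<^sub>v (n + 2) = 0\<^sub>v (n + 2)" using Q by (intro eq_vecI) auto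
    ultimately have "Q *\<^sub>v (P *\<^sub>v E) = 0\<^sub>v (n + 2)" by (simp add: E'_def)
    then show False using assoc_mult_mat_vec[OF Q P E(1)] QP E by simp
  qed
  have polE: "polar C (b @\<^sub>v k) (a' @\<^sub>v k') = polar A b a' + polar H k k'"
    if "b \<in> carrier_vec n" "a' \<in> carrier_vec n" "k \<in> carrier_vec 2" "k' \<in> carrier_vec 2" for b a' k k'
    unfolding C_def using polar_orth_sum[OF A H] that by simp
  have "nonsingular_form C"
    unfolding C_def H_def by (rule orth_sum_nonsingular[OF ns(1) hyperbolic_plane_nonsingular])
  then obtain R where R: "R \<in> carrier_mat (n + 2) (n + 2)" "R *\<^sub>v E' = E"
    "\<And>v. v \<in> carrier_vec (n + 2) \<Longrightarrow> qval C (R *\<^sub>v v) = qval C v"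
    using isotropic_transitive[OF C _ E' E'0 qE' E(1,3,2)] by blast
  define U where "U v = R *\<^sub>v (P *\<^sub>v v)" for v
  have U: "U v \<in> carrier_vec (n + 2)" if "v \<in> carrier_vec (n + 2)" for v
    using that P R(1) by (simp add: U_def)
  have Uadd: "U (v + w) = U v + U w" if "v \<in> carrier_vec (n + 2)" "w \<in> carrier_vec (n + 2)" for v w
    using that P R(1) by (simp add: U_def mult_add_distrib_mat_vec[of _ "n + 2" "n + 2"])
  have Usm: "U (c \<cdot>\<^sub>v v) = c \<cdot>\<^sub>v U v" if "v \<in> carrier_vec (n + 2)" for v c
    using that P R(1) by (simp add: U_def mult_mat_vec[of _ "n + 2" "n + 2"])
  have UE: "U E = E" using R E' by (simp add: U_def E'_def)
  have qU: "qval C (U v) = qval D v" if "v \<in> carrier_vec (n + 2)" for v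
  proof -
    have "P *\<^sub>v v \<in> carrier_vec (n + 2)" using P that by simp
    then show ?thesis using R(3) qP[OF that] by (simp add: U_def)
  qed
  have polU: "polar C (U v) (U w) = polar D v w" if "v \<in> carrier_vec (n + 2)" "w \<in> carrier_vec (n + 2)" for v w
    using that by (simp add: polar_def qU flip: Uadd)
  define T where "T b = vec_first (U (b @\<^sub>v 0\<^sub>v 2)) n" for b
  have split: "\<exists>x. U (b @\<^sub>v 0\<^sub>v 2) = T b @\<^sub>v (x \<cdot>\<^sub>v e)" if b: "b \<in> carrier_vec n" for b
  proof -
    have b2: "b @\<^sub>v 0\<^sub>v 2 \<in> carrier_vec (n + 2)" using b by simp
    define k where "k = vec_last (U (b @\<^sub>v 0\<^sub>v 2)) 2"
    have k: "k \<in> carrier_vec 2" by (simp add: k_def)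
    have Ub: "U (b @\<^sub>v 0\<^sub>v 2) = T b @\<^sub>v k"
      using vec_first_last_append[OF U[OF b2]] by (simp add: T_def k_def)
    have Tb: "T b \<in> carrier_vec n" by (simp add: T_def)
    have "polar C (T b @\<^sub>v k) E = polar D (b @\<^sub>v 0\<^sub>v 2) E"
      using polU[OF b2 E(1)] UE Ub by simp
    also have "\<dots> = 0"
      unfolding D_def E_def using polar_orth_sum[OF B H b _ _ ec, of "0\<^sub>v 2" "0\<^sub>v n"]
        polar_zero_right[OF B b] polar_zero_left[OF H ec] by simp
    finally have "k $ 1 = 0"
      using polE[OF Tb _ k ec, of "0\<^sub>v n"] polar_zero_right[OF A Tb] pH[OF k ec] by (simp add: E_def e_def)
    then have "k = k $ 0 \<cdot>\<^sub>v e" using k by (intro eq_vecI) (auto simp: e_def less_2_cases_iff)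
    then show ?thesis using Ub by metis
  qed
  show ?thesis
  proof (rule isometric_linI[OF A B ns(2), of T])
    fix v w :: "'a vec" assume v: "v \<in> carrier_vec n" and w: "w \<in> carrier_vec n"
    have "(v + w) @\<^sub>v 0\<^sub>v 2 = (v @\<^sub>v 0\<^sub>v 2) + (w @\<^sub>v 0\<^sub>v 2)"
      using v w by (simp add: append_vec_add[of v n w "0\<^sub>v 2" 2 "0\<^sub>v 2"])
    then have "U ((v + w) @\<^sub>v 0\<^sub>v 2) = U (v @\<^sub>v 0\<^sub>v 2) + U (w @\<^sub>v 0\<^sub>v 2)"
      using Uadd v w by simp
    then show "T (v + w) = T v + T w"
      using U[of "v @\<^sub>v 0\<^sub>v 2"] U[of "w @\<^sub>v 0\<^sub>v 2"] v w
      by (intro eq_vecI) (auto simp: T_def vec_first_def)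
  next
    fix v :: "'a vec" and c assume v: "v \<in> carrier_vec n"
    have "(c \<cdot>\<^sub>v v) @\<^sub>v 0\<^sub>v 2 = c \<cdot>\<^sub>v (v @\<^sub>v 0\<^sub>v 2)"
      by (intro eq_vecI) auto
    then have "U ((c \<cdot>\<^sub>v v) @\<^sub>v 0\<^sub>v 2) = c \<cdot>\<^sub>v U (v @\<^sub>v 0\<^sub>v 2)"
      using Usm v by simp
    then show "T (c \<cdot>\<^sub>v v) = c \<cdot>\<^sub>v T v"
      using U[of "v @\<^sub>v 0\<^sub>v 2"] v by (intro eq_vecI) (auto simp: T_def vec_first_def)
  next
    fix v :: "'a vec" assume v: "v \<in> carrier_vec n"
    obtain x where x: "U (v @\<^sub>v 0\<^sub>v 2) = T v @\<^sub>v (x \<cdot>\<^sub>v e)" using split[OF v] by blast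
    have "qval B v = qval D (v @\<^sub>v 0\<^sub>v 2)"
      unfolding D_def using B H v by (simp add: qval_orth_sum[of B n H 2])
    also have "\<dots> = qval C (T v @\<^sub>v (x \<cdot>\<^sub>v e))" using qU[of "v @\<^sub>v 0\<^sub>v 2"] v x by simp
    also have "\<dots> = qval A (T v)"
      unfolding C_def using A H ec by (simp add: qval_orth_sum[of A n H 2] T_def qH e_def)
    finally show "qval B v = qval A (T v)" .
  qed (simp add: T_def)
qed

lemma hyperbolic_sum_cancel:
  assumes "nonsingular_form A" "nonsingular_form B" "dim_row A = dim_row B"
    and "isometric (orth_sum A (hyperbolic_sum m)) (orth_sum B (hyperbolic_sum m))"
  shows "isometric A B"
  using assms(4)
proof (induction m)
  case (Suc m)
  have "nonsingular_form (orth_sum A (hyperbolic_sum m))" "nonsingular_form (orth_sum B (hyperbolic_sum m))"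
    using assms by (auto intro: orth_sum_nonsingular hyperbolic_sum_nonsingular)
  moreover from this have "orth_sum A (hyperbolic_sum m) \<in> carrier_mat (dim_row A + 2 * m) (dim_row A + 2 * m)"
    "orth_sum B (hyperbolic_sum m) \<in> carrier_mat (dim_row A + 2 * m) (dim_row A + 2 * m)"
    using assms(3) nonsingular_form_carrier by fastforce+
  ultimately show ?case
    using Suc hyperbolic_plane_cancel by (simp add: hyperbolic_sum_Suc' orth_sum_assoc) blast
qed simp

section \<open>The Witt group\<close>

lemma even_forms_carrier: "A \<in> even_forms \<Longrightarrow> A \<in> carrier_mat (dim_row A) (dim_row A)"
  by (simp add: even_forms_def nonsingular_form_carrier)

lemma orth_sum_even_forms [intro]:
  "A \<in> even_forms \<Longrightarrow> B \<in> even_forms \<Longrightarrow> orth_sum A B \<in> even_forms"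
  by (simp add: even_forms_def orth_sum_nonsingular)

lemma hyperbolic_sum_even_forms [simp, intro]: "hyperbolic_sum m \<in> even_forms"
  by (simp add: even_forms_def hyperbolic_sum_nonsingular)

lemma zero_even_forms [simp, intro]: "0\<^sub>m 0 0 \<in> even_forms"
  using hyperbolic_sum_even_forms[of 0] by simp

lemma isometric_even_forms: "isometric A B \<Longrightarrow> A \<in> even_forms \<Longrightarrow> B \<in> even_forms"
  by (auto simp: even_forms_def isometric_dim intro: isometric_nonsingular)

lemma isometric_even_forms': "isometric A B \<Longrightarrow> B \<in> even_forms \<Longrightarrow> A \<in> even_forms"
  using isometric_even_forms isometric_sym by blast

lemma witt_relI:
  "A \<in> even_forms \<Longrightarrow> B \<in> even_forms \<Longrightarrow>
    isometric (orth_sum A (hyperbolic_sum m)) (orth_sum B (hyperbolic_sum n)) \<Longrightarrow> (A, B) \<in> witt_rel"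
  unfolding witt_rel_def by blast

lemma witt_relE:
  assumes "(A, B) \<in> witt_rel"
  obtains m n where "A \<in> even_forms" "B \<in> even_forms"
    "isometric (orth_sum A (hyperbolic_sum m)) (orth_sum B (hyperbolic_sum n))"
  using assms unfolding witt_rel_def by blast

lemma isometric_witt_rel:
  assumes "isometric A B" "A \<in> even_forms"
  shows "(A, B) \<in> witt_rel"
  using assms isometric_even_forms[OF assms] by (intro witt_relI[of _ _ 0 0]) auto

lemma isometric_add_hyperbolic:
  assumes "isometric (orth_sum A (hyperbolic_sum m)) (orth_sum B (hyperbolic_sum n))"
  shows "isometric (orth_sum A (hyperbolic_sum (m + k))) (orth_sum B (hyperbolic_sum (n + k)))"
  using orth_sum_isometric_cong[OF assms isometric_refl[OF hyperbolic_sum_carrier[of k]]]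
  by (simp add: hyperbolic_sum_add orth_sum_assoc)

lemma equiv_witt_rel: "equiv even_forms (witt_rel :: ('a::field mat \<times> 'a mat) set)"
proof (rule equivI)
  show "(witt_rel :: ('a mat \<times> 'a mat) set) \<subseteq> even_forms \<times> even_forms" unfolding witt_rel_def by blast
  show "refl_on even_forms (witt_rel :: ('a mat \<times> 'a mat) set)"
    unfolding refl_on_def using isometric_witt_rel isometric_refl[OF even_forms_carrier] by blast
  show "sym (witt_rel :: ('a mat \<times> 'a mat) set)" unfolding sym_def witt_rel_def using isometric_sym by blast
  show "trans (witt_rel :: ('a mat \<times> 'a mat) set)"
  proof (rule transI)
    fix A B C :: "'a mat"
    assume "(A, B) \<in> witt_rel" "(B, C) \<in> witt_rel"
    then obtain m n k l where *: "A \<in> even_forms" "C \<in> even_forms"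
      "isometric (orth_sum A (hyperbolic_sum m)) (orth_sum B (hyperbolic_sum n))"
      "isometric (orth_sum B (hyperbolic_sum k)) (orth_sum C (hyperbolic_sum l))"
      by (elim witt_relE)
    \<comment> \<open>Padding with each other's planes turns both middle terms into \<open>B\<close>
      plus \<open>n + k\<close> planes.\<close>
    from isometric_add_hyperbolic[OF *(3), of k] isometric_add_hyperbolic[OF *(4), of n]
    have "isometric (orth_sum A (hyperbolic_sum (m + k))) (orth_sum C (hyperbolic_sum (l + n)))"
      using isometric_trans by (simp add: add.commute) blast
    then show "(A, C) \<in> witt_rel" using * by (intro witt_relI)
  qed
qed

lemma witt_class_eq_iff:
  "A \<in> even_forms \<Longrightarrow> B \<in> even_forms \<Longrightarrow> witt_class A = witt_class B \<longleftrightarrow> (A, B) \<in> witt_rel"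
  unfolding witt_class_def using eq_equiv_class_iff[OF equiv_witt_rel] by blast

lemma witt_class_isometric: "isometric A B \<Longrightarrow> A \<in> even_forms \<Longrightarrow> witt_class A = witt_class B"
  using witt_class_eq_iff[of A B] isometric_witt_rel[of A B] isometric_even_forms[of A B] by simp

lemma mem_witt_class: "B \<in> witt_class A \<longleftrightarrow> (A, B) \<in> witt_rel"
  by (simp add: witt_class_def)

lemma orth_sum_rotate:
  assumes "A \<in> carrier_mat a a" "B \<in> carrier_mat b b" "C \<in> carrier_mat c c" "D \<in> carrier_mat d d"
  shows "isometric (orth_sum (orth_sum A B) (orth_sum C D)) (orth_sum (orth_sum A C) (orth_sum B D))"
proof -
  have "isometric (orth_sum A (orth_sum (orth_sum B C) D)) (orth_sum A (orth_sum (orth_sum C B) D))"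
    using assms by (intro orth_sum_isometric_cong isometric_refl[of _ a] isometric_refl[of _ d]
        orth_sum_isometric_commute) auto
  then show ?thesis by (simp add: orth_sum_assoc)
qed

lemma witt_rel_orth_sum:
  assumes "(A, A') \<in> witt_rel" "(B, B') \<in> witt_rel"
  shows "(orth_sum A B, orth_sum A' B') \<in> witt_rel"
proof -
  obtain m n k l where *: "A \<in> even_forms" "B \<in> even_forms" "A' \<in> even_forms" "B' \<in> even_forms"
    "isometric (orth_sum A (hyperbolic_sum m)) (orth_sum A' (hyperbolic_sum n))"
    "isometric (orth_sum B (hyperbolic_sum k)) (orth_sum B' (hyperbolic_sum l))"
    using assms by (elim witt_relE)
  note c = even_forms_carrier
  have "isometric (orth_sum (orth_sum A B) (orth_sum (hyperbolic_sum m) (hyperbolic_sum k)))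
    (orth_sum (orth_sum A (hyperbolic_sum m)) (orth_sum B (hyperbolic_sum k)))"
    using * by (intro orth_sum_rotate[OF c c c c]) auto
  moreover have "isometric (orth_sum (orth_sum A (hyperbolic_sum m)) (orth_sum B (hyperbolic_sum k)))
    (orth_sum (orth_sum A' (hyperbolic_sum n)) (orth_sum B' (hyperbolic_sum l)))"
    by (rule orth_sum_isometric_cong[OF *(5,6)])
  moreover have "isometric (orth_sum (orth_sum A' (hyperbolic_sum n)) (orth_sum B' (hyperbolic_sum l)))
    (orth_sum (orth_sum A' B') (orth_sum (hyperbolic_sum n) (hyperbolic_sum l)))"
    using * by (intro orth_sum_rotate[OF c c c c]) auto
  ultimately have "isometric (orth_sum (orth_sum A B) (hyperbolic_sum (m + k)))
    (orth_sum (orth_sum A' B') (hyperbolic_sum (n + l)))"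
    unfolding hyperbolic_sum_add using isometric_trans by blast
  then show ?thesis using * by (intro witt_relI) auto
qed

abbreviation witt_add :: "'a::field mat set \<Rightarrow> 'a mat set \<Rightarrow> 'a mat set" (infixl "\<boxplus>" 70) where
  "x \<boxplus> y \<equiv> x \<otimes>\<^bsub>Iq1\<^esub> y"

lemma Iq1_mult:
  assumes "A \<in> even_forms" "B \<in> even_forms"
  shows "witt_class A \<otimes>\<^bsub>Iq1\<^esub> witt_class B = witt_class (orth_sum A B)"
proof -
  have 1: "witt_class (orth_sum A' B') = witt_class (orth_sum A B)"
    if "A' \<in> witt_class A" "B' \<in> witt_class B" for A' B'
  proof -
    have "(A, A') \<in> witt_rel" "(B, B') \<in> witt_rel" using that by (simp_all add: mem_witt_class)
    moreover from this have "A' \<in> even_forms" "B' \<in> even_forms" by (auto elim: witt_relE)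
    ultimately show ?thesis
      using witt_rel_orth_sum[of A A' B B'] witt_class_eq_iff[of "orth_sum A B" "orth_sum A' B'"] assms
      by (simp add: orth_sum_even_forms)
  qed
  have 2: "A \<in> witt_class A" "B \<in> witt_class B"
    using assms by (simp_all add: mem_witt_class isometric_witt_rel isometric_refl[OF even_forms_carrier])
  have "(\<Union>A'\<in>witt_class A. \<Union>B'\<in>witt_class B. witt_class (orth_sum A' B')) =
      witt_class (orth_sum A B)"
  proof
    show "(\<Union>A'\<in>witt_class A. \<Union>B'\<in>witt_class B. witt_class (orth_sum A' B')) \<subseteq>
      witt_class (orth_sum A B)" by (intro UN_least) (simp add: 1)
    show "witt_class (orth_sum A B) \<subseteq>
      (\<Union>A'\<in>witt_class A. \<Union>B'\<in>witt_class B. witt_class (orth_sum A' B'))"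
      using 2 by blast
  qed
  then show ?thesis by (simp add: Iq1_def)
qed

lemma carrier_Iq1: "carrier Iq1 = witt_class ` even_forms"
  by (auto simp: Iq1_def quotient_def witt_class_def)

lemma one_Iq1: "\<one>\<^bsub>Iq1\<^esub> = witt_class (0\<^sub>m 0 0)"
  by (simp add: Iq1_def)

lemma witt_class_hyperbolic_sum: "witt_class (hyperbolic_sum m) = \<one>\<^bsub>Iq1\<^esub>"
  unfolding one_Iq1
  by (subst witt_class_eq_iff) (auto intro!: witt_relI[of _ _ 0 m] isometric_refl)

lemma comm_monoid_Iq1: "comm_monoid (Iq1 :: 'a::field mat set monoid)"
proof (rule comm_monoidI)
  show "\<one>\<^bsub>Iq1\<^esub> \<in> carrier (Iq1 :: 'a mat set monoid)" by (simp add: one_Iq1 carrier_Iq1)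
next
  fix x y :: "'a mat set"
  assume "x \<in> carrier Iq1" "y \<in> carrier Iq1"
  then obtain A B where *: "A \<in> even_forms" "B \<in> even_forms" "x = witt_class A" "y = witt_class B"
    by (auto simp: carrier_Iq1)
  then show "x \<otimes>\<^bsub>Iq1\<^esub> y \<in> carrier Iq1" by (auto simp: carrier_Iq1 Iq1_mult)
  have "isometric (orth_sum A B) (orth_sum B A)"
    using * by (intro orth_sum_isometric_commute[OF even_forms_carrier even_forms_carrier])
  then show "x \<otimes>\<^bsub>Iq1\<^esub> y = y \<otimes>\<^bsub>Iq1\<^esub> x"
    using * by (simp add: Iq1_mult) (intro witt_class_isometric, auto)
next
  fix x y z :: "'a mat set"
  assume "x \<in> carrier Iq1" "y \<in> carrier Iq1" "z \<in> carrier Iq1"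
  then obtain A B C where *: "A \<in> even_forms" "B \<in> even_forms" "C \<in> even_forms"
    "x = witt_class A" "y = witt_class B" "z = witt_class C"
    by (auto simp: carrier_Iq1)
  then show "x \<otimes>\<^bsub>Iq1\<^esub> y \<otimes>\<^bsub>Iq1\<^esub> z = x \<otimes>\<^bsub>Iq1\<^esub> (y \<otimes>\<^bsub>Iq1\<^esub> z)"
    by (simp add: Iq1_mult orth_sum_even_forms orth_sum_assoc)
next
  fix x :: "'a mat set"
  assume "x \<in> carrier Iq1"
  then obtain A where "A \<in> even_forms" "x = witt_class A" by (auto simp: carrier_Iq1)
  then show "\<one>\<^bsub>Iq1\<^esub> \<otimes>\<^bsub>Iq1\<^esub> x = x" by (simp add: one_Iq1 Iq1_mult)
qed

text \<open>Equal dimensions force equally many hyperbolic planes on both sides, and these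
  cancel.\<close>

lemma witt_class_eq_imp_isometric:
  assumes "A \<in> even_forms" "B \<in> even_forms" "dim_row A = dim_row B" "witt_class A = witt_class B"
  shows "isometric A B"
proof -
  from assms obtain m n where iso: "isometric (orth_sum A (hyperbolic_sum m)) (orth_sum B (hyperbolic_sum n))"
    using witt_class_eq_iff[of A B] by (auto elim: witt_relE)
  from isometric_dim[OF iso] assms(3) have "m = n" by simp
  then show ?thesis
    using iso assms by (intro hyperbolic_sum_cancel[of A B m]) (auto simp: even_forms_def)
qed

lemma witt_class_one_imp_hyperbolic:
  assumes "A \<in> even_forms" "witt_class A = \<one>\<^bsub>Iq1\<^esub>"
  shows "hyperbolic A"
proof -
  obtain k where "dim_row A = 2 * k" using assms(1) by (auto simp: even_forms_def)
  then have "isometric A (hyperbolic_sum k)"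
    using assms by (intro witt_class_eq_imp_isometric) (auto simp: witt_class_hyperbolic_sum)
  then show ?thesis by (auto simp: hyperbolic_def)
qed

text \<open>By cancellation the larger form is the smaller one plus hyperbolic planes; a basis
  vector of the first plane is isotropic.\<close>

lemma witt_class_eq_imp_isotropic:
  assumes A: "A \<in> even_forms" and B: "B \<in> even_forms" and "dim_row B < dim_row A"
    and "witt_class A = witt_class B"
  obtains v where "v \<in> carrier_vec (dim_row A)" "v \<noteq> 0\<^sub>v (dim_row A)" "qval A v = 0"
proof -
  interpret comm_monoid Iq1 by (rule comm_monoid_Iq1)
  define b where "b = dim_row B"
  define n where "n = dim_row A"
  have "even (dim_row A - dim_row B)" using A B by (auto simp: even_forms_def)
  moreover have "dim_row A - dim_row B > 0" using assms by simp
  \<comment> \<open>\<open>Suc k\<close> is the number of planes: the difference of the dimensions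
    is even and positive, so there is at least one.\<close>
  ultimately obtain k where "dim_row A - dim_row B = 2 * Suc k"
    by (metis evenE mult_0_right not0_implies_Suc neq0_conv)
  then have dims: "n = 2 + (2 * k + b)" using assms by (simp add: n_def b_def)
  have cB: "B \<in> carrier_mat b b" and cA: "A \<in> carrier_mat n n"
    using B A even_forms_carrier by (auto simp: b_def n_def)
  have "witt_class (orth_sum (hyperbolic_sum (Suc k)) B) = witt_class A"
    using B assms(4) by (simp flip: Iq1_mult add: witt_class_hyperbolic_sum carrier_Iq1)
  then have "isometric A (orth_sum (hyperbolic_sum (Suc k)) B)"
    using A B dims by (intro witt_class_eq_imp_isometric) (auto simp: n_def b_def)
  then have "isometric A (orth_sum (binary_form 0 0) (orth_sum (hyperbolic_sum k) B))" (is "isometric A ?C")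
    by (simp add: hyperbolic_sum_Suc orth_sum_assoc)
  from isometricE[OF this cA] obtain P Q where P: "P \<in> carrier_mat n n" and Q: "Q \<in> carrier_mat n n"
    and QP: "Q * P = 1\<^sub>m n" and q: "\<And>v. v \<in> carrier_vec n \<Longrightarrow> qval ?C v = qval A (P *\<^sub>v v)"
    by metis
  define v where "v = unit_vec 2 0 @\<^sub>v (0\<^sub>v (2 * k + b) :: 'a vec)"
  have v: "v \<in> carrier_vec n" by (simp add: v_def dims)
  have "v $ 0 = 1" by (simp add: v_def)
  then have v0: "v \<noteq> 0\<^sub>v n" using dims by auto
  have "orth_sum (hyperbolic_sum k) B \<in> carrier_mat (2 * k + b) (2 * k + b)" using cB by auto
  then have "qval ?C v = 0"
    unfolding v_def by (subst qval_orth_sum[of _ 2 _ "2 * k + b"]) (auto simp: qval_binary)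
  then have "qval A (P *\<^sub>v v) = 0" using q[OF v] by simp
  moreover have "P *\<^sub>v v \<noteq> 0\<^sub>v n"
  proof
    assume "P *\<^sub>v v = 0\<^sub>v n"
    moreover have "Q *\<^sub>v 0\<^sub>v n = 0\<^sub>v n" using Q by (intro eq_vecI) auto
    ultimately show False using assoc_mult_mat_vec[OF Q P v] QP v v0 by simp
  qed
  moreover have "P *\<^sub>v v \<in> carrier_vec n" using P v by simp
  ultimately show ?thesis using that by (simp add: n_def)
qed

section \<open>Forms over a field of characteristic 2\<close>

lemma smult_isometric:
  assumes "isometric A B"
  shows "isometric (c \<cdot>\<^sub>m A) (c \<cdot>\<^sub>m B)"
proof -
  define n where "n = dim_row A"
  have A: "A \<in> carrier_mat n n" using assms by (auto simp: isometric_def n_def)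
  obtain P Q where P: "P \<in> carrier_mat n n" "Q \<in> carrier_mat n n" "P * Q = 1\<^sub>m n" "Q * P = 1\<^sub>m n"
    and B: "B \<in> carrier_mat n n" and q: "\<And>v. v \<in> carrier_vec n \<Longrightarrow> qval B v = qval A (P *\<^sub>v v)"
    using isometricE[OF assms A] by metis
  have "qval (c \<cdot>\<^sub>m B) v = qval (c \<cdot>\<^sub>m A) (P *\<^sub>v v)" if "v \<in> carrier_vec n" for v
  proof -
    have "P *\<^sub>v v \<in> carrier_vec n" using P that by simp
    then show ?thesis using q[OF that] qval_smult_mat[OF A] qval_smult_mat[OF B that] by simp
  qed
  then show ?thesis using isometric_invI[of "c \<cdot>\<^sub>m A" n "c \<cdot>\<^sub>m B" P Q] A B P by simp
qed

lemma qval_orth_sum_split: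
  assumes "A \<in> carrier_mat n n" "B \<in> carrier_mat m m" "v \<in> carrier_vec (n + m)"
  shows "qval (orth_sum A B) v = qval A (vec_first v n) + qval B (vec_last v m)"
  using qval_orth_sum[OF assms(1,2), of "vec_first v n" "vec_last v m"] assms by simp

lemma smult_nonsingular:
  assumes "nonsingular_form A" "c \<noteq> 0"
  shows "nonsingular_form (c \<cdot>\<^sub>m A)"
proof -
  define n where "n = dim_row A"
  have A: "A \<in> carrier_mat n n" using assms nonsingular_form_carrier n_def by auto
  show ?thesis
  proof (rule nonsingular_formI[of _ n])
    fix v assume v: "v \<in> carrier_vec n" and 0: "\<And>w. w \<in> carrier_vec n \<Longrightarrow> polar (c \<cdot>\<^sub>m A) v w = 0"
    show "v = 0\<^sub>v n"
    proof (rule nonsingular_formD[OF assms(1) A v])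
      fix w :: "'a vec" assume w: "w \<in> carrier_vec n"
      have "polar (c \<cdot>\<^sub>m A) v w = c * polar A v w"
        using v w by (simp add: polar_def qval_smult_mat[OF A] right_diff_distrib)
      then show "polar A v w = 0" using 0[OF w] assms by simp
    qed
  qed (use A in simp)
qed

lemma smult_even_forms: "A \<in> even_forms \<Longrightarrow> c \<noteq> 0 \<Longrightarrow> c \<cdot>\<^sub>m A \<in> even_forms"
  by (simp add: even_forms_def smult_nonsingular)

lemma one_smult_mat [simp]: "(1 :: 'a::field) \<cdot>\<^sub>m A = A"
  by (intro eq_matI) auto

lemma smult_smult_mat: "(a :: 'a::field) \<cdot>\<^sub>m (b \<cdot>\<^sub>m A) = (a * b) \<cdot>\<^sub>m A"
  by (intro eq_matI) (auto simp: mult.assoc)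

lemma isometric_binaryI:
  fixes A B :: "'a::field mat"
  assumes "A \<in> carrier_mat 2 2" "B \<in> carrier_mat 2 2" "nonsingular_form B"
    and q: "\<And>x y. qval B (vec_of_list [x, y]) = qval A (vec_of_list [\<alpha> * x + \<beta> * y, \<gamma> * x + \<delta> * y])"
  shows "isometric A B"
proof -
  define T where "T v = vec 2 (\<lambda>i. if i = 0 then \<alpha> * v $ 0 + \<beta> * v $ 1 else \<gamma> * v $ 0 + \<delta> * v $ 1)"
    for v :: "'a vec"
  show ?thesis
  proof (rule isometric_linI[OF assms(1-3), of T])
    fix v :: "'a vec" assume v: "v \<in> carrier_vec 2"
    have "T v = vec_of_list [\<alpha> * v $ 0 + \<beta> * v $ 1, \<gamma> * v $ 0 + \<delta> * v $ 1]"
      using vec2_eq[of "T v"] by (simp add: T_def)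
    then show "qval B v = qval A (T v)" using q[of "v $ 0" "v $ 1"] vec2_eq[OF v] by simp
  qed (auto simp: T_def algebra_simps intro!: eq_vecI)
qed

text \<open>The two parametrisations of binary classes have different virtues: in characteristic 2,
  [p, q] is biadditive in the Witt group, whereas c[1, a] separates the Arf invariant
  \<open>a\<close> from the scalar \<open>c\<close>.\<close>

definition binary_class :: "'a::field \<Rightarrow> 'a \<Rightarrow> 'a mat set" where
  "binary_class p q = witt_class (binary_form p q)"

definition block_class :: "'a::field \<Rightarrow> 'a \<Rightarrow> 'a mat set" where
  "block_class a c = witt_class (c \<cdot>\<^sub>m binary_form 1 a)"

lemma vec_of_list2_carrier: "vec_of_list [x, y] \<in> carrier_vec 2"
  by (rule carrier_vecI) simp

lemma qval_block_form:
  "qval (c \<cdot>\<^sub>m binary_form 1 a) (vec_of_list [x, y]) = c * (x\<^sup>2 + x * y + a * y\<^sup>2)"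
  using qval_smult_mat[OF binary_form_carrier vec_of_list2_carrier, of c 1 a x y] qval_binary_form[of 1 a x y]
  by simp

locale char_two_field =
  fixes F :: "'a::field itself"
  assumes two_eq_0: "(2 :: 'a) = 0"
begin

lemma char2_simps:
  fixes x y :: 'a
  shows "x + x = 0" "x + (x + y) = y" "- x = x" "x - y = x + y"
proof -
  have *: "z + z = 0" for z :: 'a using two_eq_0 by (metis mult_2 mult_zero_left)
  then show "x + x = 0" "x + (x + y) = y" by (simp_all flip: add.assoc)
  have "- z = z" for z :: 'a using * by (simp add: neg_eq_iff_add_eq_0)
  then show "- x = x" "x - y = x + y" by (simp_all add: diff_conv_add_uminus del: add_uminus_conv_diff)
qed

lemma add_eq_0_char2: "x + y = 0 \<longleftrightarrow> x = (y :: 'a)"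
  using eq_neg_iff_add_eq_0[of x y] by (simp only: char2_simps(3))

lemma binary_form_nonsingular: "nonsingular_form (binary_form (a :: 'a) b)"
proof (rule nonsingular_formI[of _ 2])
  fix v :: "'a vec" assume v: "v \<in> carrier_vec 2"
    and 0: "\<And>w. w \<in> carrier_vec 2 \<Longrightarrow> polar (binary_form a b) v w = 0"
  have "v $ 1 = 0" using 0[of "unit_vec 2 0"] v two_eq_0 by (simp add: polar_binary)
  moreover have "v $ 0 = 0" using 0[of "unit_vec 2 1"] v two_eq_0 by (simp add: polar_binary)
  ultimately show "v = 0\<^sub>v 2" using v by (intro eq_vecI) (auto simp: less_2_cases_iff)
qed auto

lemma binary_form_even [simp, intro]: "binary_form (a :: 'a) b \<in> even_forms"
  by (simp add: even_forms_def binary_form_nonsingular)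

text \<open>In characteristic 2, \<open>q (r + y) + q r = q y + b (r, y)\<close>, where \<open>b\<close> is the polar form with matrix \<open>B\<close>.
  The vector \<open>r\<close> is chosen so that \<open>b (r, y) = x \<bullet> y + q y\<close>.\<close>

lemma orth_sum_self:
  assumes ns: "nonsingular_form (A :: 'a mat)"
  shows "isometric (orth_sum A A) (hyperbolic_sum (dim_row A))"
proof -
  define n where "n = dim_row A"
  have A: "A \<in> carrier_mat n n" using ns nonsingular_form_carrier n_def by auto
  define B where "B = A + A\<^sup>T"
  have B: "B \<in> carrier_mat n n" using A by (simp add: B_def)
  have AT: "A\<^sup>T \<in> carrier_mat n n" using A by simp
  have polB: "polar A v w = v \<bullet> (B *\<^sub>v w)" if v: "v \<in> carrier_vec n" and w: "w \<in> carrier_vec n" for v w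
  proof -
    have c: "A *\<^sub>v v \<in> carrier_vec n" "A\<^sup>T *\<^sub>v w \<in> carrier_vec n" "A *\<^sub>v w \<in> carrier_vec n"
      using A AT v w by simp_all
    have "w \<bullet> (A *\<^sub>v v) = (A\<^sup>T *\<^sub>v w) \<bullet> v"
      using transpose_vec_mult_scalar[OF A v w] by simp
    also have "\<dots> = v \<bullet> (A\<^sup>T *\<^sub>v w)" using comm_scalar_prod[OF c(2) v] .
    finally show ?thesis
      unfolding polar_eq[OF A v w] B_def add_mult_distrib_mat_vec[OF A AT w]
      using scalar_prod_add_distrib[OF v c(3,2)] by simp
  qed
  have inj: "v = 0\<^sub>v n" if v: "v \<in> carrier_vec n" and "B *\<^sub>v v = 0\<^sub>v n" for v
  proof (rule nonsingular_formD[OF ns A v])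
    fix w :: "'a vec" assume "w \<in> carrier_vec n"
    then show "polar A v w = 0" using polB[of w v] that polar_commute[of v n w A] by simp
  qed
  obtain Q where Q: "Q \<in> carrier_mat n n" "B * Q = 1\<^sub>m n"
    using injective_inverse_mat[OF B inj] by blast
  \<comment> \<open>The planes of \<open>hyperbolic_sum\<close> occupy consecutive coordinates, so
    the two halves of the standard hyperbolic pairing are the even and the odd coordinates.\<close>
  define X where "X u = vec n (\<lambda>i. u $ (2 * i))" for u :: "'a vec"
  define Y where "Y u = vec n (\<lambda>i. u $ (2 * i + 1))" for u :: "'a vec"
  define R where "R u = Q *\<^sub>v (X u + A *\<^sub>v Y u)" for u
  define T where "T u = (R u + Y u) @\<^sub>v R u" for u
  have XY: "X u \<in> carrier_vec n" "Y u \<in> carrier_vec n" for u by (simp_all add: X_def Y_def)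
  have AY: "A *\<^sub>v Y u \<in> carrier_vec n" for u using A by (simp add: Y_def)
  have Z: "X u + A *\<^sub>v Y u \<in> carrier_vec n" for u using XY AY by simp
  have Rc: "R u \<in> carrier_vec n" for u using Q(1) Z by (simp add: R_def)
  have "isometric (orth_sum A A) (hyperbolic_sum n)"
  proof (rule isometric_linI[of _ "2 * n" _ T])
    show "orth_sum A A \<in> carrier_mat (2 * n) (2 * n)" using orth_sum_carrier[OF A A] by (simp add: mult_2)
    show "T u \<in> carrier_vec (2 * n)" for u using Rc[of u] XY[of u] by (simp add: T_def mult_2)
  next
    fix u v :: "'a vec" assume u: "u \<in> carrier_vec (2 * n)" and v: "v \<in> carrier_vec (2 * n)"
    have XYa: "X (u + v) = X u + X v" "Y (u + v) = Y u + Y v"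
      using u v by (auto intro!: eq_vecI simp: X_def Y_def)
    have "X (u + v) + A *\<^sub>v Y (u + v) = (X u + A *\<^sub>v Y u) + (X v + A *\<^sub>v Y v)"
      using XY AY unfolding XYa mult_add_distrib_mat_vec[OF A XY(2) XY(2)]
      by (intro eq_vecI) (use A in \<open>auto simp: X_def\<close>)
    then have "R (u + v) = R u + R v"
      unfolding R_def using mult_add_distrib_mat_vec[OF Q(1) Z Z] by simp
    then show "T (u + v) = T u + T v"
      unfolding T_def XYa using Rc[of u] Rc[of v] XY(2)[of u] XY(2)[of v]
      by (intro eq_vecI) auto
  next
    fix u :: "'a vec" and c assume u: "u \<in> carrier_vec (2 * n)"
    have XYs: "X (c \<cdot>\<^sub>v u) = c \<cdot>\<^sub>v X u" "Y (c \<cdot>\<^sub>v u) = c \<cdot>\<^sub>v Y u"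
      using u by (auto intro!: eq_vecI simp: X_def Y_def)
    have "X (c \<cdot>\<^sub>v u) + A *\<^sub>v Y (c \<cdot>\<^sub>v u) = c \<cdot>\<^sub>v (X u + A *\<^sub>v Y u)"
      unfolding XYs mult_mat_vec[OF A XY(2)] using smult_add_distrib_vec[OF XY(1) AY] by simp
    then have "R (c \<cdot>\<^sub>v u) = c \<cdot>\<^sub>v R u"
      unfolding R_def using mult_mat_vec[OF Q(1) Z] by simp
    then show "T (c \<cdot>\<^sub>v u) = c \<cdot>\<^sub>v T u"
      unfolding T_def XYs using Rc[of u] XY(2)[of u]
      by (intro eq_vecI) (auto simp: distrib_left)
  next
    fix u :: "'a vec" assume u: "u \<in> carrier_vec (2 * n)"
    have hs: "qval (hyperbolic_sum k) w = (\<Sum>i<k. w $ (2 * i + 1) * w $ (2 * i))"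
      if "w \<in> carrier_vec (2 * k)" for k and w :: "'a vec"
      using that
    proof (induction k arbitrary: w)
      case 0
      then show ?case by (auto simp: qval_def scalar_prod_def)
    next
      case (Suc k)
      then have w: "w \<in> carrier_vec (2 * k + 2)" by (simp add: add.commute)
      have *: "vec_first w (2 * k) $ j = w $ j" if "j < 2 * k" for j using that by (simp add: vec_first_def)
      have "vec_last w 2 $ 0 = w $ (2 * k)" "vec_last w 2 $ 1 = w $ (2 * k + 1)"
        using w by (simp_all add: vec_last_def)
      then show ?case
        unfolding hyperbolic_sum_Suc' qval_orth_sum_split[OF hyperbolic_sum_carrier binary_form_carrier w]
        using Suc.IH[of "vec_first w (2 * k)"] by (simp add: qval_binary *)
    qed
    have "qval (orth_sum A A) (T u) = qval A (R u + Y u) + qval A (R u)"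
      unfolding T_def using Rc[of u] XY(2)[of u] by (intro qval_orth_sum[OF A A]) auto
    also have "\<dots> = qval A (Y u) + polar A (R u) (Y u)"
      by (simp add: qval_add add_ac char2_simps)
    also have "polar A (R u) (Y u) = Y u \<bullet> (B *\<^sub>v R u)"
      using polB[OF XY(2) Rc] polar_commute[OF XY(2) Rc] by metis
    also have "B *\<^sub>v R u = X u + A *\<^sub>v Y u"
      unfolding R_def using assoc_mult_mat_vec[OF B Q(1) Z] Q(2) Z by simp
    also have "Y u \<bullet> (X u + A *\<^sub>v Y u) = Y u \<bullet> X u + qval A (Y u)"
      unfolding qval_def using scalar_prod_add_distrib[OF XY(2) XY(1) AY] .
    finally have "qval (orth_sum A A) (T u) = Y u \<bullet> X u" by (simp add: add_ac char2_simps)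
    also have "\<dots> = qval (hyperbolic_sum n) u"
      unfolding hs[OF u] by (simp add: scalar_prod_def X_def Y_def atLeast0LessThan)
    finally show "qval (hyperbolic_sum n) u = qval (orth_sum A A) (T u)" by simp
  qed (use hyperbolic_sum_nonsingular in auto)
  then show ?thesis by (simp add: n_def)
qed

lemma Iq1_square:
  assumes "x \<in> carrier (Iq1 :: 'a mat set monoid)"
  shows "x \<boxplus> x = \<one>\<^bsub>Iq1\<^esub>"
proof -
  obtain A where A: "A \<in> even_forms" "x = witt_class A" using assms by (auto simp: carrier_Iq1)
  then have "witt_class (orth_sum A A) = \<one>\<^bsub>Iq1\<^esub>"
    using witt_class_isometric[OF orth_sum_self, of A] witt_class_hyperbolic_sum
    by (simp add: orth_sum_even_forms even_forms_def orth_sum_nonsingular)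
  then show ?thesis using A by (simp add: Iq1_mult)
qed

lemma comm_group_Iq1: "comm_group (Iq1 :: 'a mat set monoid)"
proof -
  interpret comm_monoid "Iq1 :: 'a mat set monoid" by (rule comm_monoid_Iq1)
  show ?thesis
  proof (rule comm_groupI)
    fix x assume "x \<in> carrier (Iq1 :: 'a mat set monoid)"
    then show "\<exists>y\<in>carrier Iq1. y \<boxplus> x = \<one>\<^bsub>Iq1\<^esub>" using Iq1_square by blast
  qed (simp_all add: m_ac)
qed

section \<open>Classes of binary forms\<close>

interpretation Iq1: comm_group "Iq1 :: 'a mat set monoid"
  by (rule comm_group_Iq1)

lemma witt_class_carrier [simp, intro]:
  "A \<in> even_forms \<Longrightarrow> witt_class A \<in> carrier (Iq1 :: 'a mat set monoid)"
  by (auto simp: carrier_Iq1)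

lemma Iq1_square_left:
  "x \<in> carrier (Iq1 :: 'a mat set monoid) \<Longrightarrow> y \<in> carrier Iq1 \<Longrightarrow>
    x \<boxplus> (x \<boxplus> y) = y"
  by (simp add: Iq1_square flip: Iq1.m_assoc)

lemma block_even [intro]: "c \<noteq> 0 \<Longrightarrow> c \<cdot>\<^sub>m binary_form 1 (a :: 'a) \<in> even_forms"
  by (simp add: smult_even_forms)

lemma binary_class_carrier [simp, intro]: "binary_class p q \<in> carrier (Iq1 :: 'a mat set monoid)"
  by (simp add: binary_class_def)

lemma block_class_carrier [simp, intro]:
  "c \<noteq> 0 \<Longrightarrow> block_class a c \<in> carrier (Iq1 :: 'a mat set monoid)"
  by (auto simp: block_class_def)

lemma binary_class_commute: "binary_class p q = binary_class q (p :: 'a)"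
  unfolding binary_class_def
proof (rule witt_class_isometric)
  show "isometric (binary_form p q) (binary_form q p)"
    by (rule isometric_binaryI[where \<alpha> = 0 and \<beta> = 1 and \<gamma> = 1 and \<delta> = 0])
      (simp_all add: binary_form_nonsingular qval_binary_form algebra_simps del: vec_of_list_Cons)
qed simp

lemma binary_class_square:
  assumes "r \<noteq> 0"
  shows "binary_class (p * r\<^sup>2) q = binary_class p (q * (r :: 'a)\<^sup>2)"
  unfolding binary_class_def
proof (rule witt_class_isometric)
  show "isometric (binary_form (p * r\<^sup>2) q) (binary_form p (q * r\<^sup>2))"
    by (rule isometric_binaryI[where \<alpha> = "1 / r" and \<beta> = 0 and \<gamma> = 0 and \<delta> = r])
      (use assms in \<open>simp_all add: binary_form_nonsingular qval_binary_form field_simps power2_eq_square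
        del: vec_of_list_Cons\<close>)
qed simp

lemma block_class_eq_binary:
  assumes "c \<noteq> 0"
  shows "block_class a c = binary_class c (a / c :: 'a)"
  unfolding binary_class_def block_class_def
proof (rule witt_class_isometric)
  show "isometric (c \<cdot>\<^sub>m binary_form 1 a) (binary_form c (a / c))"
    by (rule isometric_binaryI[where \<alpha> = 1 and \<beta> = 0 and \<gamma> = 0 and \<delta> = "1 / c"])
      (use assms in \<open>simp_all add: binary_form_nonsingular qval_binary_form qval_block_form field_simps
        power2_eq_square del: vec_of_list_Cons\<close>)
qed (use assms in auto)

lemma binary_class_zero_left: "binary_class 0 (q :: 'a) = \<one>\<^bsub>Iq1\<^esub>"
proof -
  have "isometric (binary_form 0 q) (binary_form 0 0)"
    by (rule isometric_binaryI[where \<alpha> = 1 and \<beta> = q and \<gamma> = 0 and \<delta> = 1])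
      (simp_all add: binary_form_nonsingular qval_binary_form algebra_simps power2_eq_square char2_simps
        del: vec_of_list_Cons)
  then have "binary_class 0 q = witt_class (binary_form 0 0)"
    unfolding binary_class_def by (rule witt_class_isometric) simp
  also have "\<dots> = \<one>\<^bsub>Iq1\<^esub>"
    using witt_class_hyperbolic_sum[of 1] by (simp add: hyperbolic_sum_Suc)
  finally show ?thesis .
qed

lemma binary_class_zero_right: "binary_class (q :: 'a) 0 = \<one>\<^bsub>Iq1\<^esub>"
  using binary_class_zero_left binary_class_commute by metis

text \<open>Replacing x by x + t y in [c, 0] adds t + c t^2 to the second entry. For c = 1 this is
  the Artin-Schreier ambiguity of the Arf invariant.\<close>

lemma binary_class_artin_schreier: "binary_class c (t + c * t\<^sup>2 :: 'a) = \<one>\<^bsub>Iq1\<^esub>"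
proof -
  have "isometric (binary_form c (t + c * t\<^sup>2)) (binary_form c 0)"
    by (rule isometric_binaryI[where \<alpha> = 1 and \<beta> = t and \<gamma> = 0 and \<delta> = 1])
      (simp_all add: binary_form_nonsingular qval_binary_form algebra_simps power2_eq_square char2_simps
        del: vec_of_list_Cons)
  then have "binary_class c (t + c * t\<^sup>2) = binary_class c 0"
    unfolding binary_class_def by (rule witt_class_isometric) simp
  then show ?thesis using binary_class_zero_right by simp
qed

lemma binary_class_add_right:
  "binary_class p q \<boxplus> binary_class p q' = binary_class p (q + q' :: 'a)"
proof -
  let ?A = "orth_sum (binary_form p q) (binary_form p q')"
  let ?B = "orth_sum (binary_form p (q + q')) (binary_form 0 q')"
  \<comment> \<open>If (e, f) and (e', f') are the bases of the two planes, the new basis is e, f +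
    f', e + e', f'. Since p + p = 0, the vector e + e' is isotropic and the second new plane is
    hyperbolic.\<close>
  define T where "T v = vec 4 (\<lambda>i. if i = 0 then v $ 0 + v $ 2 else if i = 1 then v $ 1
    else if i = 2 then v $ 2 else v $ 1 + v $ 3)" for v :: "'a vec"
  have q4: "qval (orth_sum C D) v = qval C (vec_of_list [v $ 0, v $ 1]) + qval D (vec_of_list [v $ 2, v $ 3])"
    if "C \<in> carrier_mat 2 2" "D \<in> carrier_mat 2 2" "v \<in> carrier_vec 4" for C D and v :: "'a vec"
  proof -
    have "v \<in> carrier_vec (2 + 2)" using that by simp
    moreover have "vec_first v 2 = vec_of_list [v $ 0, v $ 1]"
      using vec2_eq[of "vec_first v 2"] by (simp add: vec_first_def)
    moreover have "vec_last v 2 = vec_of_list [v $ 2, v $ 3]"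
      using vec2_eq[of "vec_last v 2"] that by (simp add: vec_last_def)
    ultimately show ?thesis using qval_orth_sum_split[OF that(1,2), of v] by simp
  qed
  have "?A \<in> carrier_mat (2 + 2) (2 + 2)" "?B \<in> carrier_mat (2 + 2) (2 + 2)"
    by (intro orth_sum_carrier binary_form_carrier)+
  then have "isometric ?A ?B"
  proof (intro isometric_linI[of ?A 4 ?B T])
    fix v :: "'a vec" assume v: "v \<in> carrier_vec 4"
    have Tv: "T v \<in> carrier_vec 4" by (simp add: T_def)
    show "qval ?B v = qval ?A (T v)"
      unfolding q4[OF binary_form_carrier binary_form_carrier v] q4[OF binary_form_carrier binary_form_carrier Tv]
        qval_binary_form
      by (simp add: T_def power2_eq_square algebra_simps char2_simps)
  qed (auto simp: T_def algebra_simps intro!: eq_vecI orth_sum_nonsingular binary_form_nonsingular)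
  then have "witt_class ?A = witt_class ?B" by (rule witt_class_isometric) (auto intro: orth_sum_even_forms)
  then show ?thesis
    using binary_class_zero_left[of q'] by (simp add: binary_class_def flip: Iq1_mult)
qed

lemma binary_class_add_left:
  "binary_class p q \<boxplus> binary_class p' q = binary_class (p + p') (q :: 'a)"
  using binary_class_add_right[of q p p'] by (simp add: binary_class_commute)

text \<open>x^2 + x y + a y^2 is the norm of x + y z in the quadratic algebra with z^2 = z + a.
  Multiplication by this element is a similarity of the norm form [1, a] whose factor is the
  norm.\<close>

lemma block_class_norm:
  assumes "c \<noteq> 0" "x\<^sup>2 + x * y + a * y\<^sup>2 \<noteq> 0"
  shows "block_class a (c * (x\<^sup>2 + x * y + a * y\<^sup>2)) = block_class a (c :: 'a)"
proof -
  define n where "n = x\<^sup>2 + x * y + a * y\<^sup>2"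
  have n: "c * n \<noteq> 0" using assms by (simp add: n_def)
  have "isometric (c \<cdot>\<^sub>m binary_form 1 a) ((c * n) \<cdot>\<^sub>m binary_form 1 a)"
  proof (rule isometric_binaryI[where \<alpha> = x and \<beta> = "a * y" and \<gamma> = y and \<delta> = "x + y"])
    show "nonsingular_form ((c * n) \<cdot>\<^sub>m binary_form 1 a)"
      using n by (intro smult_nonsingular binary_form_nonsingular)
  qed (simp_all add: n_def qval_block_form algebra_simps power2_eq_square char2_simps del: vec_of_list_Cons)
  then show ?thesis
    unfolding block_class_def n_def[symmetric] using assms(1) by (metis block_even witt_class_isometric)
qed

lemma block_class_square: "c \<noteq> 0 \<Longrightarrow> r \<noteq> 0 \<Longrightarrow> block_class a (c * r\<^sup>2) = block_class a (c :: 'a)"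
  using block_class_norm[of c r 0 a] by simp

lemma block_class_add_param:
  "c \<noteq> 0 \<Longrightarrow> block_class a c \<boxplus> block_class b c = block_class (a + b) (c :: 'a)"
  by (simp add: block_class_eq_binary binary_class_add_right add_divide_distrib)

lemma block_class_isotropic:
  assumes "x\<^sup>2 + x * y + a * y\<^sup>2 = 0" "x \<noteq> 0 \<or> y \<noteq> 0" "c \<noteq> (0 :: 'a)"
  shows "block_class a c = \<one>\<^bsub>Iq1\<^esub>"
proof -
  have y: "y \<noteq> 0" using assms by auto
  \<comment> \<open>With s = x / y the hypothesis reads a = s + s^2. Taking t = s / c gives a / c =
    t + c t^2, as \<open>binary_class_artin_schreier\<close> requires.\<close>
  define t where "t = x / (y * c)"
  have x: "x = t * c * y" using y assms(3) by (simp add: t_def)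
  have "(a + (t * c + t\<^sup>2 * c\<^sup>2)) * y\<^sup>2 = 0"
    using assms(1) unfolding x by (simp add: power2_eq_square algebra_simps)
  then have "a = t * c + t\<^sup>2 * c\<^sup>2" using y by (simp add: add_eq_0_char2)
  then have "a / c = t + c * t\<^sup>2" using assms(3) by (simp add: field_simps power2_eq_square)
  then show ?thesis using assms(3) by (simp add: block_class_eq_binary binary_class_artin_schreier)
qed

text \<open>This is the relation between the diagonal forms \<langle>e, f\<rangle> and \<langle>e +
  f, e f (e + f)\<rangle>, tensored with [1, a]. It follows from biadditivity after writing e f (e +
  f) as f e^2 + e f^2 and moving the squares into the other slot.\<close>

lemma block_class_sum:
  assumes "e \<noteq> 0" "f \<noteq> 0" "e + f \<noteq> (0 :: 'a)"
  shows "block_class a e \<boxplus> block_class a f =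
    block_class a (e + f) \<boxplus> block_class a (e * f * (e + f))"
proof -
  define X where "X = a / (e * f * (e + f))"
  have "f * e\<^sup>2 + e * f\<^sup>2 = e * f * (e + f)" by (simp add: power2_eq_square algebra_simps)
  then have "block_class a (e * f * (e + f)) = binary_class (f * e\<^sup>2 + e * f\<^sup>2) X"
    using assms by (simp add: block_class_eq_binary X_def)
  also have "\<dots> = binary_class (f * e\<^sup>2) X \<boxplus> binary_class (e * f\<^sup>2) X"
    by (simp add: binary_class_add_left)
  also have "\<dots> = binary_class f (X * e\<^sup>2) \<boxplus> binary_class e (X * f\<^sup>2)"
    using assms by (simp add: binary_class_square)
  finally have 1: "block_class a (e * f * (e + f)) =
    binary_class f (X * e\<^sup>2) \<boxplus> binary_class e (X * f\<^sup>2)" .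
  have 2: "block_class a (e + f) =
    binary_class e (a / (e + f)) \<boxplus> binary_class f (a / (e + f))"
    using assms by (simp add: block_class_eq_binary binary_class_add_left)
  have frac: "a / (e' + f') + a / (e' * f' * (e' + f')) * f'\<^sup>2 = a / e'"
    if "e' \<noteq> 0" "f' \<noteq> 0" "e' + f' \<noteq> 0" for e' f' :: 'a
  proof -
    define s where "s = e' + f'"
    have "a / s + a / (e' * f' * s) * f'\<^sup>2 = a * e' / (e' * s) + a * f' / (e' * s)"
      using that by (simp add: power2_eq_square)
    also have "\<dots> = a * (e' + f') / (e' * s)"
      unfolding distrib_left add_divide_distrib ..
    finally have "a / s + a / (e' * f' * s) * f'\<^sup>2 = a * s / (e' * s)" by (simp add: s_def)
    then show ?thesis using that by (simp add: s_def)
  qed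
  have e3: "a / (e + f) + X * f\<^sup>2 = a / e"
    using frac[of e f] assms by (simp add: X_def)
  have e4: "a / (e + f) + X * e\<^sup>2 = a / f"
    using frac[of f e] assms by (simp add: X_def mult.commute[of f e] add.commute[of f e])
  have 3: "block_class a e = binary_class e (a / (e + f)) \<boxplus> binary_class e (X * f\<^sup>2)"
    using assms(1) e3 by (simp add: block_class_eq_binary binary_class_add_right)
  have 4: "block_class a f = binary_class f (a / (e + f)) \<boxplus> binary_class f (X * e\<^sup>2)"
    using assms(2) e4 by (simp add: block_class_eq_binary binary_class_add_right)
  show ?thesis unfolding 1 2 3 4 by (simp add: Iq1.m_ac)
qed

text \<open>With g = (p + q) / (b + c) the third block is [b, g] + [c, g]. These summands are
  absorbed by the first two blocks, which end up with the same parameter because p + b g = q + c g.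
  Three blocks thus become two of equal Arf invariant.\<close>

lemma block_class_three:
  assumes "b \<noteq> 0" "c \<noteq> 0" "b + c \<noteq> (0 :: 'a)"
  shows "block_class p b \<boxplus> (block_class q c \<boxplus> block_class (p + q) (b + c)) =
    block_class (p + b * (p + q) / (b + c)) b \<boxplus> block_class (p + b * (p + q) / (b + c)) c"
proof -
  define g where "g = (p + q) / (b + c)"
  have 1: "block_class (p + b * (p + q) / (b + c)) b = block_class p b \<boxplus> binary_class b g"
    using assms by (simp add: block_class_eq_binary binary_class_add_right g_def add_divide_distrib)
  have "(p + b * (p + q) / (b + c)) * (b + c) = (q + c * g) * (b + c)"
    using assms by (simp add: g_def field_simps char2_simps)
  then have "p + b * (p + q) / (b + c) = q + c * g" using assms by simp
  then have 2: "block_class (p + b * (p + q) / (b + c)) c = block_class q c \<boxplus> binary_class c g"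
    using assms by (simp add: block_class_eq_binary binary_class_add_right add_divide_distrib)
  have 3: "block_class (p + q) (b + c) = binary_class b g \<boxplus> binary_class c g"
    using assms by (simp add: block_class_eq_binary binary_class_add_left g_def)
  show ?thesis unfolding 1 2 3 using assms by (simp add: Iq1.m_ac)
qed

end

section \<open>Operators on functions of finite sets\<close>

definition linear_op :: "(('i \<Rightarrow> 'a::field) \<Rightarrow> 'i \<Rightarrow> 'a) \<Rightarrow> bool" where
  "linear_op f \<longleftrightarrow> (\<forall>x y. f (\<lambda>t. x t + y t) = (\<lambda>t. f x t + f y t)) \<and>
     (\<forall>c x. f (\<lambda>t. c * x t) = (\<lambda>t. c * f x t))"

lemma linear_op_add: "linear_op f \<Longrightarrow> f (\<lambda>t. x t + y t) = (\<lambda>t. f x t + f y t)"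
  unfolding linear_op_def by blast

lemma linear_op_scale: "linear_op f \<Longrightarrow> f (\<lambda>t. c * x t) = (\<lambda>t. c * f x t)"
  unfolding linear_op_def by blast

lemma linear_op_zero: "linear_op f \<Longrightarrow> f (\<lambda>t. 0) = (\<lambda>t. 0)"
  using linear_op_scale[of f 0 "\<lambda>t. 0"] by simp

lemma linear_op_sum:
  assumes "linear_op f"
  shows "f (\<lambda>t. \<Sum>i<n. c i * x i t) = (\<lambda>t. \<Sum>i<(n::nat). c i * f (x i) t)"
  by (induction n) (simp_all add: linear_op_zero[OF assms] linear_op_add[OF assms] linear_op_scale[OF assms])

lemma linear_op_comp: "linear_op f \<Longrightarrow> linear_op g \<Longrightarrow> linear_op (\<lambda>x. f (g x))"
  by (simp add: linear_op_def)

lemma linear_op_plus: "linear_op f \<Longrightarrow> linear_op g \<Longrightarrow> linear_op (\<lambda>x t. f x t + g x t)"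
  by (simp add: linear_op_def algebra_simps)

lemma linear_op_smult: "linear_op f \<Longrightarrow> linear_op (\<lambda>x t. c * f x t)"
  by (simp add: linear_op_def algebra_simps)

lemma linear_op_id: "linear_op (\<lambda>x. x)"
  by (simp add: linear_op_def)

definition linear_subspace :: "('i \<Rightarrow> 'a::field) set \<Rightarrow> bool" where
  "linear_subspace W \<longleftrightarrow> (\<forall>x\<in>W. \<forall>y\<in>W. (\<lambda>t. x t + y t) \<in> W) \<and> (\<forall>c. \<forall>x\<in>W. (\<lambda>t. c * x t) \<in> W)"

text \<open>The dimension of \<open>W\<close> is at most \<open>d\<close>.\<close>

definition dim_bound :: "('i \<Rightarrow> 'a::field) set \<Rightarrow> nat \<Rightarrow> bool" where
  "dim_bound W d \<longleftrightarrow> (\<forall>n > d. \<forall>x. (\<forall>i<n. x i \<in> W) \<longrightarrow>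
     (\<exists>c. (\<exists>i<n. c i \<noteq> 0) \<and> (\<forall>t. (\<Sum>i<n. c i * x i t) = 0)))"

lemma dim_boundD:
  assumes "dim_bound W d" "d < n" "\<And>i. i < n \<Longrightarrow> x i \<in> W"
  obtains c i where "i < n" "c i \<noteq> 0" "\<And>t. (\<Sum>i<n. c i * x i t) = 0"
  using assms unfolding dim_bound_def by blast

text \<open>Gaussian elimination, removing one coordinate of \<open>T\<close> at a time.\<close>

lemma finite_support_dependent:
  fixes x :: "nat \<Rightarrow> 'i \<Rightarrow> 'a::field"
  assumes "finite T" "finite I" "card T < card I" "\<And>i t. i \<in> I \<Longrightarrow> t \<notin> T \<Longrightarrow> x i t = 0"
  shows "\<exists>c. (\<exists>i\<in>I. c i \<noteq> 0) \<and> (\<forall>t. (\<Sum>i\<in>I. c i * x i t) = 0)"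
  using assms
proof (induction T arbitrary: I x rule: finite_induct)
  case empty
  then have "I \<noteq> {}" by auto
  then show ?case using empty by (intro exI[of _ "\<lambda>_. 1"]) auto
next
  case (insert s T)
  show ?case
  proof (cases "\<forall>i\<in>I. x i s = 0")
    case True
    have "x i t = 0" if "i \<in> I" "t \<notin> T" for i t using that True insert.prems(3)[of i t] by (cases "t = s") auto
    then show ?thesis using insert.prems(2) insert.hyps by (intro insert.IH[OF insert.prems(1)]) auto
  next
    case False
    then obtain j where j: "j \<in> I" "x j s \<noteq> 0" by blast
    \<comment> \<open>The vector with index \<open>j\<close> is the pivot; subtracting its multiples
      clears the coordinate \<open>s\<close> of all others.\<close>
    define y where "y i t = x i t - x i s / x j s * x j t" for i t
    have "y i t = 0" if "i \<in> I - {j}" "t \<notin> T" for i t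
      using that insert.prems(3)[of i t] insert.prems(3)[of j t] j by (cases "t = s") (auto simp: y_def)
    moreover have "card T < card (I - {j})" using insert.prems insert.hyps j by simp
    ultimately obtain c where c: "\<exists>i\<in>I - {j}. c i \<noteq> 0" "\<And>t. (\<Sum>i\<in>I - {j}. c i * y i t) = 0"
      using insert.IH[of "I - {j}" y] insert.prems(1) by blast
    define d where "d = c(j := - (\<Sum>i\<in>I - {j}. c i * (x i s / x j s)))"
    have "(\<Sum>i\<in>I. d i * x i t) = 0" for t
    proof -
      have "(\<Sum>i\<in>I. d i * x i t) = d j * x j t + (\<Sum>i\<in>I - {j}. d i * x i t)"
        using j insert.prems(1) by (intro sum.remove) auto
      also have "(\<Sum>i\<in>I - {j}. d i * x i t) = (\<Sum>i\<in>I - {j}. c i * x i t)"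
        by (intro sum.cong) (auto simp: d_def)
      also have "\<dots> = (\<Sum>i\<in>I - {j}. c i * y i t + c i * (x i s / x j s) * x j t)"
        by (intro sum.cong) (auto simp: y_def algebra_simps)
      also have "\<dots> = (\<Sum>i\<in>I - {j}. c i * (x i s / x j s)) * x j t"
        by (simp only: sum.distrib c(2) sum_distrib_right) simp
      finally show ?thesis by (simp add: d_def)
    qed
    moreover have "\<exists>i\<in>I. d i \<noteq> 0" using c(1) by (auto simp: d_def)
    ultimately show ?thesis by blast
  qed
qed

text \<open>If \<open>e\<close> kills \<open>K\<close> and \<open>g \<circ> e \<circ> f\<close> is a nonzero scalar on \<open>K\<close>, then \<open>K\<close> and \<open>f K\<close> are
  independent, so \<open>K\<close> has at most half the dimension.\<close>

lemma dim_bound_half: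
  fixes W :: "('i \<Rightarrow> 'a::field) set"
  assumes W: "dim_bound W (2 * d)" and "K \<subseteq> W" and fK: "\<And>x. x \<in> K \<Longrightarrow> f x \<in> W"
    and lin: "linear_op e" "linear_op f" "linear_op g"
    and e: "\<And>x. x \<in> K \<Longrightarrow> e x = (\<lambda>t. 0)"
    and g: "\<And>x. x \<in> K \<Longrightarrow> g (e (f x)) = (\<lambda>t. s * x t)" and "s \<noteq> 0"
  shows "dim_bound K d"
  unfolding dim_bound_def
proof (intro allI impI)
  fix n x assume n: "d < n" and x: "\<forall>i<n. x i \<in> K"
  define y where "y i = (if i < n then x i else f (x (i - n)))" for i
  have yW: "y i \<in> W" if "i < 2 * n" for i using that x fK \<open>K \<subseteq> W\<close> by (auto simp: y_def)
  have "2 * d < 2 * n" using n by simp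
  then obtain c i where ci: "i < 2 * n" "c i \<noteq> 0" and 0: "\<And>t. (\<Sum>i<2 * n. c i * y i t) = 0"
    by (rule dim_boundD[OF W _ yW]) auto
  have split: "(\<Sum>i<2 * n. h i) = (\<Sum>i<n. h i) + (\<Sum>i<n. h (n + i))" for h :: "nat \<Rightarrow> 'a"
  proof -
    have "(\<Sum>i<n + n. h i) = (\<Sum>i<n. h i) + (\<Sum>i\<in>{n..<n + n}. h i)"
      by (simp add: lessThan_atLeast0 sum.atLeastLessThan_concat)
    also have "(\<Sum>i\<in>{n..<n + n}. h i) = (\<Sum>i<n. h (n + i))"
      using sum.shift_bounds_nat_ivl[of h 0 n n] by (simp add: lessThan_atLeast0 add.commute)
    finally show ?thesis by (simp add: mult_2)
  qed
  define u where "u = (\<lambda>t. \<Sum>i<n. c i * x i t)"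
  define v where "v = (\<lambda>t. \<Sum>i<n. c (n + i) * x i t)"
  have uv: "(\<lambda>t. u t + f v t) = (\<lambda>t. 0)"
    using 0 unfolding split by (simp add: u_def v_def linear_op_sum[OF lin(2)] y_def)
  have "e u = (\<lambda>t. 0)" unfolding u_def linear_op_sum[OF lin(1)] using x e by simp
  then have "e (f v) = (\<lambda>t. 0)"
    using arg_cong[OF uv, of e] by (simp add: linear_op_add[OF lin(1)] linear_op_zero[OF lin(1)])
  then have "g (e (f v)) = (\<lambda>t. 0)" by (simp add: linear_op_zero[OF lin(3)])
  moreover have "g (e (f v)) = (\<lambda>t. \<Sum>i<n. c (n + i) * g (e (f (x i))) t)"
    unfolding v_def linear_op_sum[OF lin(2)] linear_op_sum[OF lin(1)] linear_op_sum[OF lin(3)] ..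
  moreover have "\<dots> = (\<lambda>t. \<Sum>i<n. c (n + i) * (s * x i t))" using x g by simp
  moreover have "\<dots> = (\<lambda>t. s * v t)" by (simp add: v_def sum_distrib_left mult_ac)
  ultimately have v0: "v t = 0" for t using \<open>s \<noteq> 0\<close> by (metis mult_eq_0_iff)
  then have "v = (\<lambda>t. 0)" by blast
  then have u0: "u t = 0" for t using fun_cong[OF uv, of t] by (simp add: linear_op_zero[OF lin(2)])
  show "\<exists>c. (\<exists>i<n. c i \<noteq> 0) \<and> (\<forall>t. (\<Sum>i<n. c i * x i t) = 0)"
  proof (cases "i < n")
    case True
    then show ?thesis using ci u0 unfolding u_def by blast
  next
    case False
    then have "i - n < n" "c (n + (i - n)) \<noteq> 0" using ci by auto
    then show ?thesis using v0 unfolding v_def by (intro exI[of _ "\<lambda>i. c (n + i)"]) blast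
  qed
qed

text \<open>The matrix with rows (a, b) and (c, d), acting on the \<open>k\<close>-th factor of a
  tensor product of planes. A set \<open>t\<close> stands for the basis tensor that takes the second
  basis vector exactly in the factors from \<open>t\<close>.\<close>

definition coord_op :: "nat \<Rightarrow> 'a::field \<Rightarrow> 'a \<Rightarrow> 'a \<Rightarrow> 'a \<Rightarrow> (nat set \<Rightarrow> 'a) \<Rightarrow> nat set \<Rightarrow> 'a" where
  "coord_op k a b c d x t =
     (if k \<in> t then c * x (t - {k}) + d * x t else a * x t + b * x (insert k t))"

lemma linear_coord_op: "linear_op (coord_op k a b c d)"
  by (auto simp: linear_op_def coord_op_def fun_eq_iff algebra_simps)

lemma coord_op_comp:
  "coord_op k a b c d (coord_op k a' b' c' d' x) =
    coord_op k (a * a' + b * c') (a * b' + b * d') (c * a' + d * c') (c * b' + d * d') x"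
  by (auto simp: coord_op_def fun_eq_iff algebra_simps insert_absorb)

lemma coord_op_commute:
  assumes "k \<noteq> l"
  shows "coord_op k a b c d (coord_op l a' b' c' d' x) = coord_op l a' b' c' d' (coord_op k a b c d x)"
proof
  fix t
  have "insert k (t - {l}) = insert k t - {l}" "insert l (t - {k}) = insert l t - {k}"
    "insert k (insert l t) = insert l (insert k t)" "t - {k} - {l} = t - {l} - {k}"
    using assms by auto
  then show "coord_op k a b c d (coord_op l a' b' c' d' x) t = coord_op l a' b' c' d' (coord_op k a b c d x) t"
    using assms assms[symmetric] by (simp add: coord_op_def algebra_simps)
qed

definition supported :: "nat \<Rightarrow> (nat set \<Rightarrow> 'a::field) \<Rightarrow> bool" where
  "supported M x \<longleftrightarrow> (\<forall>t. \<not> t \<subseteq> {..<M} \<longrightarrow> x t = 0)"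

text \<open>Acting only on the first \<open>N\<close> tensor factors is expressed by commuting with
  every operator on a later factor. The support condition makes the functions on subsets of the
  first \<open>M\<close> \<ge> \<open>N\<close> factors an invariant space.\<close>

definition local_op :: "nat \<Rightarrow> ((nat set \<Rightarrow> 'a::field) \<Rightarrow> nat set \<Rightarrow> 'a) \<Rightarrow> bool" where
  "local_op N f \<longleftrightarrow> linear_op f \<and>
     (\<forall>k\<ge>N. \<forall>a b c d x. f (coord_op k a b c d x) = coord_op k a b c d (f x)) \<and>
     (\<forall>M\<ge>N. \<forall>x. supported M x \<longrightarrow> supported M (f x))"

lemma local_op_linear: "local_op N f \<Longrightarrow> linear_op f"
  by (simp add: local_op_def)

lemma local_op_commute: "local_op N f \<Longrightarrow> N \<le> k \<Longrightarrow> f (coord_op k a b c d x) = coord_op k a b c d (f x)"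
  by (simp add: local_op_def)

lemma local_op_supported: "local_op N f \<Longrightarrow> N \<le> M \<Longrightarrow> supported M x \<Longrightarrow> supported M (f x)"
  by (simp add: local_op_def)

lemma local_op_mono: "local_op N f \<Longrightarrow> N \<le> N' \<Longrightarrow> local_op N' f"
  by (simp add: local_op_def)

lemma local_coord_op: "k < N \<Longrightarrow> local_op N (coord_op k a b c d)"
  unfolding local_op_def
proof (intro conjI allI impI)
  fix M and x :: "nat set \<Rightarrow> 'a" assume "k < N" "N \<le> M" "supported M x"
  then show "supported M (coord_op k a b c d x)"
    unfolding supported_def coord_op_def by (auto simp: subset_eq) (metis DiffI less_trans order_less_le_trans singletonD)+
qed (auto simp: linear_coord_op intro: coord_op_commute)

lemma local_op_comp: "local_op N f \<Longrightarrow> local_op N g \<Longrightarrow> local_op N (\<lambda>x. f (g x))"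
  by (simp add: local_op_def linear_op_comp)

lemma local_op_plus: "local_op N f \<Longrightarrow> local_op N g \<Longrightarrow> local_op N (\<lambda>x t. f x t + g x t)"
  by (simp add: local_op_def linear_op_plus supported_def linear_op_add[OF linear_coord_op])

lemma local_op_smult: "local_op N f \<Longrightarrow> local_op N (\<lambda>x t. c * f x t)"
  by (simp add: local_op_def linear_op_smult supported_def linear_op_scale[OF linear_coord_op])

section \<open>Clifford maps\<close>

text \<open>A module over the Clifford algebra, recorded through the action of the vectors alone, so
  that the algebra itself is never constructed.\<close>

definition clifford_map :: "'a::field mat \<Rightarrow> ('a vec \<Rightarrow> ('i \<Rightarrow> 'a) \<Rightarrow> 'i \<Rightarrow> 'a) \<Rightarrow> bool" where
  "clifford_map A \<gamma> \<longleftrightarrow>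
     (\<forall>v \<in> carrier_vec (dim_row A). linear_op (\<gamma> v)) \<and>
     (\<forall>v \<in> carrier_vec (dim_row A). \<forall>w \<in> carrier_vec (dim_row A).
        \<forall>x. \<gamma> (v + w) x = (\<lambda>t. \<gamma> v x t + \<gamma> w x t)) \<and>
     (\<forall>c. \<forall>v \<in> carrier_vec (dim_row A). \<forall>x. \<gamma> (c \<cdot>\<^sub>v v) x = (\<lambda>t. c * \<gamma> v x t)) \<and>
     (\<forall>v \<in> carrier_vec (dim_row A). \<forall>x. \<gamma> v (\<gamma> v x) = (\<lambda>t. qval A v * x t))"

lemma clifford_mapD:
  assumes "clifford_map A \<gamma>" "A \<in> carrier_mat n n"
  shows "v \<in> carrier_vec n \<Longrightarrow> linear_op (\<gamma> v)"
    and "v \<in> carrier_vec n \<Longrightarrow> w \<in> carrier_vec n \<Longrightarrow> \<gamma> (v + w) x = (\<lambda>t. \<gamma> v x t + \<gamma> w x t)"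
    and "v \<in> carrier_vec n \<Longrightarrow> \<gamma> (c \<cdot>\<^sub>v v) x = (\<lambda>t. c * \<gamma> v x t)"
    and "v \<in> carrier_vec n \<Longrightarrow> \<gamma> v (\<gamma> v x) = (\<lambda>t. qval A v * x t)"
  using assms unfolding clifford_map_def by auto

lemma clifford_mapI:
  assumes "A \<in> carrier_mat n n"
    and "\<And>v. v \<in> carrier_vec n \<Longrightarrow> linear_op (\<gamma> v)"
    and "\<And>v w x. v \<in> carrier_vec n \<Longrightarrow> w \<in> carrier_vec n \<Longrightarrow> \<gamma> (v + w) x = (\<lambda>t. \<gamma> v x t + \<gamma> w x t)"
    and "\<And>c v x. v \<in> carrier_vec n \<Longrightarrow> \<gamma> (c \<cdot>\<^sub>v v) x = (\<lambda>t. c * \<gamma> v x t)"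
    and "\<And>v x. v \<in> carrier_vec n \<Longrightarrow> \<gamma> v (\<gamma> v x) = (\<lambda>t. qval A v * x t)"
  shows "clifford_map A \<gamma>"
  using assms unfolding clifford_map_def by auto

lemma clifford_map_pullback:
  assumes g: "clifford_map A \<gamma>" and A: "A \<in> carrier_mat n n" and B: "B \<in> carrier_mat m m"
    and T: "\<And>v. v \<in> carrier_vec m \<Longrightarrow> T v \<in> carrier_vec n"
    and add: "\<And>v w. v \<in> carrier_vec m \<Longrightarrow> w \<in> carrier_vec m \<Longrightarrow> T (v + w) = T v + T w"
    and smult: "\<And>c v. v \<in> carrier_vec m \<Longrightarrow> T (c \<cdot>\<^sub>v v) = c \<cdot>\<^sub>v T v"
    and q: "\<And>v. v \<in> carrier_vec m \<Longrightarrow> qval B v = qval A (T v)"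
  shows "clifford_map B (\<lambda>v. \<gamma> (T v))"
proof (rule clifford_mapI[OF B])
  fix v w :: "'a vec" and x c assume v: "v \<in> carrier_vec m"
  note D = clifford_mapD[OF g A]
  show "linear_op (\<gamma> (T v))" by (rule D(1)[OF T[OF v]])
  show "\<gamma> (T (c \<cdot>\<^sub>v v)) x = (\<lambda>t. c * \<gamma> (T v) x t)" unfolding smult[OF v] by (rule D(3)[OF T[OF v]])
  show "\<gamma> (T v) (\<gamma> (T v) x) = (\<lambda>t. qval B v * x t)" unfolding q[OF v] by (rule D(4)[OF T[OF v]])
  show "\<gamma> (T (v + w)) x = (\<lambda>t. \<gamma> (T v) x t + \<gamma> (T w) x t)" if w: "w \<in> carrier_vec m"
    unfolding add[OF v w] by (rule D(2)[OF T[OF v] T[OF w]])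
qed

lemma clifford_map_anticommute:
  assumes g: "clifford_map A \<gamma>" and A: "A \<in> carrier_mat n n"
    and v: "v \<in> carrier_vec n" and w: "w \<in> carrier_vec n"
  shows "\<gamma> v (\<gamma> w x) t + \<gamma> w (\<gamma> v x) t = polar A v w * x t"
proof -
  note d = clifford_mapD[OF g A]
  have "\<gamma> (v + w) (\<gamma> (v + w) x) t = qval A (v + w) * x t" using d(4)[of "v + w"] v w by simp
  moreover have "\<gamma> (v + w) (\<gamma> (v + w) x) t =
      \<gamma> v (\<gamma> v x) t + \<gamma> w (\<gamma> v x) t + (\<gamma> v (\<gamma> w x) t + \<gamma> w (\<gamma> w x) t)"
    using d(2)[OF v w] linear_op_add[OF d(1)[OF v]] linear_op_add[OF d(1)[OF w]] by (simp add: algebra_simps)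
  ultimately show ?thesis
    using d(4)[OF v] d(4)[OF w] by (simp add: qval_add algebra_simps)
qed

lemma clifford_map_lincomb:
  assumes g: "clifford_map A \<gamma>" and A: "A \<in> carrier_mat n n"
  shows "(\<Sum>i<n. c i * \<gamma> (unit_vec n i) x t) = \<gamma> (vec n c) x t"
proof -
  note d = clifford_mapD[OF g A]
  have "\<gamma> (0 \<cdot>\<^sub>v 0\<^sub>v n) x = (\<lambda>t. 0 * \<gamma> (0\<^sub>v n) x t)" by (rule d(3)) simp
  moreover have "0 \<cdot>\<^sub>v 0\<^sub>v n = (0\<^sub>v n :: 'a vec)" by (intro eq_vecI) auto
  ultimately have zero: "\<gamma> (0\<^sub>v n) x = (\<lambda>t. 0)" by simp
  have "(\<Sum>i<k. c i * \<gamma> (unit_vec n i) x t) = \<gamma> (vec n (\<lambda>i. if i < k then c i else 0)) x t" if "k \<le> n" for k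
    using that
  proof (induction k)
    case 0
    have "vec n (\<lambda>i. 0) = (0\<^sub>v n :: 'a vec)" by (intro eq_vecI) auto
    then show ?case using zero by simp
  next
    case (Suc k)
    have "vec n (\<lambda>i. if i < Suc k then c i else 0) =
        vec n (\<lambda>i. if i < k then c i else 0) + c k \<cdot>\<^sub>v unit_vec n k"
      using Suc.prems by (intro eq_vecI) (auto simp: less_Suc_eq)
    then have "\<gamma> (vec n (\<lambda>i. if i < Suc k then c i else 0)) x t =
        \<gamma> (vec n (\<lambda>i. if i < k then c i else 0)) x t + \<gamma> (c k \<cdot>\<^sub>v unit_vec n k) x t"
      using d(2)[of "vec n (\<lambda>i. if i < k then c i else 0)" "c k \<cdot>\<^sub>v unit_vec n k" x] by simp
    then show ?case using Suc d(3)[of "unit_vec n k" "c k" x] by simp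
  qed
  moreover have "vec n (\<lambda>i. if i < n then c i else 0) = vec n c" by (intro eq_vecI) auto
  ultimately show ?thesis by simp
qed

text \<open>In characteristic 2 there are no signs: operators that commute with a Clifford map extend
  it to an orthogonal sum.\<close>

definition extend_map ::
  "(('i \<Rightarrow> 'a::field) \<Rightarrow> 'i \<Rightarrow> 'a) \<Rightarrow> (('i \<Rightarrow> 'a) \<Rightarrow> 'i \<Rightarrow> 'a) \<Rightarrow> ('a vec \<Rightarrow> ('i \<Rightarrow> 'a) \<Rightarrow> 'i \<Rightarrow> 'a) \<Rightarrow>
    'a vec \<Rightarrow> ('i \<Rightarrow> 'a) \<Rightarrow> 'i \<Rightarrow> 'a" where
  "extend_map e f \<gamma> v x t = v $ 0 * e x t + v $ 1 * f x t + \<gamma> (vec_last v (dim_vec v - 2)) x t"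

lemma linear_extend_map:
  assumes "linear_op e" "linear_op f" "linear_op (\<gamma> (vec_last v (dim_vec v - 2)))"
  shows "linear_op (extend_map e f \<gamma> v)"
  using assms by (auto simp: linear_op_def extend_map_def fun_eq_iff algebra_simps)

context char_two_field
begin

lemma extend_map_clifford:
  assumes g: "clifford_map A \<gamma>" and A: "A \<in> carrier_mat n n" and B: "B \<in> carrier_mat 2 2"
    and lin: "linear_op e" "linear_op f"
    and qB: "\<And>v. v \<in> carrier_vec 2 \<Longrightarrow> qval B v = p * (v $ 0)\<^sup>2 + r * v $ 0 * v $ 1 + s * (v $ 1 :: 'a)\<^sup>2"
    and ee: "\<And>x. e (e x) = (\<lambda>t. p * x t)" and ff: "\<And>x. f (f x) = (\<lambda>t. s * x t)"
    and ef: "\<And>x t. e (f x) t + f (e x) t = r * x t"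
    and ce: "\<And>v x. v \<in> carrier_vec n \<Longrightarrow> \<gamma> v (e x) = e (\<gamma> v x)"
    and cf: "\<And>v x. v \<in> carrier_vec n \<Longrightarrow> \<gamma> v (f x) = f (\<gamma> v x)"
  shows "clifford_map (orth_sum B A) (extend_map e f \<gamma>)"
proof (rule clifford_mapI[of _ "2 + n"])
  note d = clifford_mapD[OF g A]
  show "orth_sum B A \<in> carrier_mat (2 + n) (2 + n)" using A B by auto
  have L: "vec_last v (dim_vec v - 2) \<in> carrier_vec n" if "v \<in> carrier_vec (2 + n)" for v :: "'a vec"
    using that by simp
  show "linear_op (extend_map e f \<gamma> v)" if "v \<in> carrier_vec (2 + n)" for v
    using linear_extend_map[of e f \<gamma> v, OF lin d(1)[OF L[OF that]]] .
  fix v :: "'a vec" and x assume v: "v \<in> carrier_vec (2 + n)"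
  show "extend_map e f \<gamma> (v + w) x = (\<lambda>t. extend_map e f \<gamma> v x t + extend_map e f \<gamma> w x t)"
    if w: "w \<in> carrier_vec (2 + n)" for w
  proof -
    have "vec_last (v + w) (dim_vec (v + w) - 2) = vec_last v (dim_vec v - 2) + vec_last w (dim_vec w - 2)"
      using v w by (intro eq_vecI) (auto simp: vec_last_def)
    then show ?thesis
      using d(2)[OF L[OF v] L[OF w], of x] v w by (auto simp: extend_map_def fun_eq_iff algebra_simps)
  qed
  show "extend_map e f \<gamma> (c \<cdot>\<^sub>v v) x = (\<lambda>t. c * extend_map e f \<gamma> v x t)" for c
  proof -
    have "vec_last (c \<cdot>\<^sub>v v) (dim_vec (c \<cdot>\<^sub>v v) - 2) = c \<cdot>\<^sub>v vec_last v (dim_vec v - 2)"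
      using v by (intro eq_vecI) (auto simp: vec_last_def)
    then show ?thesis
      using d(3)[OF L[OF v], of c x] v by (auto simp: extend_map_def fun_eq_iff algebra_simps)
  qed
  show "extend_map e f \<gamma> v (extend_map e f \<gamma> v x) = (\<lambda>t. qval (orth_sum B A) v * x t)"
  proof
    fix t
    define u where "u = vec_last v n"
    have u: "u \<in> carrier_vec n" by (simp add: u_def)
    have ext: "extend_map e f \<gamma> v = (\<lambda>y t. v $ 0 * e y t + v $ 1 * f y t + \<gamma> u y t)"
      using v by (auto simp: extend_map_def u_def fun_eq_iff)
    have v2: "vec_first v 2 $ 0 = v $ 0" "vec_first v 2 $ 1 = v $ 1" by (simp_all add: vec_first_def)
    have q: "qval (orth_sum B A) v = p * (v $ 0)\<^sup>2 + r * v $ 0 * v $ 1 + s * (v $ 1)\<^sup>2 + qval A u"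
      using qval_orth_sum_split[OF B A v] qB[of "vec_first v 2", unfolded v2] by (simp add: u_def)
    note l = linear_op_add[OF lin(1)] linear_op_add[OF lin(2)] linear_op_add[OF d(1)[OF u]]
      linear_op_scale[OF lin(1)] linear_op_scale[OF lin(2)] linear_op_scale[OF d(1)[OF u]]
    have fe: "f (e x) t = r * x t + e (f x) t" using ef[of x t] char2_simps by (metis add.commute)
    \<comment> \<open>Each product of an operator of the plane with one of \<open>A\<close> occurs
      twice, since they commute, and so vanishes.\<close>
    show "extend_map e f \<gamma> v (extend_map e f \<gamma> v x) t = qval (orth_sum B A) v * x t"
      unfolding ext q
      by (simp only: l ee ff ce[OF u] cf[OF u] d(4)[OF u] fe)
        (simp add: algebra_simps power2_eq_square char2_simps)
  qed
qed

text \<open>The pair \<open>(e, z)\<close> generates the quaternion algebra \<open>[a, c)\<close>.\<close>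

definition quaternion_pair :: "'a \<Rightarrow> 'a \<Rightarrow> (('i \<Rightarrow> 'a) \<Rightarrow> 'i \<Rightarrow> 'a) \<Rightarrow> (('i \<Rightarrow> 'a) \<Rightarrow> 'i \<Rightarrow> 'a) \<Rightarrow> bool" where
  "quaternion_pair a c e z \<longleftrightarrow> linear_op e \<and> linear_op z \<and> (\<forall>x. e (e x) = (\<lambda>t. c * x t)) \<and>
     (\<forall>x. z (z x) = (\<lambda>t. z x t + a * x t)) \<and> (\<forall>x. z (e x) = (\<lambda>t. e (z x) t + e x t))"

text \<open>In [a, c) the elements e and e z have squares c and c a, and e (e z) + (e z) e = c. So
  they span a copy of c[1, a].\<close>

lemma extend_map_quaternion:
  assumes g: "clifford_map A \<gamma>" and A: "A \<in> carrier_mat n n" and ez: "quaternion_pair a c e z"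
    and ce: "\<And>v x. v \<in> carrier_vec n \<Longrightarrow> \<gamma> v (e x) = e (\<gamma> v x)"
    and cz: "\<And>v x. v \<in> carrier_vec n \<Longrightarrow> \<gamma> v (z x) = z (\<gamma> v x)"
  shows "clifford_map (orth_sum (c \<cdot>\<^sub>m binary_form 1 a) A) (extend_map e (\<lambda>x. e (z x)) \<gamma>)"
proof (rule extend_map_clifford[OF g A, where p = c and r = c and s = "c * a"])
  have lin: "linear_op e" "linear_op z" and ee: "\<And>x. e (e x) = (\<lambda>t. c * x t)"
    and zz: "\<And>x. z (z x) = (\<lambda>t. z x t + a * x t)" and ze: "\<And>x. z (e x) = (\<lambda>t. e (z x) t + e x t)"
    using ez unfolding quaternion_pair_def by blast+
  note l = linear_op_add[OF lin(1)] linear_op_add[OF lin(2)] linear_op_scale[OF lin(1)] linear_op_scale[OF lin(2)]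
  show "linear_op e" "linear_op (\<lambda>x. e (z x))" using lin by (auto intro: linear_op_comp)
  show "e (e x) = (\<lambda>t. c * x t)" for x by (rule ee)
  show "e (z (e (z x))) = (\<lambda>t. c * a * x t)" for x
    by (rule ext) (simp add: ze zz l ee algebra_simps char2_simps)
  show "e (e (z x)) t + e (z (e x)) t = c * x t" for x t
    by (simp add: ze zz l ee algebra_simps char2_simps)
  show "qval (c \<cdot>\<^sub>m binary_form 1 a) v = c * (v $ 0)\<^sup>2 + c * v $ 0 * v $ 1 + c * a * (v $ 1)\<^sup>2"
    if "v \<in> carrier_vec 2" for v
    using qval_block_form[of c a "v $ 0" "v $ 1"] vec2_eq[OF that] by (simp add: algebra_simps)
qed (use ce cz in auto)

end

section \<open>Split forms\<close>

text \<open>A form of dimension \<open>2 N\<close> is split if its Clifford algebra acts on a space of dimension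
  \<open>2 ^ N\<close>, here the functions supported on the subsets of \<open>{..<N}\<close>. Locality keeps the coordinates
  beyond \<open>N\<close> free for further summands.\<close>

definition split_form :: "nat \<Rightarrow> 'a::field mat \<Rightarrow> bool" where
  "split_form N A \<longleftrightarrow> A \<in> carrier_mat (2 * N) (2 * N) \<and>
     (\<exists>\<gamma>. clifford_map A \<gamma> \<and> (\<forall>v \<in> carrier_vec (2 * N). local_op N (\<gamma> v)))"

lemma split_form_empty: "split_form 0 (0\<^sub>m 0 0)"
  unfolding split_form_def
proof (intro conjI exI ballI)
  show "clifford_map (0\<^sub>m 0 0) (\<lambda>v x t. 0)"
    by (rule clifford_mapI[of _ 0]) (auto simp: linear_op_def qval_def scalar_prod_def)
  show "local_op 0 (\<lambda>x t. 0)" by (auto simp: local_op_def linear_op_def supported_def coord_op_def)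
qed simp

lemma local_extend_map:
  assumes "local_op N e" "local_op N f" "local_op N (\<gamma> (vec_last v (dim_vec v - 2)))"
  shows "local_op N (extend_map e f \<gamma> v)"
proof -
  have "extend_map e f \<gamma> v = (\<lambda>x t. v $ 0 * e x t + v $ 1 * f x t + \<gamma> (vec_last v (dim_vec v - 2)) x t)"
    by (simp add: extend_map_def fun_eq_iff)
  then show ?thesis using assms by (simp add: local_op_plus local_op_smult)
qed

context char_two_field
begin

lemma split_form_hyperbolic_plane:
  assumes "split_form N (A :: 'a mat)"
  shows "split_form (Suc N) (orth_sum (binary_form 0 0) A)"
proof -
  obtain \<gamma> where A: "A \<in> carrier_mat (2 * N) (2 * N)" and g: "clifford_map A \<gamma>"
    and loc: "\<And>v. v \<in> carrier_vec (2 * N) \<Longrightarrow> local_op N (\<gamma> v)"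
    using assms unfolding split_form_def by blast
  \<comment> \<open>The two off-diagonal matrix units on the fresh factor \<open>N\<close>: both
    square to 0 and their anticommutator is the identity.\<close>
  let ?e = "coord_op N 0 0 1 0 :: (nat set \<Rightarrow> 'a) \<Rightarrow> _" and ?f = "coord_op N 0 1 0 0 :: (nat set \<Rightarrow> 'a) \<Rightarrow> _"
  have "clifford_map (orth_sum (binary_form 0 0) A) (extend_map ?e ?f \<gamma>)"
    by (rule extend_map_clifford[OF g A binary_form_carrier linear_coord_op linear_coord_op,
          where p = 0 and r = 1 and s = 0])
      (use local_op_commute[OF loc] in \<open>auto simp: qval_binary coord_op_comp coord_op_def fun_eq_iff\<close>)
  moreover have "local_op (Suc N) (extend_map ?e ?f \<gamma> v)" if "v \<in> carrier_vec (2 * Suc N)" for v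
    using that by (intro local_extend_map local_coord_op local_op_mono[OF loc]) auto
  moreover have "orth_sum (binary_form 0 0) A \<in> carrier_mat (2 * Suc N) (2 * Suc N)"
    using orth_sum_carrier[OF binary_form_carrier A, of 0 0] by simp
  ultimately show ?thesis unfolding split_form_def by blast
qed

lemma split_form_hyperbolic_sum:
  assumes "split_form N (A :: 'a mat)"
  shows "split_form (m + N) (orth_sum (hyperbolic_sum m) A)"
proof (induction m)
  case (Suc m)
  from split_form_hyperbolic_plane[OF this] show ?case
    by (simp add: hyperbolic_sum_Suc orth_sum_assoc)
qed (simp add: assms)

text \<open>The four quaternion pairs share the coordinate \<open>N\<close>, on which \<open>\<zeta>\<close> generates the
  separable quadratic algebra of \<open>a\<close> and \<open>\<sigma>\<close> is its conjugation.\<close>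

lemma split_form_four_blocks:
  assumes "split_form N (A :: 'a mat)" and c1_eq: "c1 = r\<^sup>2 * c2 * c3 * c4"
  shows "split_form (N + 4)
    (orth_sum (c1 \<cdot>\<^sub>m binary_form 1 a) (orth_sum (c2 \<cdot>\<^sub>m binary_form 1 a)
      (orth_sum (c3 \<cdot>\<^sub>m binary_form 1 a) (orth_sum (c4 \<cdot>\<^sub>m binary_form 1 a) A))))"
proof -
  obtain \<gamma> where A: "A \<in> carrier_mat (2 * N) (2 * N)" and g: "clifford_map A \<gamma>"
    and loc: "\<And>v. v \<in> carrier_vec (2 * N) \<Longrightarrow> local_op N (\<gamma> v)"
    using assms unfolding split_form_def by blast
  let ?c = "coord_op :: nat \<Rightarrow> 'a \<Rightarrow> _"
  \<comment> \<open>The companion matrix of z^2 + z + a. The matrix of \<open>\<sigma>\<close>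
    satisfies \<open>\<zeta> \<sigma>\<close> = \<open>\<sigma>\<close> (\<open>\<zeta>\<close> +
    1).\<close>
  define \<zeta> where "\<zeta> = ?c N 0 a 1 1"
  define \<sigma> where "\<sigma> = ?c N 1 1 0 1"
  \<comment> \<open>Each further factor carries a square root of a scalar and a projection below.
    Moving the projection past the root adds 1 to it, so \<open>\<zeta>\<close> plus the projection
    forms a quaternion pair with the root.\<close>
  define X2 where "X2 = ?c (N + 1) 0 c2 1 0"
  define X3 where "X3 = ?c (N + 2) 0 c3 1 0"
  define X4 where "X4 = ?c (N + 3) 0 c4 1 0"
  define w2 where "w2 = ?c (N + 1) 0 0 0 1"
  define w3 where "w3 = ?c (N + 2) 0 0 0 1"
  define w4 where "w4 = ?c (N + 3) 0 0 0 1"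
  note defs = \<zeta>_def \<sigma>_def X2_def X3_def X4_def w2_def w3_def w4_def
  have lin: "linear_op \<zeta>" "linear_op \<sigma>" "linear_op X2" "linear_op X3" "linear_op X4"
    "linear_op w2" "linear_op w3" "linear_op w4"
    unfolding defs by (rule linear_coord_op)+
  have loc': "local_op (N + 4) \<zeta>" "local_op (N + 4) \<sigma>" "local_op (N + 4) X2" "local_op (N + 4) X3"
    "local_op (N + 4) X4" "local_op (N + 4) w2" "local_op (N + 4) w3" "local_op (N + 4) w4"
    unfolding defs by (rule local_coord_op, simp)+
  have gam: "\<gamma> v (\<zeta> x) = \<zeta> (\<gamma> v x)" "\<gamma> v (\<sigma> x) = \<sigma> (\<gamma> v x)" "\<gamma> v (X2 x) = X2 (\<gamma> v x)"
    "\<gamma> v (X3 x) = X3 (\<gamma> v x)" "\<gamma> v (X4 x) = X4 (\<gamma> v x)" "\<gamma> v (w2 x) = w2 (\<gamma> v x)"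
    "\<gamma> v (w3 x) = w3 (\<gamma> v x)" "\<gamma> v (w4 x) = w4 (\<gamma> v x)" if "v \<in> carrier_vec (2 * N)" for v x
    unfolding defs by (rule local_op_commute[OF loc[OF that]], simp)+
  have sq: "\<zeta> (\<zeta> x) = (\<lambda>t. \<zeta> x t + a * x t)" "\<sigma> (\<sigma> x) = x" "\<zeta> (\<sigma> x) = (\<lambda>t. \<sigma> (\<zeta> x) t + \<sigma> x t)"
    "X2 (X2 x) = (\<lambda>t. c2 * x t)" "X3 (X3 x) = (\<lambda>t. c3 * x t)" "X4 (X4 x) = (\<lambda>t. c4 * x t)"
    "w2 (w2 x) = w2 x" "w3 (w3 x) = w3 x" "w4 (w4 x) = w4 x"
    "w2 (X2 x) = (\<lambda>t. X2 (w2 x) t + X2 x t)" "w3 (X3 x) = (\<lambda>t. X3 (w3 x) t + X3 x t)"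
    "w4 (X4 x) = (\<lambda>t. X4 (w4 x) t + X4 x t)" for x
    unfolding defs by (auto simp: fun_eq_iff coord_op_comp coord_op_def algebra_simps char2_simps insert_absorb)
  \<comment> \<open>All equations are oriented towards the order \<open>X2\<close>,
    \<open>X3\<close>, \<open>X4\<close>, \<open>\<sigma>\<close>, \<open>\<zeta>\<close>,
    \<open>w2\<close>, \<open>w3\<close>, \<open>w4\<close>, with the Clifford map innermost.
    Rewriting therefore yields normal forms.\<close>
  have com: "X3 (X2 x) = X2 (X3 x)" "X4 (X2 x) = X2 (X4 x)" "X4 (X3 x) = X3 (X4 x)"
    "\<zeta> (X2 x) = X2 (\<zeta> x)" "\<zeta> (X3 x) = X3 (\<zeta> x)" "\<zeta> (X4 x) = X4 (\<zeta> x)"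
    "\<sigma> (X2 x) = X2 (\<sigma> x)" "\<sigma> (X3 x) = X3 (\<sigma> x)" "\<sigma> (X4 x) = X4 (\<sigma> x)"
    "w3 (X2 x) = X2 (w3 x)" "w4 (X2 x) = X2 (w4 x)" "w2 (X3 x) = X3 (w2 x)" "w4 (X3 x) = X3 (w4 x)"
    "w2 (X4 x) = X4 (w2 x)" "w3 (X4 x) = X4 (w3 x)"
    "w2 (\<zeta> x) = \<zeta> (w2 x)" "w3 (\<zeta> x) = \<zeta> (w3 x)" "w4 (\<zeta> x) = \<zeta> (w4 x)"
    "w2 (\<sigma> x) = \<sigma> (w2 x)" "w3 (\<sigma> x) = \<sigma> (w3 x)" "w4 (\<sigma> x) = \<sigma> (w4 x)"
    "w3 (w2 x) = w2 (w3 x)" "w4 (w2 x) = w2 (w4 x)" "w4 (w3 x) = w3 (w4 x)" for x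
    unfolding defs by (rule coord_op_commute, simp)+
  note add = lin[THEN linear_op_add] and scale = lin[THEN linear_op_scale]
  note norm = add scale sq com
  \<comment> \<open>Its square is r^2 c2 c3 c4 = c1. Passing \<open>e1\<close>, each of
    \<open>z2\<close>, \<open>z3\<close>, \<open>z4\<close> is shifted by 1 twice, by
    \<open>\<sigma>\<close> and by one root, so it commutes with \<open>e1\<close>. But
    \<open>\<zeta>\<close> alone is shifted once, which makes (\<open>e1\<close>,
    \<open>\<zeta>\<close>) the missing quaternion pair.\<close>
  define e1 where "e1 = (\<lambda>x t. r * X2 (X3 (X4 (\<sigma> x))) t)"
  define z2 where "z2 = (\<lambda>x t. \<zeta> x t + w2 x t)"
  define z3 where "z3 = (\<lambda>x t. \<zeta> x t + w3 x t)"
  define z4 where "z4 = (\<lambda>x t. \<zeta> x t + w4 x t)"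
  note ez = e1_def z2_def z3_def z4_def
  have lin': "linear_op e1" "linear_op z2" "linear_op z3" "linear_op z4"
    unfolding ez
    by (rule linear_op_smult[OF linear_op_comp[OF lin(3) linear_op_comp[OF lin(4) linear_op_comp[OF lin(5,2)]]]]
        linear_op_plus[OF lin(1,6)] linear_op_plus[OF lin(1,7)] linear_op_plus[OF lin(1,8)])+
  have locz: "local_op (N + 4) e1" "local_op (N + 4) z2" "local_op (N + 4) z3" "local_op (N + 4) z4"
    unfolding ez
    by (rule local_op_smult[OF local_op_comp[OF loc'(3) local_op_comp[OF loc'(4) local_op_comp[OF loc'(5,2)]]]]
        local_op_plus[OF loc'(1,6)] local_op_plus[OF loc'(1,7)] local_op_plus[OF loc'(1,8)])+
  have q1: "quaternion_pair a c1 e1 \<zeta>"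
    unfolding quaternion_pair_def
  proof (intro conjI allI ext lin lin')
    show "e1 (e1 x) t = c1 * x t" for x t
      unfolding ez c1_eq by (simp only: norm) (simp add: power2_eq_square mult_ac)
    show "\<zeta> (\<zeta> x) t = \<zeta> x t + a * x t" for x t by (simp add: sq)
    show "\<zeta> (e1 x) t = e1 (\<zeta> x) t + e1 x t" for x t
      unfolding ez by (simp only: norm) (simp add: algebra_simps)
  qed
  have q2: "quaternion_pair a c2 X2 z2" and q3: "quaternion_pair a c3 X3 z3"
    and q4: "quaternion_pair a c4 X4 z4"
    unfolding quaternion_pair_def ez using lin'[unfolded ez]
    by (auto simp only: norm lin) (auto simp: fun_eq_iff algebra_simps char2_simps)
  let ?A4 = "orth_sum (c4 \<cdot>\<^sub>m binary_form 1 a) A"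
  let ?A3 = "orth_sum (c3 \<cdot>\<^sub>m binary_form 1 a) ?A4"
  let ?A2 = "orth_sum (c2 \<cdot>\<^sub>m binary_form 1 a) ?A3"
  let ?A1 = "orth_sum (c1 \<cdot>\<^sub>m binary_form 1 a) ?A2"
  have bl: "c \<cdot>\<^sub>m binary_form 1 a \<in> carrier_mat 2 2" for c by simp
  have A4: "?A4 \<in> carrier_mat (2 + 2 * N) (2 + 2 * N)" by (rule orth_sum_carrier[OF bl A])
  have A3: "?A3 \<in> carrier_mat (2 + (2 + 2 * N)) (2 + (2 + 2 * N))" by (rule orth_sum_carrier[OF bl A4])
  have A2: "?A2 \<in> carrier_mat (2 + (2 + (2 + 2 * N))) (2 + (2 + (2 + 2 * N)))"
    by (rule orth_sum_carrier[OF bl A3])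
  have A1: "?A1 \<in> carrier_mat (2 * (N + 4)) (2 * (N + 4))"
    using orth_sum_carrier[OF bl[of "c1"] A2] by (simp add: algebra_simps)
  define g4 where "g4 = extend_map X4 (\<lambda>x. X4 (z4 x)) \<gamma>"
  define g3 where "g3 = extend_map X3 (\<lambda>x. X3 (z3 x)) g4"
  define g2 where "g2 = extend_map X2 (\<lambda>x. X2 (z2 x)) g3"
  define g1 where "g1 = extend_map e1 (\<lambda>x. e1 (\<zeta> x)) g2"
  have last: "vec_last v (dim_vec v - 2) \<in> carrier_vec n" if "v \<in> carrier_vec (2 + n)" for v :: "'a vec" and n
    using that by simp
  note gadd = local_op_linear[OF loc, THEN linear_op_add] local_op_linear[OF loc, THEN linear_op_scale]
  have cm4: "clifford_map ?A4 g4"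
    unfolding g4_def by (rule extend_map_quaternion[OF g A q4]) (simp_all only: gam norm ez gadd)
  have cm3: "clifford_map ?A3 g3" unfolding g3_def
  proof (rule extend_map_quaternion[OF cm4 A4 q3])
    fix v :: "'a vec" and x assume "v \<in> carrier_vec (2 + 2 * N)"
    note u = last[OF this]
    show "g4 v (X3 x) = X3 (g4 v x)" "g4 v (z3 x) = z3 (g4 v x)"
      unfolding g4_def extend_map_def ez by (simp_all only: gam[OF u] norm gadd[OF u]) (auto simp: algebra_simps)
  qed
  have cm2: "clifford_map ?A2 g2" unfolding g2_def
  proof (rule extend_map_quaternion[OF cm3 A3 q2])
    fix v :: "'a vec" and x assume "v \<in> carrier_vec (2 + (2 + 2 * N))"
    note u = last[OF last[OF this]]
    show "g3 v (X2 x) = X2 (g3 v x)" "g3 v (z2 x) = z2 (g3 v x)"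
      unfolding g3_def g4_def extend_map_def ez by (simp_all only: gam[OF u] norm gadd[OF u]) (auto simp: algebra_simps)
  qed
  have cm1: "clifford_map ?A1 g1" unfolding g1_def
  proof (rule extend_map_quaternion[OF cm2 A2 q1])
    fix v :: "'a vec" and x assume "v \<in> carrier_vec (2 + (2 + (2 + 2 * N)))"
    note u = last[OF last[OF last[OF this]]]
    show "g2 v (e1 x) = e1 (g2 v x)" "g2 v (\<zeta> x) = \<zeta> (g2 v x)"
      unfolding g2_def g3_def g4_def extend_map_def ez
      by (simp_all only: gam[OF u] norm gadd[OF u]) (auto simp: algebra_simps char2_simps)
  qed
  have l4: "local_op (N + 4) (g4 v)" if "v \<in> carrier_vec (2 + 2 * N)" for v
    unfolding g4_def
    by (rule local_extend_map[where \<gamma> = \<gamma>, OF loc'(5) local_op_comp[OF loc'(5) locz(4)]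
          local_op_mono[OF loc[OF last[OF that]]]]) simp
  have l3: "local_op (N + 4) (g3 v)" if "v \<in> carrier_vec (2 + (2 + 2 * N))" for v
    unfolding g3_def
    by (rule local_extend_map[where \<gamma> = g4, OF loc'(4) local_op_comp[OF loc'(4) locz(3)] l4[OF last[OF that]]])
  have l2: "local_op (N + 4) (g2 v)" if "v \<in> carrier_vec (2 + (2 + (2 + 2 * N)))" for v
    unfolding g2_def
    by (rule local_extend_map[where \<gamma> = g3, OF loc'(3) local_op_comp[OF loc'(3) locz(2)] l3[OF last[OF that]]])
  have l1: "local_op (N + 4) (g1 v)" if "v \<in> carrier_vec (2 + (2 + (2 + (2 + 2 * N))))" for v
    unfolding g1_def
    by (rule local_extend_map[where \<gamma> = g2, OF locz(1) local_op_comp[OF locz(1) loc'(1)] l2[OF last[OF that]]])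
  have "2 * (N + 4) = 2 + (2 + (2 + (2 + 2 * N)))" by simp
  then have "\<forall>v \<in> carrier_vec (2 * (N + 4)). local_op (N + 4) (g1 v)" using l1 by metis
  then show ?thesis unfolding split_form_def using cm1 A1 by blast
qed

end

section \<open>Clifford modules of bounded dimension\<close>

text \<open>An upper bound on the dimension and one nonzero element are all that the counting
  argument needs; both are easy to carry over to subspaces.\<close>

definition clifford_module :: "'a::field mat \<Rightarrow> nat \<Rightarrow> bool" where
  "clifford_module A d \<longleftrightarrow> (\<exists>\<gamma> (W :: (nat set \<Rightarrow> 'a) set). clifford_map A \<gamma> \<and> linear_subspace W \<and>
     (\<forall>v \<in> carrier_vec (dim_row A). \<forall>x \<in> W. \<gamma> v x \<in> W) \<and> (\<exists>x \<in> W. x \<noteq> (\<lambda>t. 0)) \<and> dim_bound W d)"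

lemma clifford_moduleD:
  fixes A :: "'a::field mat"
  assumes "clifford_module A d" "A \<in> carrier_mat n n"
  shows "\<exists>\<gamma> (W :: (nat set \<Rightarrow> 'a) set) x. clifford_map A \<gamma> \<and> linear_subspace W \<and>
    (\<forall>v \<in> carrier_vec n. \<forall>x \<in> W. \<gamma> v x \<in> W) \<and> x \<in> W \<and> x \<noteq> (\<lambda>t. 0) \<and> dim_bound W d"
  using assms unfolding clifford_module_def by blast

lemma clifford_moduleI:
  fixes W :: "(nat set \<Rightarrow> 'a::field) set"
  assumes "A \<in> carrier_mat n n" "clifford_map A \<gamma>" "linear_subspace W"
    "\<And>v x. v \<in> carrier_vec n \<Longrightarrow> x \<in> W \<Longrightarrow> \<gamma> v x \<in> W" "x \<in> W" "x \<noteq> (\<lambda>t. 0)" "dim_bound W d"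
  shows "clifford_module A d"
  unfolding clifford_module_def using assms by (intro exI[of _ \<gamma>] exI[of _ W]) auto

lemma split_form_clifford_module:
  fixes A :: "'a::field mat"
  assumes "split_form N A"
  shows "clifford_module A (2 ^ N)"
proof -
  obtain \<gamma> where A: "A \<in> carrier_mat (2 * N) (2 * N)" and g: "clifford_map A \<gamma>"
    and loc: "\<And>v. v \<in> carrier_vec (2 * N) \<Longrightarrow> local_op N (\<gamma> v)"
    using assms unfolding split_form_def by blast
  define W :: "(nat set \<Rightarrow> 'a) set" where "W = {x. supported N x}"
  show ?thesis
  proof (rule clifford_moduleI[OF A g])
    show "linear_subspace W" unfolding W_def by (auto simp: linear_subspace_def supported_def)
    show "\<gamma> v x \<in> W" if "v \<in> carrier_vec (2 * N)" "x \<in> W" for v x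
      using local_op_supported[OF loc[OF that(1)], of N x] that(2) by (simp add: W_def)
    show "(\<lambda>t. if t = {} then 1 else 0) \<in> W" by (auto simp: W_def supported_def)
    show "(\<lambda>t. if t = {} then 1 else 0) \<noteq> (\<lambda>t :: nat set. 0 :: 'a)" by (metis zero_neq_one)
    show "dim_bound W (2 ^ N)"
      unfolding dim_bound_def
    proof (intro allI impI)
      fix n :: nat and x :: "nat \<Rightarrow> nat set \<Rightarrow> 'a"
      assume "2 ^ N < n" "\<forall>i<n. x i \<in> W"
      then show "\<exists>c. (\<exists>i<n. c i \<noteq> 0) \<and> (\<forall>t. (\<Sum>i<n. c i * x i t) = 0)"
        using finite_support_dependent[of "Pow {..<N}" "{..<n}" x]
        by (auto simp: card_Pow W_def supported_def)
    qed
  qed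
qed

lemma clifford_module_isometric:
  assumes "clifford_module A d" "isometric A B"
  shows "clifford_module B d"
proof -
  define n where "n = dim_row A"
  have A: "A \<in> carrier_mat n n" using assms(2) by (auto simp: isometric_def n_def)
  obtain P Q where P: "P \<in> carrier_mat n n" and "Q \<in> carrier_mat n n" "P * Q = 1\<^sub>m n" "Q * P = 1\<^sub>m n"
    and B: "B \<in> carrier_mat n n" and q: "\<And>v. v \<in> carrier_vec n \<Longrightarrow> qval B v = qval A (P *\<^sub>v v)"
    by (rule isometricE[OF assms(2) A]) (rule that)
  obtain \<gamma> and W :: "(nat set \<Rightarrow> 'a) set" and x where g: "clifford_map A \<gamma>" and W1: "linear_subspace W"
    and W2: "\<forall>v \<in> carrier_vec n. \<forall>x \<in> W. \<gamma> v x \<in> W"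
    and W345: "x \<in> W" "x \<noteq> (\<lambda>t. 0)" "dim_bound W d"
    using clifford_moduleD[OF assms(1) A] by blast
  note W = W1 W2[rule_format] W345
  have Pv: "P *\<^sub>v v \<in> carrier_vec n" if "v \<in> carrier_vec n" for v using P that by simp
  have gB: "clifford_map B (\<lambda>v. \<gamma> (P *\<^sub>v v))"
    by (rule clifford_map_pullback[OF g A B Pv mult_add_distrib_mat_vec[OF P] mult_mat_vec[OF P] q])
  have "\<gamma> (P *\<^sub>v v) x \<in> W" if "v \<in> carrier_vec n" "x \<in> W" for v x
    using W(2)[OF Pv[OF that(1)] that(2)] .
  then show ?thesis
    by (rule clifford_moduleI[where \<gamma> = "\<lambda>v. \<gamma> (P *\<^sub>v v)" and W = W, OF B gB W(1) _ W(3-5)])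
qed

text \<open>If e and f come from the basis of the plane, the kernel of e is a module for
  \<open>A\<close>, because e anticommutes with the vectors of \<open>A\<close>. On this kernel e f
  is the identity, so \<open>dim_bound_half\<close> halves the dimension.\<close>

lemma clifford_module_remove_plane:
  assumes m: "clifford_module (orth_sum A (binary_form 0 0)) (2 * d)" and A: "A \<in> carrier_mat n n"
  shows "clifford_module A d"
proof -
  let ?H = "binary_form 0 0 :: 'a mat"
  have H: "?H \<in> carrier_mat 2 2" by simp
  have C: "orth_sum A ?H \<in> carrier_mat (n + 2) (n + 2)" by (rule orth_sum_carrier[OF A H])
  obtain \<gamma> and W :: "(nat set \<Rightarrow> 'a) set" and x where g: "clifford_map (orth_sum A ?H) \<gamma>" and W1: "linear_subspace W"
    and W2: "\<forall>v \<in> carrier_vec (n + 2). \<forall>x \<in> W. \<gamma> v x \<in> W"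
    and W345: "x \<in> W" "x \<noteq> (\<lambda>t. 0)" "dim_bound W (2 * d)"
    using clifford_moduleD[OF m C] by blast
  note W = W1 W2[rule_format] W345
  note D = clifford_mapD[OF g C]
  define e where "e = \<gamma> (0\<^sub>v n @\<^sub>v unit_vec 2 0)"
  define f where "f = \<gamma> (0\<^sub>v n @\<^sub>v unit_vec 2 1)"
  define \<delta> where "\<delta> v = \<gamma> (v @\<^sub>v 0\<^sub>v 2)" for v
  have ec: "0\<^sub>v n @\<^sub>v unit_vec 2 0 \<in> carrier_vec (n + 2)" and fc: "0\<^sub>v n @\<^sub>v unit_vec 2 1 \<in> carrier_vec (n + 2)"
    by simp_all
  have vc: "v @\<^sub>v 0\<^sub>v 2 \<in> carrier_vec (n + 2)" if "v \<in> carrier_vec n" for v :: "'a vec" using that by simp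
  have lin: "linear_op e" "linear_op f" unfolding e_def f_def by (rule D(1)[OF ec] D(1)[OF fc])+
  have qe: "qval (orth_sum A ?H) (0\<^sub>v n @\<^sub>v unit_vec 2 0) = 0"
    using qval_orth_sum[OF A H, of "0\<^sub>v n" "unit_vec 2 0"] A by (simp add: qval_binary)
  have ee: "e (e x) = (\<lambda>t. 0)" for x using D(4)[OF ec, of x] by (simp add: e_def qe)
  have pe: "polar (orth_sum A ?H) (0\<^sub>v n @\<^sub>v unit_vec 2 0) (0\<^sub>v n @\<^sub>v unit_vec 2 1) = 1"
    using polar_orth_sum[OF A H, of "0\<^sub>v n" "unit_vec 2 0" "0\<^sub>v n" "unit_vec 2 1"] polar_zero_left[OF A, of "0\<^sub>v n"]
    by (simp add: polar_binary)
  have ef: "e (f x) t + f (e x) t = x t" for x t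
    using clifford_map_anticommute[OF g C ec fc, of x t, unfolded pe] by (simp add: e_def f_def)
  have pv: "polar (orth_sum A ?H) (0\<^sub>v n @\<^sub>v unit_vec 2 0) (v @\<^sub>v 0\<^sub>v 2) = 0" if v: "v \<in> carrier_vec n" for v
    using polar_orth_sum[OF A H, of "0\<^sub>v n" "unit_vec 2 0" v "0\<^sub>v 2"] v polar_zero_left[OF A v]
    by (simp add: polar_binary)
  have ev: "e (\<delta> v x) t + \<delta> v (e x) t = 0" if v: "v \<in> carrier_vec n" for v x t
    using clifford_map_anticommute[OF g C ec vc[OF v], of x t] pv[OF v] by (simp add: e_def \<delta>_def)
  define K where "K = {x \<in> W. e x = (\<lambda>t. 0)}"
  have gd: "clifford_map A \<delta>"
    unfolding \<delta>_def
  proof (rule clifford_map_pullback[OF g C A vc])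
    fix v w :: "'a vec" and c assume v: "v \<in> carrier_vec n"
    show "(c \<cdot>\<^sub>v v) @\<^sub>v 0\<^sub>v 2 = c \<cdot>\<^sub>v (v @\<^sub>v 0\<^sub>v 2)" by (intro eq_vecI) auto
    show "qval A v = qval (orth_sum A ?H) (v @\<^sub>v 0\<^sub>v 2)"
      using qval_orth_sum[OF A H v, of "0\<^sub>v 2"] by (simp add: qval_binary)
    show "(v + w) @\<^sub>v 0\<^sub>v 2 = (v @\<^sub>v 0\<^sub>v 2) + (w @\<^sub>v 0\<^sub>v 2)" if "w \<in> carrier_vec n"
      using v that by (intro eq_vecI) auto
  qed
  have sK: "linear_subspace K"
    using W(1) by (auto simp: linear_subspace_def K_def linear_op_add[OF lin(1)] linear_op_scale[OF lin(1)])
  have dK: "\<delta> v x \<in> K" if v: "v \<in> carrier_vec n" and x: "x \<in> K" for v x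
  proof -
    have "\<delta> v (e x) = (\<lambda>t. 0)" using x linear_op_zero[OF D(1)[OF vc[OF v]]] by (simp add: K_def \<delta>_def)
    then have "e (\<delta> v x) = (\<lambda>t. 0)" using ev[OF v, of x] by (simp add: fun_eq_iff)
    then show ?thesis using W(2)[OF vc[OF v]] x by (simp add: K_def \<delta>_def)
  qed
  \<comment> \<open>Since e squares to 0, either the nonzero element itself or its image under e is
    a nonzero element of the kernel.\<close>
  have "\<exists>x \<in> K. x \<noteq> (\<lambda>t. 0)"
  proof (cases "e x = (\<lambda>t. 0)")
    case True
    then show ?thesis using W(3,4) by (auto simp: K_def)
  next
    case False
    moreover have "e x \<in> K" using W(2)[OF ec W(3)] ee by (simp add: K_def e_def)
    ultimately show ?thesis by blast
  qed
  then obtain y where y: "y \<in> K" "y \<noteq> (\<lambda>t. 0)" by blast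
  have bK: "dim_bound K d"
  proof (rule dim_bound_half[OF W(5), of K f e "\<lambda>x. x" 1])
    show "f x \<in> W" if "x \<in> K" for x using W(2)[OF fc] that by (simp add: K_def f_def)
    show "e (f x) = (\<lambda>t. 1 * x t)" if x: "x \<in> K" for x
    proof
      fix t
      have "f (e x) t = 0" using x linear_op_zero[OF lin(2)] by (simp add: K_def)
      then show "e (f x) t = 1 * x t" using ef[of x t] by simp
    qed
  qed (use lin linear_op_id in \<open>auto simp: K_def\<close>)
  show ?thesis by (rule clifford_moduleI[where \<gamma> = \<delta> and W = K, OF A gd sK dK y bK])
qed

lemma clifford_module_remove_hyperbolic:
  assumes "clifford_module (orth_sum A (hyperbolic_sum m)) (2 ^ m * d)" "A \<in> carrier_mat n n"
  shows "clifford_module A d"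
  using assms(1)
proof (induction m arbitrary: d)
  case (Suc m)
  have "orth_sum A (hyperbolic_sum m) \<in> carrier_mat (n + 2 * m) (n + 2 * m)" using assms(2) by auto
  then have "clifford_module (orth_sum A (hyperbolic_sum m)) (2 ^ m * d)"
    using Suc.prems clifford_module_remove_plane[of "orth_sum A (hyperbolic_sum m)" "2 ^ m * d" "n + 2 * m"]
    by (simp add: hyperbolic_sum_Suc' orth_sum_assoc mult.assoc)
  then show ?case by (rule Suc.IH)
qed simp

section \<open>Forms with trivial Arf invariant\<close>

text \<open>The pair (a, c) stands for c[1, a], so the Arf invariant of the whole form is
  represented by the sum of the first components.\<close>

fun block_form :: "('a::field \<times> 'a) list \<Rightarrow> 'a mat" where
  "block_form [] = 0\<^sub>m 0 0"
| "block_form ((a, c) # L) = orth_sum (c \<cdot>\<^sub>m binary_form 1 a) (block_form L)"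

lemma block_form_carrier [simp, intro]: "block_form L \<in> carrier_mat (2 * length L) (2 * length L)"
proof (induction L)
  case (Cons p L)
  obtain a c where p: "p = (a, c)" by force
  have "c \<cdot>\<^sub>m binary_form 1 a \<in> carrier_mat 2 2" by simp
  from orth_sum_carrier[OF this Cons.IH] show ?case by (simp add: p)
qed simp

lemma dim_block_form [simp]: "dim_row (block_form L) = 2 * length L" "dim_col (block_form L) = 2 * length L"
  by (rule carrier_matD[OF block_form_carrier])+

context char_two_field
begin

text \<open>The operator \<open>z\<close> is the element of the even Clifford algebra whose Artin-Schreier
  polynomial is the Arf invariant.\<close>

definition arf_operator ::
  "('a \<times> 'a) list \<Rightarrow> ('a vec \<Rightarrow> ('i \<Rightarrow> 'a) \<Rightarrow> 'i \<Rightarrow> 'a) \<Rightarrow> (('i \<Rightarrow> 'a) \<Rightarrow> 'i \<Rightarrow> 'a) \<Rightarrow> bool" where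
  "arf_operator L \<gamma> z \<longleftrightarrow> linear_op z \<and>
    (\<forall>v \<in> carrier_vec (2 * length L). \<forall>x. z (\<gamma> v x) = (\<lambda>t. \<gamma> v (z x) t + \<gamma> v x t)) \<and>
    (\<forall>x. z (z x) = (\<lambda>t. z x t + sum_list (map fst L) * x t)) \<and>
    (\<forall>h. linear_op h \<longrightarrow> (\<forall>v \<in> carrier_vec (2 * length L). \<forall>x. h (\<gamma> v x) = \<gamma> v (h x)) \<longrightarrow>
       (\<forall>x. h (z x) = z (h x))) \<and>
    (\<forall>W. linear_subspace W \<longrightarrow> (\<forall>v \<in> carrier_vec (2 * length L). \<forall>x\<in>W. \<gamma> v x \<in> W) \<longrightarrow>
       (\<forall>x\<in>W. z x \<in> W))"

lemma arf_operatorD: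
  assumes Z: "arf_operator L \<gamma> z"
  shows "linear_op z"
    and "\<And>v x. v \<in> carrier_vec (2 * length L) \<Longrightarrow> z (\<gamma> v x) = (\<lambda>t. \<gamma> v (z x) t + \<gamma> v x t)"
    and "\<And>x. z (z x) = (\<lambda>t. z x t + sum_list (map fst L) * x t)"
    and "\<And>h x. linear_op h \<Longrightarrow>
      (\<And>v x. v \<in> carrier_vec (2 * length L) \<Longrightarrow> h (\<gamma> v x) = \<gamma> v (h x)) \<Longrightarrow> h (z x) = z (h x)"
    and "\<And>W x. linear_subspace W \<Longrightarrow>
      (\<And>v x. v \<in> carrier_vec (2 * length L) \<Longrightarrow> x \<in> W \<Longrightarrow> \<gamma> v x \<in> W) \<Longrightarrow> x \<in> W \<Longrightarrow> z x \<in> W"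
proof -
  note D = Z[unfolded arf_operator_def]
  show "linear_op z" by (rule D[THEN conjunct1])
  note D2 = D[THEN conjunct2]
  show "z (\<gamma> v x) = (\<lambda>t. \<gamma> v (z x) t + \<gamma> v x t)" if "v \<in> carrier_vec (2 * length L)" for v x
    by (rule D2[THEN conjunct1, rule_format, OF that])
  note D3 = D2[THEN conjunct2]
  show "z (z x) = (\<lambda>t. z x t + sum_list (map fst L) * x t)" for x
    by (rule D3[THEN conjunct1, rule_format])
  note D4 = D3[THEN conjunct2]
  show "h (z x) = z (h x)"
    if "linear_op h" "\<And>v x. v \<in> carrier_vec (2 * length L) \<Longrightarrow> h (\<gamma> v x) = \<gamma> v (h x)" for h x
    by (rule D4[THEN conjunct1, rule_format, OF that(1)]) (rule that(2))
  show "z x \<in> W" if "linear_subspace W"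
    "\<And>v x. v \<in> carrier_vec (2 * length L) \<Longrightarrow> x \<in> W \<Longrightarrow> \<gamma> v x \<in> W" "x \<in> W" for W x
    by (rule D4[THEN conjunct2, rule_format, OF that(1) _ that(3)]) (rule that(2))
qed

text \<open>The operator is the sum of e f / c over the blocks, where e and f are the basis vectors
  of a block. The last two clauses of \<open>arf_operator\<close> express that it lies in the
  algebra generated by the vectors; the first of them is what the induction step uses to pass the
  operator of the tail through e and f.\<close>

lemma ex_arf_operator:
  fixes \<gamma> :: "'a vec \<Rightarrow> ('i \<Rightarrow> 'a) \<Rightarrow> 'i \<Rightarrow> 'a"
  assumes "clifford_map (block_form L) \<gamma>" "\<forall>p \<in> set L. snd p \<noteq> 0"
  shows "\<exists>z. arf_operator L \<gamma> z"
  using assms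
proof (induction L arbitrary: \<gamma>)
  case Nil
  have g: "\<gamma> v x t = 0" if "v \<in> carrier_vec 0" for v :: "'a vec" and x t
  proof -
    have "0 \<cdot>\<^sub>v v = v" using that by (intro eq_vecI) auto
    then show ?thesis using clifford_mapD(3)[OF Nil(1) block_form_carrier, of v 0 x] that by simp
  qed
  have W: "(\<lambda>t. 0) \<in> W" if "linear_subspace W" "x \<in> W" for W :: "('i \<Rightarrow> 'a) set" and x
  proof -
    have "(\<lambda>t. 0 * x t) \<in> W" using that unfolding linear_subspace_def by blast
    then show ?thesis by simp
  qed
  have lz: "linear_op (\<lambda>(x :: 'i \<Rightarrow> 'a) t. 0 :: 'a)" by (simp add: linear_op_def)
  have "arf_operator [] \<gamma> (\<lambda>x t. 0)"
    unfolding arf_operator_def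
    by (intro conjI allI impI ballI) (use g W linear_op_zero lz in auto)
  then show ?case by blast
next
  case (Cons p L)
  obtain a c where p: "p = (a, c)" by force
  define n where "n = 2 * length L"
  let ?B = "c \<cdot>\<^sub>m binary_form 1 a" and ?A = "block_form L"
  have c: "c \<noteq> 0" using Cons.prems(2) by (simp add: p)
  have B: "?B \<in> carrier_mat 2 2" by simp
  have A: "?A \<in> carrier_mat n n" by (simp add: n_def)
  have C: "orth_sum ?B ?A \<in> carrier_mat (2 + n) (2 + n)" by (rule orth_sum_carrier[OF B A])
  have g: "clifford_map (orth_sum ?B ?A) \<gamma>" using Cons.prems(1) by (simp add: p)
  note D = clifford_mapD[OF g C]
  define \<delta> where "\<delta> v = \<gamma> (0\<^sub>v 2 @\<^sub>v v)" for v
  have vc: "0\<^sub>v 2 @\<^sub>v v \<in> carrier_vec (2 + n)" if "v \<in> carrier_vec n" for v :: "'a vec" using that by simp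
  define E where "E = unit_vec 2 0 @\<^sub>v (0\<^sub>v n :: 'a vec)"
  define F where "F = unit_vec 2 1 @\<^sub>v (0\<^sub>v n :: 'a vec)"
  have EF: "E \<in> carrier_vec (2 + n)" "F \<in> carrier_vec (2 + n)" by (simp_all add: E_def F_def)
  define e where "e = \<gamma> E"
  define f where "f = \<gamma> F"
  have lin: "linear_op e" "linear_op f" unfolding e_def f_def by (rule D(1)[OF EF(1)] D(1)[OF EF(2)])+
  have qB: "qval ?B v = c * ((v $ 0)\<^sup>2 + v $ 0 * v $ 1 + a * (v $ 1)\<^sup>2)" if "v \<in> carrier_vec 2" for v
    using qval_block_form[of c a "v $ 0" "v $ 1"] vec2_eq[OF that] by simp
  have ee: "e (e x) t = c * x t" for x t
    using D(4)[OF EF(1), of x] qval_orth_sum[OF B A, of "unit_vec 2 0" "0\<^sub>v n"] A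
    by (simp add: e_def E_def qB)
  have ff: "f (f x) t = c * a * x t" for x t
    using D(4)[OF EF(2), of x] qval_orth_sum[OF B A, of "unit_vec 2 1" "0\<^sub>v n"] A
    by (simp add: f_def F_def qB)
  have fe: "f (e x) t = e (f x) t + c * x t" for x t
  proof -
    have "polar ?B (unit_vec 2 0) (unit_vec 2 1) = c"
      by (simp add: polar_def qB algebra_simps char2_simps)
    then have "polar (orth_sum ?B ?A) E F = c"
      using polar_orth_sum[OF B A, of "unit_vec 2 0" "0\<^sub>v n" "unit_vec 2 1" "0\<^sub>v n"] polar_zero_left[OF A, of "0\<^sub>v n"]
      by (simp add: E_def F_def)
    then have "e (f x) t + f (e x) t = c * x t"
      using clifford_map_anticommute[OF g C EF, of x t] by (simp add: e_def f_def)
    then show ?thesis using char2_simps by metis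
  qed
  have com: "h' (\<delta> v x) = \<delta> v (h' x)"
    if v: "v \<in> carrier_vec n" and u: "u \<in> carrier_vec 2" "h' = \<gamma> (u @\<^sub>v 0\<^sub>v n)" for v u h' x
  proof
    fix t
    have "polar (orth_sum ?B ?A) (u @\<^sub>v 0\<^sub>v n) (0\<^sub>v 2 @\<^sub>v v) = 0"
      using polar_orth_sum[OF B A u(1), of "0\<^sub>v n" "0\<^sub>v 2" v] v polar_zero_left[OF A v]
        polar_zero_right[OF B u(1)] by simp
    then have "h' (\<delta> v x) t + \<delta> v (h' x) t = 0"
      using clifford_map_anticommute[OF g C _ vc[OF v], of "u @\<^sub>v 0\<^sub>v n" x t] u by (simp add: \<delta>_def)
    then show "h' (\<delta> v x) t = \<delta> v (h' x) t" by (simp add: add_eq_0_char2)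
  qed
  have comE: "e (\<delta> v x) = \<delta> v (e x)" and comF: "f (\<delta> v x) = \<delta> v (f x)" if "v \<in> carrier_vec n" for v x
    using com[OF that, of "unit_vec 2 0" e] com[OF that, of "unit_vec 2 1" f]
    by (simp_all add: e_def f_def E_def F_def)
  have gd: "clifford_map ?A \<delta>"
    unfolding \<delta>_def
  proof (rule clifford_map_pullback[OF g C A vc])
    fix v w :: "'a vec" and k assume v: "v \<in> carrier_vec n"
    show "0\<^sub>v 2 @\<^sub>v (k \<cdot>\<^sub>v v) = k \<cdot>\<^sub>v (0\<^sub>v 2 @\<^sub>v v)" by (intro eq_vecI) auto
    show "qval ?A v = qval (orth_sum ?B ?A) (0\<^sub>v 2 @\<^sub>v v)"
      using qval_orth_sum[OF B A _ v, of "0\<^sub>v 2"] by (simp add: qB)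
    show "0\<^sub>v 2 @\<^sub>v (v + w) = (0\<^sub>v 2 @\<^sub>v v) + (0\<^sub>v 2 @\<^sub>v w)" if "w \<in> carrier_vec n"
      using v that by (intro eq_vecI) auto
  qed
  have split: "\<gamma> v x t = v $ 0 * e x t + v $ 1 * f x t + \<delta> (vec_last v n) x t"
    if v: "v \<in> carrier_vec (2 + n)" for v x t
  proof -
    have 1: "v = v $ 0 \<cdot>\<^sub>v E + (v $ 1 \<cdot>\<^sub>v F + (0\<^sub>v 2 @\<^sub>v vec_last v n))"
    proof (rule eq_vecI)
      fix i assume "i < dim_vec (v $ 0 \<cdot>\<^sub>v E + (v $ 1 \<cdot>\<^sub>v F + (0\<^sub>v 2 @\<^sub>v vec_last v n)))"
      then have "i < 2 + n" using EF by simp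
      then have "i = 0 \<or> i = 1 \<or> i = 2 + (i - 2) \<and> i - 2 < n" by arith
      then consider "i = 0" | "i = 1" | j where "i = 2 + j" "j < n" by blast
      then show "v $ i = (v $ 0 \<cdot>\<^sub>v E + (v $ 1 \<cdot>\<^sub>v F + (0\<^sub>v 2 @\<^sub>v vec_last v n))) $ i"
        by cases (use v in \<open>simp_all add: E_def F_def vec_last_def\<close>)
    qed (use v EF in simp)
    have c1: "v $ 0 \<cdot>\<^sub>v E \<in> carrier_vec (2 + n)" "v $ 1 \<cdot>\<^sub>v F \<in> carrier_vec (2 + n)"
      "0\<^sub>v 2 @\<^sub>v vec_last v n \<in> carrier_vec (2 + n)" using EF by auto
    have "\<gamma> v x t = \<gamma> (v $ 0 \<cdot>\<^sub>v E) x t + (\<gamma> (v $ 1 \<cdot>\<^sub>v F) x t + \<gamma> (0\<^sub>v 2 @\<^sub>v vec_last v n) x t)"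
      by (subst 1) (use D(2)[OF c1(1), of "v $ 1 \<cdot>\<^sub>v F + (0\<^sub>v 2 @\<^sub>v vec_last v n)"] D(2)[OF c1(2,3)] c1 in simp)
    then show ?thesis
      using D(3)[OF EF(1)] D(3)[OF EF(2)] by (simp add: e_def f_def \<delta>_def)
  qed
  obtain z' where Z: "arf_operator L \<delta> z'"
    using Cons.IH[OF gd] Cons.prems(2) by auto
  note Z' = arf_operatorD[OF Z, folded n_def]
  note linz = Z'(1) and zgf = Z'(2) and zzf = Z'(3) and zh = Z'(4) and zW = Z'(5)
  have ze: "z' (e x) = e (z' x)" and zf: "z' (f x) = f (z' x)" for x
    using zh[OF lin(1) comE, of x] zh[OF lin(2) comF, of x] by simp_all
  \<comment> \<open>For w = e f / c the relation f e = e f + c gives w^2 = w + a, and moving w past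
    e or f adds 1 to w.\<close>
  define z where "z x t = z' x t + inverse c * e (f x) t" for x t
  have zfun: "z = (\<lambda>x t. z' x t + inverse c * e (f x) t)" by (simp add: z_def fun_eq_iff)
  have lz: "linear_op z" unfolding zfun by (rule linear_op_plus[OF linz linear_op_smult[OF linear_op_comp[OF lin]]])
  have fef: "f (e x) = (\<lambda>t. e (f x) t + c * x t)" "e (e x) = (\<lambda>t. c * x t)" "f (f x) = (\<lambda>t. c * a * x t)" for x
    using fe ee ff by (simp_all add: fun_eq_iff)
  note l = linear_op_add[OF lin(1)] linear_op_add[OF lin(2)] linear_op_scale[OF lin(1)] linear_op_scale[OF lin(2)]
    linear_op_add[OF linz] linear_op_scale[OF linz]
  have len: "2 * length (p # L) = 2 + n" by (simp add: n_def)
  have "arf_operator (p # L) \<gamma> z"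
    unfolding arf_operator_def len
  proof (intro conjI ballI allI impI)
    show "linear_op z" by (rule lz)
  next
    fix v :: "'a vec" and x assume v: "v \<in> carrier_vec (2 + n)"
    define u where "u = vec_last v n"
    have u: "u \<in> carrier_vec n" by (simp add: u_def)
    note ld = linear_op_add[OF clifford_mapD(1)[OF gd A u]] linear_op_scale[OF clifford_mapD(1)[OF gd A u]]
    have gv: "\<gamma> v = (\<lambda>x t. v $ 0 * e x t + v $ 1 * f x t + \<delta> u x t)"
      using split[OF v] by (simp add: fun_eq_iff u_def)
    show "z (\<gamma> v x) = (\<lambda>t. \<gamma> v (z x) t + \<gamma> v x t)"
      unfolding gv zfun
      by (simp only: l ld zgf[OF u] ze zf comE[OF u] comF[OF u] fef)
        (use c in \<open>simp add: fun_eq_iff field_simps char2_simps\<close>)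
  next
    fix x
    show "z (z x) = (\<lambda>t. z x t + sum_list (map fst (p # L)) * x t)"
      unfolding zfun
      by (simp only: l ze zf zzf fef) (use c in \<open>simp add: p fun_eq_iff field_simps char2_simps\<close>)
  next
    fix h x assume lh: "linear_op h" and hv: "\<forall>v \<in> carrier_vec (2 + n). \<forall>x. h (\<gamma> v x) = \<gamma> v (h x)"
    have "h (z' x) = z' (h x)" using hv vc by (intro zh[OF lh]) (simp add: \<delta>_def)
    moreover have "h (e (f x)) = e (f (h x))" using hv EF by (simp add: e_def f_def)
    ultimately show "h (z x) = z (h x)"
      unfolding zfun by (simp add: linear_op_add[OF lh] linear_op_scale[OF lh])
  next
    fix W x assume W: "linear_subspace W" "\<forall>v \<in> carrier_vec (2 + n). \<forall>x\<in>W. \<gamma> v x \<in> W" and x: "x \<in> W"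
    have "z' x \<in> W" using W(2) vc by (intro zW[OF W(1) _ x]) (simp add: \<delta>_def)
    moreover have "e (f x) \<in> W" using W(2) EF x by (simp add: e_def f_def)
    ultimately show "z x \<in> W" unfolding zfun using W(1) by (simp add: linear_subspace_def)
  qed
  then show ?case by blast
qed

text \<open>The Arf operator splits the module into two halves of dimension at most \<open>d\<close>. For \<open>x\<close> in one of
  them, the map \<open>v \<mapsto> \<gamma> v x\<close> from the quadratic space to the other one has a kernel, which consists
  of isotropic vectors.\<close>

lemma clifford_module_isotropic:
  assumes m: "clifford_module (block_form L) (2 * d)" and c: "\<forall>p \<in> set L. snd p \<noteq> (0 :: 'a)"
    and arf: "sum_list (map fst L) = 0" and "L \<noteq> []" and d: "d < 2 * length L"
  shows "\<exists>v \<in> carrier_vec (2 * length L). v \<noteq> 0\<^sub>v (2 * length L) \<and> qval (block_form L) v = 0"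
proof -
  define n where "n = 2 * length L"
  have A: "block_form L \<in> carrier_mat n n" by (simp add: n_def)
  obtain \<gamma> and W :: "(nat set \<Rightarrow> 'a) set" and x where g: "clifford_map (block_form L) \<gamma>" and W1: "linear_subspace W"
    and W2: "\<forall>v \<in> carrier_vec n. \<forall>x \<in> W. \<gamma> v x \<in> W"
    and W345: "x \<in> W" "x \<noteq> (\<lambda>t. 0)" "dim_bound W (2 * d)"
    using clifford_moduleD[OF m A] by blast
  note W = W1 W2[rule_format] W345
  note D = clifford_mapD[OF g A]
  obtain z where Z: "arf_operator L \<gamma> z" using ex_arf_operator[OF g c] by blast
  note Z' = arf_operatorD[OF Z, folded n_def]
  note linz = Z'(1) and zg = Z'(2) and zz' = Z'(3)
  have zW: "z x \<in> W" if "x \<in> W" for x by (rule Z'(5)[OF W(1) _ that]) (rule W(2))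
  \<comment> \<open>The vanishing Arf sum makes the Arf operator idempotent.\<close>
  have zz: "z (z x) = z x" for x using zz'[of x] by (simp add: arf)
  obtain p L' where L: "L = p # L'" using \<open>L \<noteq> []\<close> by (cases L) auto
  obtain a c0 where p: "p = (a, c0)" by force
  have c0: "c0 \<noteq> 0" using c by (simp add: L p)
  \<comment> \<open>A vector with the nonzero value \<open>c0\<close>: its operator is invertible,
    so it can exchange the two halves without loss.\<close>
  define E where "E = unit_vec 2 0 @\<^sub>v (0\<^sub>v (2 * length L') :: 'a vec)"
  have E: "E \<in> carrier_vec n" by (simp add: E_def n_def L)
  have qE: "qval (block_form L) E = c0"
  proof -
    have "c0 \<cdot>\<^sub>m binary_form 1 a \<in> carrier_mat 2 2" by simp
    moreover have "qval (c0 \<cdot>\<^sub>m binary_form 1 a) (unit_vec 2 0) = c0"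
      using qval_smult_mat[OF binary_form_carrier, of "unit_vec 2 0" c0 1 a] by (simp add: qval_binary)
    ultimately show ?thesis
      using qval_orth_sum[OF _ block_form_carrier, of "c0 \<cdot>\<^sub>m binary_form 1 a" 2 "unit_vec 2 0" "0\<^sub>v (2 * length L')" L']
        qval_zero[OF block_form_carrier[of L']]
      by (simp add: L p E_def)
  qed
  \<comment> \<open>The eigenspaces of the Arf operator for 0 and 1; every vector of the form maps
    the first into the second.\<close>
  define K where "K = {y \<in> W. z y = (\<lambda>t. 0)}"
  define K' where "K' = {y \<in> W. z y = y}"
  have EE: "\<gamma> E (\<gamma> E y) = (\<lambda>t. c0 * y t)" for y using D(4)[OF E] qE by simp
  have "\<exists>y \<in> K. y \<noteq> (\<lambda>t. 0)"
  proof (cases "z x = x")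
    case True
    have "z (\<gamma> E x) = (\<lambda>t. 0)" using zg[OF E, of x] True by (simp add: char2_simps)
    moreover have "\<gamma> E x \<noteq> (\<lambda>t. 0)"
    proof
      assume "\<gamma> E x = (\<lambda>t. 0)"
      then have "(\<lambda>t. c0 * x t) = (\<lambda>t. 0)" using EE[of x] linear_op_zero[OF D(1)[OF E]] by simp
      then show False using c0 W(4) by (simp add: fun_eq_iff)
    qed
    ultimately show ?thesis using W(2)[OF E W(3)] by (auto simp: K_def)
  next
    case False
    define y where "y = (\<lambda>t. z x t + x t)"
    have "z y = (\<lambda>t. 0)" unfolding y_def using linear_op_add[OF linz, of "z x" x] zz by (simp add: char2_simps)
    moreover have "y \<noteq> (\<lambda>t. 0)" using False by (auto simp: y_def fun_eq_iff add_eq_0_char2)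
    moreover have "y \<in> W" using zW[OF W(3)] W(1,3) by (simp add: y_def linear_subspace_def)
    ultimately show ?thesis by (auto simp: K_def)
  qed
  then obtain y where y: "y \<in> K" "y \<noteq> (\<lambda>t. 0)" by blast
  \<comment> \<open>z + 1 kills \<open>K'\<close> and is the identity on the image of
    \<open>K'\<close> under \<open>E\<close>, whose Arf eigenvalue is 0. Applying \<open>E\<close>
    again leaves the scalar \<open>c0\<close>.\<close>
  have bK': "dim_bound K' d"
  proof (rule dim_bound_half[OF W(5), of K' "\<gamma> E" "\<lambda>x t. z x t + x t" "\<gamma> E" c0])
    show "linear_op (\<lambda>x t. z x t + x t)" using linear_op_plus[OF linz linear_op_id] .
    show "\<gamma> E (\<lambda>t. z (\<gamma> E x) t + \<gamma> E x t) = (\<lambda>t. c0 * x t)" if "x \<in> K'" for x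
      using that zg[OF E, of x] EE by (simp add: K'_def add.assoc char2_simps)
  qed (use D(1)[OF E] W(2)[OF E] c0 in \<open>auto simp: K'_def char2_simps\<close>)
  have "\<gamma> v y \<in> K'" if "v \<in> carrier_vec n" for v
    using y(1) zg[OF that, of y] W(2)[OF that] linear_op_zero[OF D(1)[OF that]] by (simp add: K_def K'_def)
  then have "\<exists>k. (\<exists>i<n. k i \<noteq> 0) \<and> (\<forall>t. (\<Sum>i<n. k i * \<gamma> (unit_vec n i) y t) = 0)"
    using bK' d unfolding dim_bound_def n_def[symmetric] by simp
  then obtain k i where ki: "i < n" "k i \<noteq> 0"
    and 0: "\<And>t. (\<Sum>i<n. k i * \<gamma> (unit_vec n i) y t) = 0" by blast
  define v where "v = vec n k"
  have v: "v \<in> carrier_vec n" by (simp add: v_def)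
  have "\<gamma> v y = (\<lambda>t. 0)" using 0 clifford_map_lincomb[OF g A] by (simp add: v_def fun_eq_iff)
  then have "(\<lambda>t. qval (block_form L) v * y t) = (\<lambda>t. 0)"
    using D(4)[OF v, of y] linear_op_zero[OF D(1)[OF v]] by simp
  then have "qval (block_form L) v = 0" using y(2) by (auto simp: fun_eq_iff)
  moreover have "v \<noteq> 0\<^sub>v n" using ki by (auto simp: v_def vec_eq_iff)
  ultimately show ?thesis using v unfolding n_def by blast
qed

end

section \<open>Products indexed by families of sets under symmetric difference\<close>

text \<open>Exactly one of the sets T and its symmetric difference with \<open>U\<close> contains
  \<open>j\<close>, so the sets avoiding \<open>j\<close> represent all the pairs.\<close>

lemma (in comm_monoid) finprod_pair:
  assumes "finite \<T>" and g: "g \<in> \<T> \<rightarrow> carrier G" and "j \<in> U"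
    and closed: "\<And>T. T \<in> \<T> \<Longrightarrow> sym_diff T U \<in> \<T>"
  shows "finprod G g \<T> = finprod G (\<lambda>T. g T \<otimes> g (sym_diff T U)) {T \<in> \<T>. j \<notin> T}"
proof -
  let ?N = "{T \<in> \<T>. j \<notin> T}" and ?h = "\<lambda>T. sym_diff T U"
  have inv: "?h (?h T) = T" for T by auto
  have inj: "inj_on ?h ?N" by (rule inj_on_inverseI[of _ ?h]) (rule inv)
  have im: "?h ` ?N = {T \<in> \<T>. j \<in> T}"
  proof (intro equalityI subsetI)
    fix T assume "T \<in> {T \<in> \<T>. j \<in> T}"
    then have "?h T \<in> ?N" using closed \<open>j \<in> U\<close> by auto
    then show "T \<in> ?h ` ?N" by (rule image_eqI[where f = ?h, OF inv[symmetric]])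
  qed (use closed \<open>j \<in> U\<close> in auto)
  have "finprod G g \<T> = finprod G g (?N \<union> ?h ` ?N)"
    by (rule arg_cong[where f = "finprod G g"]) (auto simp: im)
  also have "\<dots> = finprod G g ?N \<otimes> finprod G g (?h ` ?N)"
    using assms(1) g by (intro finprod_Un_disjoint) (auto simp: im)
  also have "finprod G g (?h ` ?N) = finprod G (\<lambda>T. g (?h T)) ?N"
    using g inj by (intro finprod_reindex) (auto simp: im)
  also have "finprod G g ?N \<otimes> finprod G (\<lambda>T. g (?h T)) ?N = finprod G (\<lambda>T. g T \<otimes> g (?h T)) ?N"
    using g closed by (intro finprod_multf[symmetric]) auto
  finally show ?thesis .
qed

text \<open>Modulo squares, products over subsets turn symmetric difference into multiplication;
  square factors do not affect Pfister classes.\<close>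

lemma prod_sym_diff:
  fixes f :: "'b \<Rightarrow> 'c::comm_monoid_mult"
  assumes "finite T" "finite U"
  shows "prod f T * prod f U = prod f (sym_diff T U) * (prod f (T \<inter> U))\<^sup>2"
proof -
  have "prod f T = prod f (T - U) * prod f (T \<inter> U)" "prod f U = prod f (U - T) * prod f (T \<inter> U)"
    using assms by (simp_all add: prod.Int_Diff[of T f U] prod.Int_Diff[of U f T] Int_commute mult.commute)
  moreover have "prod f (sym_diff T U) = prod f (T - U) * prod f (U - T)"
    using assms by (intro prod.union_disjoint) auto
  ultimately show ?thesis by (simp add: power2_eq_square mult_ac)
qed

section \<open>Pfister forms and block forms in the Witt group\<close>

context char_two_field
begin

interpretation Iq1: comm_group "Iq1 :: 'a mat set monoid"
  by (rule comm_group_Iq1)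

lemma block_form_even_forms: "\<forall>p \<in> set L. snd p \<noteq> 0 \<Longrightarrow> block_form L \<in> (even_forms :: 'a mat set)"
  by (induction L rule: block_form.induct) (auto intro!: orth_sum_even_forms block_even)

lemma witt_class_block_form_Cons:
  assumes "c \<noteq> 0" "\<forall>p \<in> set L. snd p \<noteq> 0"
  shows "witt_class (block_form ((a, c) # L)) = block_class a c \<boxplus> witt_class (block_form L :: 'a mat)"
  using assms by (simp add: block_class_def Iq1_mult block_even block_form_even_forms)

lemma witt_class_block_form_Nil: "witt_class (block_form [] :: 'a mat) = \<one>\<^bsub>Iq1\<^esub>"
  by (simp add: one_Iq1)

lemma qval_block_form_sum:
  "v \<in> carrier_vec (2 * length L) \<Longrightarrow> qval (block_form L) v =
    (\<Sum>i<length L. snd (L ! i) * ((v $ (2 * i))\<^sup>2 + v $ (2 * i) * v $ (2 * i + 1)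
      + fst (L ! i) * (v $ (2 * i + 1 :: nat) :: 'a)\<^sup>2))"
proof (induction L arbitrary: v)
  case Nil
  then show ?case by (simp add: qval_def scalar_prod_def)
next
  case (Cons p L)
  obtain a c where p: "p = (a, c)" by force
  have v: "v \<in> carrier_vec (2 + 2 * length L)" using Cons.prems by simp
  have B: "c \<cdot>\<^sub>m binary_form 1 a \<in> carrier_mat 2 2" by simp
  have 1: "qval (c \<cdot>\<^sub>m binary_form 1 a) (vec_first v 2) = c * ((v $ 0)\<^sup>2 + v $ 0 * v $ 1 + a * (v $ 1)\<^sup>2)"
    using qval_block_form[of c a "v $ 0" "v $ 1"] vec2_eq[of "vec_first v 2"] by (simp add: vec_first_def)
  have last: "vec_last v (2 * length L) $ j = v $ (2 + j)" if "j < 2 * length L" for j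
    using that v by (simp add: vec_last_def)
  have 2: "qval (block_form L) (vec_last v (2 * length L)) =
    (\<Sum>i<length L. snd (L ! i) * ((v $ (2 * Suc i))\<^sup>2 + v $ (2 * Suc i) * v $ (2 * Suc i + 1)
      + fst (L ! i) * (v $ (2 * Suc i + 1))\<^sup>2))"
    unfolding Cons.IH[OF vec_last_carrier] by (intro sum.cong) (auto simp: last)
  have "qval (block_form (p # L)) v = qval (c \<cdot>\<^sub>m binary_form 1 a) (vec_first v 2)
      + qval (block_form L) (vec_last v (2 * length L))"
    using qval_orth_sum_split[OF B block_form_carrier v] by (simp add: p)
  then show ?case
    unfolding 1 2 by (simp add: p sum.lessThan_Suc_shift del: sum.lessThan_Suc)
qed

lemma pfister_one:
  assumes "b \<noteq> 0"
  shows "pfister [b] (a :: 'a) \<in> even_forms"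
    and "witt_class (pfister [b] a) = block_class a 1 \<boxplus> block_class a b"
  using assms by (auto simp: block_class_def Iq1_mult block_even intro!: orth_sum_even_forms)

lemma smult_pfister_two:
  assumes "b \<noteq> 0" "c \<noteq> 0" "k \<noteq> 0"
  shows "k \<cdot>\<^sub>m pfister [b, c] (a :: 'a) \<in> even_forms"
    and "witt_class (k \<cdot>\<^sub>m pfister [b, c] a) =
      (block_class a k \<boxplus> block_class a (k * c)) \<boxplus>
      (block_class a (k * b) \<boxplus> block_class a (k * b * c))"
proof -
  have *: "k \<cdot>\<^sub>m pfister [b, c] a = orth_sum
    (orth_sum (k \<cdot>\<^sub>m binary_form 1 a) ((k * c) \<cdot>\<^sub>m binary_form 1 a))
    (orth_sum ((k * b) \<cdot>\<^sub>m binary_form 1 a) ((k * b * c) \<cdot>\<^sub>m binary_form 1 a))"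
    by (simp add: smult_orth_sum smult_smult_mat mult.assoc)
  show "k \<cdot>\<^sub>m pfister [b, c] (a :: 'a) \<in> even_forms"
    unfolding * using assms by (intro orth_sum_even_forms block_even) auto
  have "k \<cdot>\<^sub>m binary_form 1 a \<in> even_forms" "(k * c) \<cdot>\<^sub>m binary_form 1 a \<in> even_forms"
    "(k * b) \<cdot>\<^sub>m binary_form 1 a \<in> even_forms" "(k * b * c) \<cdot>\<^sub>m binary_form 1 a \<in> even_forms"
    using assms by (auto intro: block_even)
  then show "witt_class (k \<cdot>\<^sub>m pfister [b, c] a) =
      (block_class a k \<boxplus> block_class a (k * c)) \<boxplus>
      (block_class a (k * b) \<boxplus> block_class a (k * b * c))"
    unfolding * block_class_def by (simp add: Iq1_mult orth_sum_even_forms)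
qed

lemma pfister_form_2E:
  assumes "pfister_form 2 (A :: 'a mat)"
  obtains b a where "b \<noteq> 0" "isometric A (pfister [b] a)"
proof -
  from assms obtain bs a where *: "Suc (length bs) = 2" "0 \<notin> set bs" "isometric A (pfister bs a)"
    unfolding pfister_form_def by blast
  then obtain b where "bs = [b]" by (auto simp: numeral_2_eq_2 length_Suc_conv)
  then show ?thesis using * that by auto
qed

lemma pfister_form_3E:
  assumes "pfister_form 3 (A :: 'a mat)"
  obtains b c a where "b \<noteq> 0" "c \<noteq> 0" "isometric A (pfister [b, c] a)"
proof -
  from assms obtain bs a where *: "Suc (length bs) = 3" "0 \<notin> set bs" "isometric A (pfister bs a)"
    unfolding pfister_form_def by blast
  then obtain b c where "bs = [b, c]" by (auto simp: numeral_3_eq_3 length_Suc_conv)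
  then show ?thesis using * that by auto
qed

lemma pfister_form_2_class:
  assumes "isometric A (pfister [b] a)" "b \<noteq> (0 :: 'a)"
  shows "A \<in> even_forms" "witt_class A = block_class a 1 \<boxplus> block_class a b"
proof -
  show "A \<in> even_forms" using isometric_even_forms'[OF assms(1) pfister_one(1)[OF assms(2)]] .
  then show "witt_class A = block_class a 1 \<boxplus> block_class a b"
    using witt_class_isometric[OF assms(1)] pfister_one(2)[OF assms(2)] by simp
qed

section \<open>Elements of \<open>Iq_set 3\<close> are split\<close>

text \<open>One split representative suffices: planes can be added to a split form and removed from
  a Clifford module.\<close>

definition split_class :: "'a mat set \<Rightarrow> bool" where
  "split_class x \<longleftrightarrow> (\<exists>N A. split_form N A \<and> A \<in> even_forms \<and> x = witt_class A)"

lemma Iq3_generator_class: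
  assumes "x \<in> {witt_class (c \<cdot>\<^sub>m A) | c A. c \<noteq> 0 \<and> pfister_form 3 (A :: 'a mat)}"
  obtains k b c a where "k \<noteq> 0" "b \<noteq> 0" "c \<noteq> 0" "x = witt_class (k \<cdot>\<^sub>m pfister [b, c] a)"
proof -
  from assms obtain k A where A: "k \<noteq> 0" "pfister_form 3 A" "x = witt_class (k \<cdot>\<^sub>m A)" by blast
  obtain b c a where *: "b \<noteq> 0" "c \<noteq> 0" "isometric A (pfister [b, c] a)"
    by (rule pfister_form_3E[OF A(2)])
  have iso: "isometric (k \<cdot>\<^sub>m A) (k \<cdot>\<^sub>m pfister [b, c] a)" by (rule smult_isometric[OF *(3)])
  have "witt_class (k \<cdot>\<^sub>m A) = witt_class (k \<cdot>\<^sub>m pfister [b, c] a)"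
    using witt_class_isometric[OF iso] isometric_even_forms'[OF iso] smult_pfister_two(1) * A(1) by blast
  then show ?thesis using that A * by metis
qed

lemma split_class_generator:
  assumes "k \<noteq> 0" "b \<noteq> 0" "c \<noteq> 0" and y: "split_class y"
  shows "split_class (witt_class (k \<cdot>\<^sub>m pfister [b, c] a) \<boxplus> y)"
proof -
  from y obtain N B where B: "split_form N B" "B \<in> even_forms" "y = witt_class B"
    unfolding split_class_def by blast
  define bl where "bl d = d \<cdot>\<^sub>m binary_form 1 a" for d
  let ?C = "orth_sum (bl (k * b * c)) (orth_sum (bl k) (orth_sum (bl (k * b)) (orth_sum (bl (k * c)) B)))"
  \<comment> \<open>The four scalars of the scaled 3-fold Pfister form multiply to a square; this is
    the relation demanded by \<open>split_form_four_blocks\<close>.\<close>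
  have "k * b * c = (1 / k)\<^sup>2 * k * (k * b) * (k * c)" using assms by (simp add: power2_eq_square)
  from split_form_four_blocks[OF B(1) this] have "split_form (N + 4) ?C" unfolding bl_def .
  moreover have ev: "bl k \<in> even_forms" "bl (k * b) \<in> even_forms" "bl (k * c) \<in> even_forms"
    "bl (k * b * c) \<in> even_forms"
    unfolding bl_def using assms by (auto intro: block_even)
  then have "?C \<in> even_forms" using B(2) by (intro orth_sum_even_forms)
  moreover have "witt_class (k \<cdot>\<^sub>m pfister [b, c] a) \<boxplus> y = witt_class ?C"
  proof -
    have "witt_class ?C = block_class a (k * b * c) \<boxplus> (block_class a k \<boxplus>
      (block_class a (k * b) \<boxplus> (block_class a (k * c) \<boxplus> witt_class B)))"
      using ev B(2) by (simp add: block_class_def Iq1_mult orth_sum_even_forms flip: bl_def)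
    then show ?thesis
      unfolding smult_pfister_two(2)[OF assms(2,3,1)] B(3) using assms B(2) by (simp add: Iq1.m_ac)
  qed
  ultimately show ?thesis unfolding split_class_def by blast
qed

lemma Iq3_split_class:
  assumes "x \<in> Iq_set 3"
  shows "split_class (x :: 'a mat set)"
proof -
  let ?G = "{witt_class (c \<cdot>\<^sub>m A) | c A. c \<noteq> 0 \<and> pfister_form 3 (A :: 'a mat)}"
  have G: "x \<in> carrier Iq1" if x: "x \<in> ?G" for x
  proof -
    obtain k b c a where *: "k \<noteq> 0" "b \<noteq> 0" "c \<noteq> 0" "x = witt_class (k \<cdot>\<^sub>m pfister [b, c] a)"
      by (rule Iq3_generator_class[OF x])
    show ?thesis unfolding *(4) by (rule witt_class_carrier[OF smult_pfister_two(1)[OF *(2,3,1)]])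
  qed
  have car: "y \<in> carrier Iq1" if "split_class y" for y using that by (auto simp: split_class_def)
  \<comment> \<open>The induction shows that adding \<open>x\<close> preserves split classes, since
    only the addition of a generator has been treated. The claim follows by adding \<open>x\<close>
    to the neutral element.\<close>
  have "x \<in> carrier Iq1 \<and> (\<forall>y. split_class y \<longrightarrow> split_class (x \<boxplus> y))"
    using assms unfolding Iq_set_def
  proof (induction rule: generate.induct)
    case one
    then show ?case using car by simp
  next
    case (incl x)
    obtain k b c a where *: "k \<noteq> 0" "b \<noteq> 0" "c \<noteq> 0" "x = witt_class (k \<cdot>\<^sub>m pfister [b, c] a)"
      by (rule Iq3_generator_class[OF incl])
    show ?case using G[OF incl] split_class_generator[OF *(1-3)] unfolding *(4) by blast
  next
    case (inv x)
    obtain k b c a where *: "k \<noteq> 0" "b \<noteq> 0" "c \<noteq> 0" "x = witt_class (k \<cdot>\<^sub>m pfister [b, c] a)"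
      by (rule Iq3_generator_class[OF inv])
    have "inv\<^bsub>Iq1\<^esub> x = x" using G[OF inv] Iq1_square Iq1.inv_equality by metis
    then show ?case using G[OF inv] split_class_generator[OF *(1-3)] unfolding *(4) by simp
  next
    case (eng h1 h2)
    then show ?case using car by (simp add: Iq1.m_assoc)
  qed
  moreover have "split_class \<one>\<^bsub>Iq1\<^esub>"
    unfolding split_class_def one_Iq1 using split_form_empty zero_even_forms by blast
  ultimately have "split_class (x \<boxplus> \<one>\<^bsub>Iq1\<^esub>)" by blast
  then show ?thesis using \<open>x \<in> carrier Iq1 \<and> _\<close> by simp
qed

text \<open>Removing the planes leaves a module of dimension at most 2 ^ l for l blocks, and half of
  it must have fewer dimensions than the form. The inequality admits exactly one, two or three
  blocks.\<close>

lemma block_form_Iq3_isotropic: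
  assumes c: "\<forall>p \<in> set L. snd p \<noteq> (0 :: 'a)" and arf: "sum_list (map fst L) = 0"
    and "L \<noteq> []" and len: "2 ^ (length L - 1) < 2 * length L"
    and "witt_class (block_form L) \<in> Iq_set 3"
  shows "\<exists>v \<in> carrier_vec (2 * length L). v \<noteq> 0\<^sub>v (2 * length L) \<and> qval (block_form L) v = 0"
proof -
  define l where "l = length L"
  have lpos: "0 < l" using \<open>L \<noteq> []\<close> by (simp add: l_def)
  have even: "block_form L \<in> even_forms" by (rule block_form_even_forms[OF c])
  obtain N B where B: "split_form N B" "B \<in> even_forms" "witt_class (block_form L) = witt_class B"
    using Iq3_split_class[OF assms(5)] unfolding split_class_def by blast
  have cB: "B \<in> carrier_mat (2 * N) (2 * N)" using B(1) by (simp add: split_form_def)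
  have "(block_form L, B) \<in> witt_rel" using witt_class_eq_iff[OF even B(2)] B(3) by simp
  then obtain m n where iso: "isometric (orth_sum (block_form L) (hyperbolic_sum m)) (orth_sum B (hyperbolic_sum n))"
    by (rule witt_relE)
  have dims: "n + N = m + l" using isometric_dim[OF iso] cB by (simp add: l_def)
  have "clifford_module (orth_sum (hyperbolic_sum n) B) (2 ^ (n + N))"
    by (rule split_form_clifford_module[OF split_form_hyperbolic_sum[OF B(1)]])
  moreover have "isometric (orth_sum (hyperbolic_sum n) B) (orth_sum (block_form L) (hyperbolic_sum m))"
    using isometric_trans[OF orth_sum_isometric_commute[OF hyperbolic_sum_carrier cB] isometric_sym[OF iso]] .
  ultimately have "clifford_module (orth_sum (block_form L) (hyperbolic_sum m)) (2 ^ m * 2 ^ l)"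
    using clifford_module_isometric unfolding dims power_add by blast
  then have "clifford_module (block_form L) (2 ^ l)"
    by (rule clifford_module_remove_hyperbolic[OF _ block_form_carrier])
  moreover have "2 ^ l = 2 * (2 ^ (l - 1) :: nat)" using lpos by (simp flip: power_Suc)
  ultimately have "clifford_module (block_form L) (2 * 2 ^ (l - 1))" by simp
  from clifford_module_isotropic[OF this c arf \<open>L \<noteq> []\<close>] len show ?thesis by (simp add: l_def)
qed

section \<open>Uniqueness of the 2-fold Pfister form in a class modulo \<open>Iq_set 3\<close>\<close>

abbreviation nrm :: "'a \<Rightarrow> 'a \<Rightarrow> 'a \<Rightarrow> 'a" where
  "nrm a x y \<equiv> x\<^sup>2 + x * y + a * y\<^sup>2"

text \<open>A common nonzero value e turns the blocks into e[1, p] and e[1, q], which add up to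
  e[1, p + q]. If the common value is 0, one block is hyperbolic under every scalar, so it can be
  given the scalar of the other.\<close>

lemma block_class_merge:
  assumes "c \<noteq> 0" "d \<noteq> 0" and eq: "c * nrm p x y = d * nrm q x' y'"
    and nz: "x \<noteq> 0 \<or> y \<noteq> 0 \<or> x' \<noteq> 0 \<or> y' \<noteq> 0"
  shows "\<exists>e. e \<noteq> 0 \<and> block_class p c \<boxplus> block_class q d = block_class (p + q) e"
proof (cases "c * nrm p x y = 0")
  case False
  define e where "e = c * nrm p x y"
  have "block_class p e = block_class p c" unfolding e_def using assms False by (intro block_class_norm) auto
  moreover have "block_class q e = block_class q d"
    unfolding e_def eq using assms False by (intro block_class_norm) auto
  moreover have "e \<noteq> 0" using False by (simp add: e_def)
  ultimately show ?thesis using block_class_add_param[of e p q] by metis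
next
  case True
  then have n: "nrm p x y = 0" "nrm q x' y' = 0" using assms by auto
  show ?thesis
  proof (cases "x \<noteq> 0 \<or> y \<noteq> 0")
    case True
    then have "block_class p k = \<one>\<^bsub>Iq1\<^esub>" if "k \<noteq> 0" for k
      using block_class_isotropic[OF n(1)] that by blast
    then show ?thesis
      using block_class_add_param[of d p q] assms(1,2) by (intro exI[of _ d]) simp
  next
    case False
    then have "block_class q k = \<one>\<^bsub>Iq1\<^esub>" if "k \<noteq> 0" for k
      using block_class_isotropic[OF n(2)] nz that by blast
    then show ?thesis
      using block_class_add_param[of c p q] assms(1,2) by (intro exI[of _ c]) simp
  qed
qed

text \<open>Unless two of the blocks have a common value, the isotropic vector gives \<open>e1 + e2\<close>, \<open>e1\<close> and \<open>e2\<close>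
  as nonzero values of the three blocks.\<close>

lemma three_blocks_isotropic:
  assumes c: "c0 \<noteq> 0" "c1 \<noteq> 0" "c2 \<noteq> 0"
    and 0: "c0 * nrm (p + q) x0 y0 + c1 * nrm p x1 y1 + c2 * nrm q x2 y2 = 0"
    and nz: "x0 \<noteq> 0 \<or> y0 \<noteq> 0 \<or> x1 \<noteq> 0 \<or> y1 \<noteq> 0 \<or> x2 \<noteq> 0 \<or> y2 \<noteq> 0"
  shows "\<exists>r c d. c \<noteq> 0 \<and> d \<noteq> 0 \<and>
    block_class (p + q) c0 \<boxplus> (block_class p c1 \<boxplus> block_class q c2) = block_class r c \<boxplus> block_class r d"
proof -
  define e0 e1 e2 where e: "e0 = c0 * nrm (p + q) x0 y0" "e1 = c1 * nrm p x1 y1" "e2 = c2 * nrm q x2 y2"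
  have sum: "e0 + e1 + e2 = 0" using 0 by (simp add: e)
  have eq: "e0 = 0 \<longrightarrow> e1 = e2" "e1 = 0 \<longrightarrow> e0 = e2" "e2 = 0 \<longrightarrow> e0 = e1"
    using sum by (auto simp: add_eq_0_char2)
  have zero: "x0 = 0 \<and> y0 = 0 \<longrightarrow> e0 = 0" "x1 = 0 \<and> y1 = 0 \<longrightarrow> e1 = 0" "x2 = 0 \<and> y2 = 0 \<longrightarrow> e2 = 0"
    by (simp_all add: e)
  consider
      (m12) "e1 = e2" "x1 \<noteq> 0 \<or> y1 \<noteq> 0 \<or> x2 \<noteq> 0 \<or> y2 \<noteq> 0"
    | (m02) "e0 = e2" "x0 \<noteq> 0 \<or> y0 \<noteq> 0 \<or> x2 \<noteq> 0 \<or> y2 \<noteq> 0"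
    | (m01) "e0 = e1" "x0 \<noteq> 0 \<or> y0 \<noteq> 0 \<or> x1 \<noteq> 0 \<or> y1 \<noteq> 0"
    | (all) "e0 \<noteq> 0" "e1 \<noteq> 0" "e2 \<noteq> 0"
    using eq zero nz by metis
  then show ?thesis
  proof cases
    case m12
    then obtain k where "k \<noteq> 0" "block_class p c1 \<boxplus> block_class q c2 = block_class (p + q) k"
      using block_class_merge[OF c(2,3) m12(1)[unfolded e]] by blast
    then show ?thesis using c by (intro exI[of _ "p + q"] exI[of _ c0] exI[of _ k]) simp
  next
    case m02
    then obtain k where "k \<noteq> 0" "block_class (p + q) c0 \<boxplus> block_class q c2 = block_class (p + q + q) k"
      using block_class_merge[OF c(1,3) m02(1)[unfolded e]] by blast
    then show ?thesis using c
      by (intro exI[of _ p] exI[of _ c1] exI[of _ k]) (simp add: Iq1.m_lcomm add.assoc char2_simps)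
  next
    case m01
    then obtain k where "k \<noteq> 0" "block_class (p + q) c0 \<boxplus> block_class p c1 = block_class (p + q + p) k"
      using block_class_merge[OF c(1,2) m01(1)[unfolded e]] by blast
    then show ?thesis using c
      by (intro exI[of _ q] exI[of _ k] exI[of _ c2]) (simp add: add_ac char2_simps flip: Iq1.m_assoc)
  next
    case all
    have e0: "e1 + e2 = e0" using sum by (simp add: add_eq_0_char2 add.assoc)
    have nzs: "e1 \<noteq> 0" "e2 \<noteq> 0" "e1 + e2 \<noteq> 0" using all by (simp_all add: e0)
    have "block_class p c1 = block_class p e1" "block_class q c2 = block_class q e2"
      "block_class (p + q) c0 = block_class (p + q) (e1 + e2)"
      unfolding e0 unfolding e using all[unfolded e] c by (simp_all add: block_class_norm)
    then show ?thesis
      using block_class_three[OF nzs, of p q] nzs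
      by (intro exI[of _ "p + e1 * (p + q) / (e1 + e2)"] exI[of _ e1] exI[of _ e2]) (simp add: Iq1.m_ac)
  qed
qed

lemma nonzero_vecE:
  assumes "v \<in> carrier_vec n" "v \<noteq> 0\<^sub>v n"
  obtains i where "i < n" "v $ i \<noteq> 0"
  using assms by (metis carrier_vecD eq_vecI index_zero_vec)

text \<open>The Arf invariant is r + r = 0, so the form is isotropic. The isotropic vector yields a
  common value of the blocks, which merge into e[1, 0], a hyperbolic plane.\<close>

lemma two_blocks_Iq3:
  assumes "c \<noteq> 0" "d \<noteq> 0" "block_class r c \<boxplus> block_class r (d :: 'a) \<in> Iq_set 3"
  shows "block_class r c \<boxplus> block_class r d = \<one>\<^bsub>Iq1\<^esub>"
proof -
  let ?L = "[(r, c), (r, d)]"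
  have "witt_class (block_form ?L) \<in> Iq_set 3"
    using assms by (simp add: witt_class_block_form_Cons witt_class_block_form_Nil del: block_form.simps)
  then obtain v where v: "v \<in> carrier_vec 4" "v \<noteq> 0\<^sub>v 4" "qval (block_form ?L) v = 0"
    using block_form_Iq3_isotropic[of ?L] assms by (auto simp: char2_simps simp del: block_form.simps)
  have "c * nrm r (v $ 0) (v $ 1) + d * nrm r (v $ 2) (v $ 3) = 0"
    using qval_block_form_sum[of v ?L] v by (simp add: eval_nat_numeral del: block_form.simps)
  then have eq: "c * nrm r (v $ 0) (v $ 1) = d * nrm r (v $ 2) (v $ 3)" by (simp add: add_eq_0_char2)
  have nz: "v $ 0 \<noteq> 0 \<or> v $ 1 \<noteq> 0 \<or> v $ 2 \<noteq> 0 \<or> v $ 3 \<noteq> 0"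
    by (rule nonzero_vecE[OF v(1,2)]) (auto simp: eval_nat_numeral less_Suc_eq)
  obtain e where "e \<noteq> 0" "block_class r c \<boxplus> block_class r d = block_class (r + r) e"
    using block_class_merge[OF assms(1,2) eq nz] by blast
  moreover have "block_class 0 e = \<one>\<^bsub>Iq1\<^esub>"
    using block_class_isotropic[of 0 1 0 e] \<open>e \<noteq> 0\<close> by simp
  ultimately show ?thesis by (simp add: char2_simps)
qed

text \<open>The sum of the two classes is represented by the Albert form [1, p + q] + b[1, p] +
  c[1, q], of Arf invariant 0. Its isotropy reduces it to two blocks with the same parameter, and
  these cancel.\<close>

theorem pfister_2_unique:
  assumes "pfister_form 2 (A :: 'a mat)" "pfister_form 2 B"
    and I3: "witt_class A \<boxplus> witt_class B \<in> Iq_set 3"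
  shows "witt_class A = witt_class B"
proof -
  obtain b p where A: "b \<noteq> 0" "isometric A (pfister [b] p)" by (rule pfister_form_2E[OF assms(1)])
  obtain c q where B: "c \<noteq> 0" "isometric B (pfister [c] q)" by (rule pfister_form_2E[OF assms(2)])
  note A' = pfister_form_2_class[OF A(2,1)] and B' = pfister_form_2_class[OF B(2,1)]
  have prod: "witt_class A \<boxplus> witt_class B =
    block_class (p + q) 1 \<boxplus> (block_class p b \<boxplus> block_class q c)"
    using A(1) B(1) block_class_add_param[of 1 p q, symmetric] by (simp add: A' B' Iq1.m_ac)
  let ?L = "[(p + q, 1), (p, b), (q, c)]"
  have "witt_class (block_form ?L) \<in> Iq_set 3"
    using I3 A(1) B(1) unfolding prod
    by (simp add: witt_class_block_form_Cons witt_class_block_form_Nil del: block_form.simps)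
  then obtain v where v: "v \<in> carrier_vec 6" "v \<noteq> 0\<^sub>v 6" "qval (block_form ?L) v = 0"
    using block_form_Iq3_isotropic[of ?L] A(1) B(1) by (auto simp: char2_simps add_ac simp del: block_form.simps)
  have eq: "1 * nrm (p + q) (v $ 0) (v $ 1) + b * nrm p (v $ 2) (v $ 3) + c * nrm q (v $ 4) (v $ 5) = 0"
    using qval_block_form_sum[of v ?L] v by (simp add: eval_nat_numeral add_ac del: block_form.simps)
  have nz: "v $ 0 \<noteq> 0 \<or> v $ 1 \<noteq> 0 \<or> v $ 2 \<noteq> 0 \<or> v $ 3 \<noteq> 0 \<or> v $ 4 \<noteq> 0 \<or> v $ 5 \<noteq> 0"
    by (rule nonzero_vecE[OF v(1,2)]) (auto simp: eval_nat_numeral less_Suc_eq)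
  obtain r k l where kl: "k \<noteq> 0" "l \<noteq> 0"
    "witt_class A \<boxplus> witt_class B = block_class r k \<boxplus> block_class r l"
    using three_blocks_isotropic[OF _ A(1) B(1) eq nz] unfolding prod by auto
  have "witt_class A \<boxplus> witt_class B = \<one>\<^bsub>Iq1\<^esub>"
    using two_blocks_Iq3[OF kl(1,2)] I3 unfolding kl(3) by simp
  then have "witt_class A \<boxplus> (witt_class A \<boxplus> witt_class B) = witt_class A"
    using A'(1) by simp
  then show ?thesis using Iq1_square_left A'(1) B'(1) by simp
qed

section \<open>Linked forms\<close>

text \<open>Roundness of \<langle>\<langle>b, a]]: every nonzero value r is a similarity factor.
  Generically \<open>block_class_sum\<close> is applied to e = d n and f = d b n', for which e + f =
  d r, while e f (e + f) equals d r b up to a square and two norms.\<close>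

lemma block_class_similarity:
  assumes "b \<noteq> 0" "d \<noteq> 0" and r: "r = nrm a x y + b * nrm a x' y'" "r \<noteq> 0"
  shows "block_class a (d * r) \<boxplus> block_class a (d * r * b) =
    block_class a d \<boxplus> block_class a (d * b)"
proof -
  define n where "n = nrm a x y"
  define n' where "n' = nrm a x' y'"
  have rn: "r = n + b * n'" by (simp add: r n_def n'_def)
  have norm: "block_class a (c * n) = block_class a c" if "c \<noteq> 0" "n \<noteq> 0" for c
    using block_class_norm that by (simp add: n_def)
  have norm': "block_class a (c * n') = block_class a c" if "c \<noteq> 0" "n' \<noteq> 0" for c
    using block_class_norm that by (simp add: n'_def)
  show ?thesis
  proof (cases "n = 0 \<or> n' = 0")
    case False
    define e f where ef: "e = d * n" "f = d * b * n'"
    have nz: "e \<noteq> 0" "f \<noteq> 0" "e + f \<noteq> 0"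
      using False assms by (auto simp: ef rn simp flip: distrib_left mult.assoc) (simp add: mult.assoc flip: distrib_left)
    have s: "e + f = d * r" by (simp add: ef rn algebra_simps)
    have be: "block_class a e = block_class a d" and bf: "block_class a f = block_class a (d * b)"
      unfolding ef using False assms(1,2) by (simp_all add: norm norm')
    have "e * f * (e + f) = d * r * b * d\<^sup>2 * n * n'"
      unfolding s by (simp add: ef power2_eq_square algebra_simps)
    also have "block_class a \<dots> = block_class a (d * r * b * d\<^sup>2 * n)"
      using False assms(1,2) r(2) by (intro norm') auto
    also have "\<dots> = block_class a (d * r * b * d\<^sup>2)" using False assms(1,2) r(2) by (intro norm) auto
    also have "\<dots> = block_class a (d * r * b)" using assms(1,2) r(2) by (intro block_class_square) auto
    finally have "block_class a (e * f * (e + f)) = block_class a (d * r * b)" .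
    then show ?thesis using block_class_sum[OF nz, of a] unfolding be bf s by simp
  next
    case True
    then consider "n = 0" "n' \<noteq> 0" | "n' = 0" "n \<noteq> 0" using r(2) by (auto simp: rn)
    then show ?thesis
    proof cases
      case 1
      have "block_class a (d * r) = block_class a (d * b)"
        using norm'[of "d * b"] 1 assms(1,2) by (simp add: rn mult.assoc)
      moreover have "block_class a (d * r * b) = block_class a d"
      proof -
        have eq: "d * r * b = d * b\<^sup>2 * n'" using 1 by (simp add: rn power2_eq_square algebra_simps)
        show ?thesis unfolding eq using norm'[of "d * b\<^sup>2"] block_class_square[of d b a] 1 assms(1,2) by simp
      qed
      ultimately show ?thesis using assms by (simp add: Iq1.m_comm)
    next
      case 2
      have eq: "d * r * b = d * b * n" using 2 by (simp add: rn algebra_simps)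
      show ?thesis unfolding eq using norm[of d] norm[of "d * b"] 2 assms(1,2) by (simp add: rn)
    qed
  qed
qed

text \<open>An isotropic vector yields u = c v for two values of \<langle>\<langle>b, a]]. If they
  are nonzero, both are similarity factors, so scaling \<langle>\<langle>b, a]] by d and by d c
  gives the same class, and the two copies cancel. Otherwise \<langle>\<langle>b, a]] or already
  [1, a] is isotropic.\<close>

lemma pfister_3_isotropic:
  assumes "b \<noteq> 0" "c \<noteq> 0" "d \<noteq> 0"
    and 0: "nrm a x0 y0 + b * nrm a x1 y1 + c * (nrm a x2 y2 + b * nrm a x3 y3) = 0"
    and nz: "x0 \<noteq> 0 \<or> y0 \<noteq> 0 \<or> x1 \<noteq> 0 \<or> y1 \<noteq> 0 \<or> x2 \<noteq> 0 \<or> y2 \<noteq> 0 \<or> x3 \<noteq> 0 \<or> y3 \<noteq> 0"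
  shows "(block_class a d \<boxplus> block_class a (d * b)) \<boxplus>
    (block_class a (d * c) \<boxplus> block_class a (d * c * b)) = \<one>\<^bsub>Iq1\<^esub>"
proof (cases "\<exists>x y. (x \<noteq> 0 \<or> y \<noteq> 0) \<and> nrm a x y = 0")
  case True
  then have "block_class a k = \<one>\<^bsub>Iq1\<^esub>" if "k \<noteq> 0" for k
    using block_class_isotropic that by blast
  then show ?thesis using assms by simp
next
  case False
  define u v where uv: "u = nrm a x0 y0 + b * nrm a x1 y1" "v = nrm a x2 y2 + b * nrm a x3 y3"
  have ucv: "u = c * v" using 0 by (simp add: add_eq_0_char2 flip: uv)
  have anis: "nrm a x y = 0 \<longleftrightarrow> x = 0 \<and> y = 0" for x y using False by auto
  \<comment> \<open>As [1, a] is anisotropic here, an isotropic vector of \<langle>\<langle>b, a]]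
    exhibits b as a quotient of norms.\<close>
  have swap: "block_class a k = block_class a (k * b)"
    if xy: "nrm a x y + b * nrm a x' y' = 0" and ne: "x \<noteq> 0 \<or> y \<noteq> 0 \<or> x' \<noteq> 0 \<or> y' \<noteq> 0" and k: "k \<noteq> 0"
    for x y x' y' k
  proof -
    have eq: "nrm a x y = b * nrm a x' y'" using xy by (simp add: add_eq_0_char2)
    have n: "nrm a x y \<noteq> 0"
    proof
      assume *: "nrm a x y = 0"
      then have "nrm a x' y' = 0" using eq assms by auto
      then show False using * ne anis by blast
    qed
    then have n': "nrm a x' y' \<noteq> 0" using eq by auto
    have "block_class a k = block_class a (k * nrm a x y)" using block_class_norm[OF k n] by simp
    also have "k * nrm a x y = (k * b) * nrm a x' y'" using eq by simp
    also have "block_class a \<dots> = block_class a (k * b)" using k assms n' by (intro block_class_norm) auto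
    finally show ?thesis .
  qed
  show ?thesis
  proof (cases "u = 0")
    case True
    then have v0: "v = 0" using ucv assms by simp
    have *: "block_class a (k * b) = block_class a k" if "k \<noteq> 0" for k
      using swap[OF True[unfolded uv] _ that] swap[OF v0[unfolded uv] _ that] nz by metis
    have "block_class a (d * b) = block_class a d" "block_class a (d * c * b) = block_class a (d * c)"
      using *[of d] *[of "d * c"] assms(2,3) by simp_all
    then show ?thesis using assms(2,3) by (simp add: Iq1_square)
  next
    case False
    then have v: "v \<noteq> 0" using ucv by auto
    have "block_class a (d * c * v) \<boxplus> block_class a (d * c * v * b) =
        block_class a (d * c) \<boxplus> block_class a (d * c * b)"
      using assms v by (intro block_class_similarity[OF _ _ uv(2)]) auto
    moreover have "block_class a (d * u) \<boxplus> block_class a (d * u * b) =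
        block_class a d \<boxplus> block_class a (d * b)"
      using assms False by (intro block_class_similarity[OF _ _ uv(1)]) auto
    moreover have "d * c * v = d * u" by (simp add: ucv)
    ultimately have "block_class a (d * c) \<boxplus> block_class a (d * c * b) =
      block_class a d \<boxplus> block_class a (d * b)" by simp
    then show ?thesis using assms by (simp add: Iq1_square)
  qed
qed

text \<open>The class of \<langle>\<langle>b, a]]; the parameter \<open>a\<close> that right-linked
  forms share comes first.\<close>

definition pfister_class :: "'a \<Rightarrow> 'a \<Rightarrow> 'a mat set" where
  "pfister_class a b = block_class a 1 \<boxplus> block_class a b"

text \<open>The four copies of [1, a] cancel, which leaves d \<langle>\<langle>b, c, a]]. The scalar
  d is harmless because \<open>pfister_3_isotropic\<close> deduces hyperbolicity of all multiples
  from an isotropic vector of the unscaled form.\<close>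

lemma left_linked_sum:
  assumes "b \<noteq> 0" "c \<noteq> 0" "k \<noteq> 0" "d \<noteq> 0"
    and b: "pfister_class a b = pfister_class p k" and c: "pfister_class a c = pfister_class q k"
  shows "(pfister_class a d \<boxplus> pfister_class a (d * b)) \<boxplus>
    (pfister_class a (d * c) \<boxplus> pfister_class a (d * c * b)) = \<one>\<^bsub>Iq1\<^esub>"
proof -
  let ?w = "block_class"
  \<comment> \<open>\<open>?L\<close> is the 8-dimensional \<langle>\<langle>b, c, a]]. In
    \<open>?M\<close> the sum b[1, a] + c[1, a] is replaced by [1, p + q] + k[1, p + q], and
    [1, p + q] is fused with [1, a], which brings the dimension down to 6.\<close>
  let ?L = "[(a, 1), (a, b), (a, c), (a, b * c)]" and ?M = "[(p + q + a, 1), (p + q, k), (a, b * c)]"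
  have sq: "x \<boxplus> (x \<boxplus> y) = y" if "x \<in> carrier Iq1" "y \<in> carrier Iq1" for x y :: "'a mat set"
    using Iq1_square_left that .
  have "?w a b \<boxplus> ?w a c = pfister_class a b \<boxplus> pfister_class a c"
    using assms(1-4) by (simp add: pfister_class_def Iq1.m_ac sq)
  also have "\<dots> = ?w (p + q) 1 \<boxplus> ?w (p + q) k"
    unfolding b c using assms(1-4) block_class_add_param[of 1 p q, symmetric] block_class_add_param[of k p q, symmetric]
    by (simp add: pfister_class_def Iq1.m_ac)
  finally have bc: "?w a b \<boxplus> ?w a c = ?w (p + q) 1 \<boxplus> ?w (p + q) k" .
  have "witt_class (block_form ?L) = (?w a b \<boxplus> ?w a c) \<boxplus> (?w a 1 \<boxplus> ?w a (b * c))"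
    using assms by (simp add: witt_class_block_form_Cons witt_class_block_form_Nil Iq1.m_ac del: block_form.simps)
  also have "\<dots> = witt_class (block_form ?M)"
    unfolding bc using assms block_class_add_param[of 1 "p + q" a, symmetric]
    by (simp add: witt_class_block_form_Cons witt_class_block_form_Nil Iq1.m_ac del: block_form.simps)
  finally have LM: "witt_class (block_form ?L) = witt_class (block_form ?M)" .
  have "block_form ?L \<in> even_forms" "block_form ?M \<in> even_forms"
    using assms by (auto intro!: block_form_even_forms simp del: block_form.simps)
  from witt_class_eq_imp_isotropic[OF this _ LM] obtain v
    where v: "v \<in> carrier_vec 8" "v \<noteq> 0\<^sub>v 8" "qval (block_form ?L) v = 0"
    by (auto simp del: block_form.simps)
  have eq: "nrm a (v $ 0) (v $ 1) + b * nrm a (v $ 2) (v $ 3)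
      + c * (nrm a (v $ 4) (v $ 5) + b * nrm a (v $ 6) (v $ 7)) = 0"
    using qval_block_form_sum[of v ?L] v by (simp add: eval_nat_numeral algebra_simps del: block_form.simps)
  have nz: "v $ 0 \<noteq> 0 \<or> v $ 1 \<noteq> 0 \<or> v $ 2 \<noteq> 0 \<or> v $ 3 \<noteq> 0 \<or> v $ 4 \<noteq> 0 \<or> v $ 5 \<noteq> 0 \<or> v $ 6 \<noteq> 0 \<or> v $ 7 \<noteq> 0"
    by (rule nonzero_vecE[OF v(1,2)]) (auto simp: eval_nat_numeral less_Suc_eq)
  show ?thesis
    using pfister_3_isotropic[OF assms(1,2,4) eq nz] assms(1-4) by (simp add: pfister_class_def Iq1.m_ac sq)
qed

lemma pfister_class_square: "b \<noteq> 0 \<Longrightarrow> r \<noteq> 0 \<Longrightarrow> pfister_class a (b * r\<^sup>2) = pfister_class a b"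
  by (simp add: pfister_class_def block_class_square)

lemma pfister_class_one: "pfister_class a 1 = \<one>\<^bsub>Iq1\<^esub>"
  by (simp add: pfister_class_def Iq1_square)

lemma witt_class_pfister: "isometric A (pfister [b] a) \<Longrightarrow> b \<noteq> 0 \<Longrightarrow> witt_class A = pfister_class a b"
  using pfister_form_2_class by (simp add: pfister_class_def)

section \<open>The subgroup generated by a right-linked set\<close>

lemma pfister_form_pfister: "b \<noteq> 0 \<Longrightarrow> pfister_form 2 (pfister [b] (a :: 'a))"
  unfolding pfister_form_def
  using isometric_refl[OF even_forms_carrier[OF pfister_one(1)[of b a]]]
  by (intro exI[of _ "[b]"] exI[of _ a]) (simp del: pfister.simps)

lemma Iq2_generator:
  assumes "c \<noteq> 0" "b \<noteq> (0 :: 'a)"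
  shows "block_class a c \<boxplus> block_class a (c * b) \<in> Iq_set 2"
proof -
  have "c \<cdot>\<^sub>m pfister [b] a = orth_sum (c \<cdot>\<^sub>m binary_form 1 a) ((c * b) \<cdot>\<^sub>m binary_form 1 a)"
    by (simp add: smult_orth_sum smult_smult_mat)
  then have "witt_class (c \<cdot>\<^sub>m pfister [b] a) = block_class a c \<boxplus> block_class a (c * b)"
    using assms by (simp add: block_class_def Iq1_mult block_even)
  moreover have "witt_class (c \<cdot>\<^sub>m pfister [b] a) \<in> Iq_set 2"
    unfolding Iq_set_def using assms pfister_form_pfister by (intro generate.incl) blast
  ultimately show ?thesis by simp
qed

lemma generator_carrier:
  assumes "x \<in> {witt_class (c \<cdot>\<^sub>m A) | c A. c \<noteq> 0 \<and> pfister_form 2 (A :: 'a mat)}"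
  shows "x \<in> carrier Iq1"
proof -
  from assms obtain k A where A: "k \<noteq> 0" "pfister_form 2 A" "x = witt_class (k \<cdot>\<^sub>m A)" by blast
  obtain b a where *: "b \<noteq> 0" "isometric A (pfister [b] a)" by (rule pfister_form_2E[OF A(2)])
  show ?thesis unfolding A(3)
    by (rule witt_class_carrier[OF smult_even_forms[OF pfister_form_2_class(1)[OF *(2,1)] A(1)]])
qed

lemma subgroup_Iq2: "subgroup (Iq_set 2) (Iq1 :: 'a mat set monoid)"
  unfolding Iq_set_def using generator_carrier by (intro Iq1.generate_is_subgroup) blast

lemma subgroup_Iq3: "subgroup (Iq_set 3) (Iq1 :: 'a mat set monoid)"
  unfolding Iq_set_def
proof (intro Iq1.generate_is_subgroup subsetI)
  fix x assume x: "x \<in> {witt_class (c \<cdot>\<^sub>m A) | c A. c \<noteq> 0 \<and> pfister_form 3 (A :: 'a mat)}"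
  obtain k b c a where *: "k \<noteq> 0" "b \<noteq> 0" "c \<noteq> 0" "x = witt_class (k \<cdot>\<^sub>m pfister [b, c] a)"
    by (rule Iq3_generator_class[OF x])
  show "x \<in> carrier Iq1" unfolding *(4) by (rule witt_class_carrier[OF smult_pfister_two(1)[OF *(2,3,1)]])
qed

lemma Iq3_subset_Iq2: "Iq_set 3 \<subseteq> (Iq_set 2 :: 'a mat set set)"
proof -
  interpret I2: subgroup "Iq_set 2" "Iq1 :: 'a mat set monoid" by (rule subgroup_Iq2)
  have "{witt_class (c \<cdot>\<^sub>m A) | c A. c \<noteq> 0 \<and> pfister_form 3 (A :: 'a mat)} \<subseteq> Iq_set 2"
  proof
    fix x assume x: "x \<in> {witt_class (c \<cdot>\<^sub>m A) | c A. c \<noteq> 0 \<and> pfister_form 3 (A :: 'a mat)}"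
    obtain k b c a where *: "k \<noteq> 0" "b \<noteq> 0" "c \<noteq> 0" "x = witt_class (k \<cdot>\<^sub>m pfister [b, c] a)"
      by (rule Iq3_generator_class[OF x])
    then show "x \<in> Iq_set 2"
      using Iq2_generator[of k c a] Iq2_generator[of "k * b" c a] smult_pfister_two(2)[OF *(2,3,1), of a]
      by (metis I2.m_closed mult_eq_0_iff)
  qed
  then show ?thesis
    using Iq1.generate_subgroup_incl[OF _ subgroup_Iq2] unfolding Iq_set_def by blast
qed

lemma comm_group_Iq2: "comm_group (Iq 2 :: 'a mat set monoid)"
  unfolding Iq_def
proof (rule group.group_comm_groupI[OF subgroup.subgroup_is_group[OF subgroup_Iq2 Iq1.group_axioms]])
  fix x y :: "'a mat set"
  assume "x \<in> carrier (Iq1\<lparr>carrier := Iq_set 2\<rparr>)" "y \<in> carrier (Iq1\<lparr>carrier := Iq_set 2\<rparr>)"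
  then show "x \<otimes>\<^bsub>Iq1\<lparr>carrier := Iq_set 2\<rparr>\<^esub> y = y \<otimes>\<^bsub>Iq1\<lparr>carrier := Iq_set 2\<rparr>\<^esub> x"
    using subgroup.mem_carrier[OF subgroup_Iq2] Iq1.m_comm by simp
qed

interpretation Iq2: comm_group "Iq 2 :: 'a mat set monoid"
  by (rule comm_group_Iq2)

lemma Iq2_simps [simp]: "carrier (Iq 2) = Iq_set 2" "x \<otimes>\<^bsub>Iq 2\<^esub> y = x \<boxplus> y" "\<one>\<^bsub>Iq 2\<^esub> = \<one>\<^bsub>Iq1\<^esub>"
  by (simp_all add: Iq_def)

lemma Iq3_normal: "Iq_set 3 \<lhd> (Iq 2 :: 'a mat set monoid)"
  using Iq2.subgroup_imp_normal Iq1.subgroup_incl[OF subgroup_Iq3 subgroup_Iq2 Iq3_subset_Iq2]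
  by (simp add: Iq_def)

interpretation Iq3: normal "Iq_set 3" "Iq 2 :: 'a mat set monoid"
  by (rule Iq3_normal)

interpretation Q: group "Iq2_mod_Iq3 :: 'a mat set set monoid"
  unfolding Iq2_mod_Iq3_def by (rule Iq3.factorgroup_is_group)

section \<open>Cosets modulo \<open>Iq_set 3\<close> and their Pfister representatives\<close>

definition coset3 :: "'a mat set \<Rightarrow> 'a mat set set" where
  "coset3 x = Iq_set 3 #>\<^bsub>Iq 2\<^esub> x"

lemma class_mod_Iq3_eq: "class_mod_Iq3 A = coset3 (witt_class A)"
  by (simp add: class_mod_Iq3_def coset3_def)

text \<open>The Witt group has exponent 2, so the sum takes the place of the difference.\<close>

lemma coset3_eq_iff:
  assumes "x \<in> Iq_set 2" "y \<in> Iq_set 2"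
  shows "coset3 x = coset3 y \<longleftrightarrow> x \<boxplus> y \<in> Iq_set 3"
proof -
  have car: "z \<in> carrier Iq1" if "z \<in> Iq_set 2" for z :: "'a mat set"
    using subgroup.mem_carrier[OF subgroup_Iq2 that] .
  have car3: "z \<in> carrier Iq1" if "z \<in> Iq_set 3" for z :: "'a mat set"
    using subgroup.mem_carrier[OF subgroup_Iq3 that] .
  show ?thesis
  proof
    assume "coset3 x = coset3 y"
    moreover have "x \<in> coset3 x"
      unfolding coset3_def using Iq2.rcos_self[OF _ Iq3.subgroup_axioms] assms by simp
    ultimately obtain h where "h \<in> Iq_set 3" "x = h \<boxplus> y"
      by (auto simp: coset3_def r_coset_def)
    then show "x \<boxplus> y \<in> Iq_set 3"
      using car[OF assms(2)] car3 by (simp add: Iq1.m_assoc Iq1_square)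
  next
    assume h: "x \<boxplus> y \<in> Iq_set 3"
    have "x = (x \<boxplus> y) \<boxplus> y" using car assms by (simp add: Iq1.m_assoc Iq1_square)
    then have "x \<in> coset3 y" using h by (auto simp: coset3_def r_coset_def)
    then show "coset3 x = coset3 y"
      unfolding coset3_def using Iq2.repr_independence[OF _ _ Iq3.subgroup_axioms] assms by simp
  qed
qed

lemma coset3_mult:
  "x \<in> Iq_set 2 \<Longrightarrow> y \<in> Iq_set 2 \<Longrightarrow> coset3 x \<otimes>\<^bsub>Iq2_mod_Iq3\<^esub> coset3 y = coset3 (x \<boxplus> y)"
  using Iq3.rcos_sum[of x y] by (simp add: Iq2_mod_Iq3_def FactGroup_def coset3_def)

lemma coset3_one: "coset3 \<one>\<^bsub>Iq1\<^esub> = \<one>\<^bsub>Iq2_mod_Iq3\<^esub>"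
  using Iq2.coset_mult_one[of "Iq_set 3"] Iq3_subset_Iq2
  by (simp add: Iq2_mod_Iq3_def FactGroup_def coset3_def)

lemma coset3_carrier: "x \<in> Iq_set 2 \<Longrightarrow> coset3 x \<in> carrier Iq2_mod_Iq3"
  by (auto simp: Iq2_mod_Iq3_def FactGroup_def coset3_def RCOSETS_def)

lemma pfister_class_Iq2: "b \<noteq> 0 \<Longrightarrow> pfister_class a b \<in> Iq_set 2"
  using Iq2_generator[of 1 b a] by (simp add: pfister_class_def)

text \<open>\<langle>\<langle>b, a]] + \<langle>\<langle>c, a]] + \<langle>\<langle>b c, a]] is the
  class of \<langle>\<langle>b, c, a]]. Hence right-linked sets are tight.\<close>

lemma pfister_class_mult_mod_Iq3:
  assumes "b \<noteq> 0" "c \<noteq> 0"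
  shows "coset3 (pfister_class a b) \<otimes>\<^bsub>Iq2_mod_Iq3\<^esub> coset3 (pfister_class a c) = coset3 (pfister_class a (b * c))"
proof -
  have mem: "pfister_class a b \<in> Iq_set 2" "pfister_class a c \<in> Iq_set 2" "pfister_class a (b * c) \<in> Iq_set 2"
    using assms by (auto intro: pfister_class_Iq2)
  have pf: "pfister_form 3 (pfister [b, c] a)"
    unfolding pfister_form_def using assms smult_pfister_two(1)[of b c 1 a]
    by (intro exI[of _ "[b, c]"] exI[of _ a]) (auto intro!: isometric_refl[OF even_forms_carrier] simp del: pfister.simps)
  have "witt_class (1 \<cdot>\<^sub>m pfister [b, c] a) \<in> Iq_set 3"
    unfolding Iq_set_def
    by (rule generate.incl, rule CollectI, intro exI conjI, rule refl, rule one_neq_zero, rule pf)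
  moreover have "witt_class (1 \<cdot>\<^sub>m pfister [b, c] a) =
      (pfister_class a b \<boxplus> pfister_class a c) \<boxplus> pfister_class a (b * c)"
    unfolding smult_pfister_two(2)[OF assms one_neq_zero] using assms
    by (simp add: pfister_class_def Iq1.m_ac Iq1_square_left)
  ultimately have "(pfister_class a b \<boxplus> pfister_class a c) \<boxplus> pfister_class a (b * c) \<in> Iq_set 3" by simp
  moreover have "pfister_class a b \<boxplus> pfister_class a c \<in> Iq_set 2"
    using subgroup.m_closed[OF subgroup_Iq2] mem by blast
  ultimately show ?thesis using mem by (simp add: coset3_mult coset3_eq_iff)
qed

text \<open>\<open>pfister_2_unique\<close> makes the definite description meaningful.\<close>

lemma pfister_rep_coset3:
  assumes "b \<noteq> 0"
  shows "pfister_rep (coset3 (pfister_class a b)) = pfister_class a b"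
  unfolding pfister_rep_def
proof (rule the_equality)
  have *: "witt_class (pfister [b] a) = pfister_class a b"
    using pfister_one(2)[OF assms] by (simp add: pfister_class_def)
  show "\<exists>A. pfister_form 2 A \<and> class_mod_Iq3 A = coset3 (pfister_class a b) \<and> pfister_class a b = witt_class A"
    using pfister_form_pfister[OF assms] * class_mod_Iq3_eq by metis
  fix w assume "\<exists>A. pfister_form 2 A \<and> class_mod_Iq3 A = coset3 (pfister_class a b) \<and> w = witt_class A"
  then obtain A where A: "pfister_form 2 A" "coset3 (witt_class A) = coset3 (pfister_class a b)" "w = witt_class A"
    by (auto simp: class_mod_Iq3_eq)
  obtain b' a' where "b' \<noteq> 0" "isometric A (pfister [b'] a')" by (rule pfister_form_2E[OF A(1)])
  then have "witt_class A \<in> Iq_set 2" using witt_class_pfister pfister_class_Iq2 by metis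
  then have "witt_class A \<boxplus> witt_class (pfister [b] a) \<in> Iq_set 3"
    using A(2) coset3_eq_iff pfister_class_Iq2[OF assms] * by metis
  from pfister_2_unique[OF A(1) pfister_form_pfister[OF assms] this] show "w = pfister_class a b"
    using A(3) * by simp
qed

text \<open>Subsets under symmetric difference map homomorphically to classes, since squares do not
  change a Pfister class. In particular every element is its own inverse.\<close>

lemma generated_subgroup_right_linked:
  assumes "finite S" and f: "\<And>A. A \<in> S \<Longrightarrow> f A \<noteq> 0 \<and> isometric A (pfister [f A] (a :: 'a))"
  shows "generated_subgroup S = (\<lambda>T. coset3 (pfister_class a (prod f T))) ` Pow S"
proof -
  let ?c = "\<lambda>b. coset3 (pfister_class a b)"
  have nz: "prod f T \<noteq> 0" if "T \<subseteq> S" for T using that f by (induction T rule: infinite_finite_induct) auto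
  have cls: "class_mod_Iq3 A = ?c (f A)" if "A \<in> S" for A
    using f[OF that] witt_class_pfister[of A "f A" a] by (simp add: class_mod_Iq3_eq del: pfister.simps)
  have one: "?c 1 = \<one>\<^bsub>Iq2_mod_Iq3\<^esub>" by (simp add: pfister_class_one coset3_one)
  show ?thesis
  proof (intro equalityI subsetI)
    fix x assume "x \<in> generated_subgroup S"
    then show "x \<in> (\<lambda>T. ?c (prod f T)) ` Pow S"
      unfolding generated_subgroup_def
    proof (induction rule: generate.induct)
      case one
      then show ?case using \<open>?c 1 = _\<close> by (intro image_eqI[of _ _ "{}"]) auto
    next
      case (incl x)
      then obtain A where "A \<in> S" "x = ?c (f A)" using cls by auto
      then show ?case by (intro image_eqI[of _ _ "{A}"]) auto
    next
      case (inv x)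
      then obtain A where A: "A \<in> S" "x = ?c (f A)" using cls by auto
      have "?c (f A) \<otimes>\<^bsub>Iq2_mod_Iq3\<^esub> ?c (f A) = ?c (1 * (f A)\<^sup>2)"
        using f[OF A(1)] by (simp add: pfister_class_mult_mod_Iq3 power2_eq_square)
      also have "\<dots> = \<one>\<^bsub>Iq2_mod_Iq3\<^esub>"
        using f[OF A(1)] one pfister_class_square[of 1 "f A" a] by simp
      finally have "inv\<^bsub>Iq2_mod_Iq3\<^esub> x = x"
        unfolding A(2) using f[OF A(1)] by (intro Q.inv_equality coset3_carrier pfister_class_Iq2) auto
      then show ?case using A by (intro image_eqI[of _ _ "{A}"]) auto
    next
      case (eng x y)
      then obtain T U where TU: "T \<subseteq> S" "U \<subseteq> S" "x = ?c (prod f T)" "y = ?c (prod f U)" by blast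
      have fin: "finite T" "finite U" using TU \<open>finite S\<close> finite_subset by auto
      have "x \<otimes>\<^bsub>Iq2_mod_Iq3\<^esub> y = ?c (prod f T * prod f U)"
        unfolding TU using nz TU by (intro pfister_class_mult_mod_Iq3) auto
      also have "\<dots> = ?c (prod f (sym_diff T U))"
        unfolding prod_sym_diff[OF fin] using nz[of "sym_diff T U"] nz[of "T \<inter> U"] TU
        by (subst pfister_class_square) auto
      finally show ?case using TU by (intro image_eqI[of _ _ "sym_diff T U"]) auto
    qed
  next
    fix x assume "x \<in> (\<lambda>T. ?c (prod f T)) ` Pow S"
    then obtain T where T: "T \<subseteq> S" "x = ?c (prod f T)" by blast
    have "finite T" using T \<open>finite S\<close> finite_subset by auto
    then have "?c (prod f T) \<in> generated_subgroup S"
      using T(1) unfolding generated_subgroup_def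
    proof (induction T rule: finite_induct)
      case empty
      then show ?case using one generate.one[of Iq2_mod_Iq3] by simp
    next
      case (insert A T)
      have "?c (f A) \<in> generate Iq2_mod_Iq3 (class_mod_Iq3 ` S)"
        using insert.prems cls by (intro generate.incl) auto
      then have "?c (f A) \<otimes>\<^bsub>Iq2_mod_Iq3\<^esub> ?c (prod f T) \<in> generate Iq2_mod_Iq3 (class_mod_Iq3 ` S)"
        using insert by (intro generate.eng) auto
      then show ?case
        using insert f[of A] nz[of T] by (simp add: pfister_class_mult_mod_Iq3)
    qed
    then show "x \<in> generated_subgroup S" using T by simp
  qed
qed

text \<open>Two pairings, along \<open>T\<close> and along \<open>U\<close>, group the sum into the scaled copies of the 3-fold
  Pfister form of the linked pair.\<close>

lemma finprod_linked:
  assumes "finite S" and nz: "\<And>A. A \<in> S \<Longrightarrow> f A \<noteq> 0" and TU: "T \<subseteq> S" "U \<subseteq> S"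
    and "i \<in> T" "i \<notin> U" "j \<in> U" and k: "k \<noteq> 0"
    and T: "pfister_class a (prod f T) = pfister_class p k"
    and U: "pfister_class a (prod f U) = pfister_class q (k :: 'a)"
  shows "finprod (Iq 2) (\<lambda>V. pfister_class a (prod f V)) (Pow S) = \<one>\<^bsub>Iq 2\<^esub>"
proof -
  let ?g = "\<lambda>V. pfister_class a (prod f V)"
  have nzp: "prod f V \<noteq> 0" if "V \<subseteq> S" for V using that nz by (induction V rule: infinite_finite_induct) auto
  have fin: "finite V" if "V \<subseteq> S" for V using that \<open>finite S\<close> finite_subset by auto
  have mem: "?g V \<in> Iq_set 2" if "V \<subseteq> S" for V using nzp[OF that] by (rule pfister_class_Iq2)
  have g_sym: "?g (sym_diff V W) = pfister_class a (prod f V * prod f W)" if "V \<subseteq> S" "W \<subseteq> S" for V W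
    unfolding prod_sym_diff[OF fin[OF that(1)] fin[OF that(2)]]
    using nzp[of "sym_diff V W"] nzp[of "V \<inter> W"] that by (subst pfister_class_square) auto
  have g_sym2: "?g (sym_diff (sym_diff V U) T) = pfister_class a (prod f V * prod f U * prod f T)" if V: "V \<subseteq> S" for V
  proof -
    have W: "sym_diff V U \<subseteq> S" using V TU by auto
    have eq: "prod f V * prod f U * prod f T = (prod f (sym_diff V U) * prod f T) * (prod f (V \<inter> U))\<^sup>2"
      unfolding prod_sym_diff[OF fin[OF V] fin[OF TU(2)]] by (simp add: mult_ac)
    show ?thesis
      unfolding eq g_sym[OF W TU(1)] using nzp[OF W] nzp[OF TU(1)] nzp[of "V \<inter> U"] V
      by (subst pfister_class_square) auto
  qed
  let ?h = "\<lambda>V. ?g V \<otimes>\<^bsub>Iq 2\<^esub> ?g (sym_diff V T)"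
  have memh: "?h V \<in> Iq_set 2" if "V \<subseteq> S" for V
    using subgroup.m_closed[OF subgroup_Iq2 mem[OF that] mem[of "sym_diff V T"]] that TU by auto
  \<comment> \<open>First pairing, along \<open>T\<close>, with the sets avoiding \<open>i\<close>
    as representatives.\<close>
  have "finprod (Iq 2) ?g (Pow S) = finprod (Iq 2) ?h {V \<in> Pow S. i \<notin> V}"
    using \<open>finite S\<close> \<open>i \<in> T\<close> TU mem by (intro Iq2.finprod_pair) auto
  \<comment> \<open>As \<open>i\<close> is not in \<open>U\<close>, the second pairing stays among
    the representatives of the first.\<close>
  also have "\<dots> = finprod (Iq 2) (\<lambda>V. ?h V \<otimes>\<^bsub>Iq 2\<^esub> ?h (sym_diff V U)) {V \<in> {V \<in> Pow S. i \<notin> V}. j \<notin> V}"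
    using \<open>finite S\<close> \<open>i \<notin> U\<close> \<open>j \<in> U\<close> TU memh by (intro Iq2.finprod_pair) auto
  also have "\<dots> = \<one>\<^bsub>Iq 2\<^esub>"
  proof (rule Iq2.finprod_one_eqI)
    fix V assume "V \<in> {V \<in> {V \<in> Pow S. i \<notin> V}. j \<notin> V}"
    then have V: "V \<subseteq> S" by auto
    \<comment> \<open>With b, c and d the products over \<open>T\<close>, \<open>U\<close> and
      \<open>V\<close>, the four terms have the scalars d, d b, d c, d c b up to squares.\<close>
    show "?h V \<otimes>\<^bsub>Iq 2\<^esub> ?h (sym_diff V U) = \<one>\<^bsub>Iq 2\<^esub>"
      unfolding g_sym2[OF V] g_sym[OF V TU(1)] g_sym[OF V TU(2)] Iq2_simps
      by (rule left_linked_sum[OF nzp[OF TU(1)] nzp[OF TU(2)] k nzp[OF V] T U])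
  qed
  finally show ?thesis .
qed

theorem right_linked_Sigma_form:
  fixes S :: "'a mat set"
  assumes "finite S" and "card (generated_subgroup S) = 2 ^ card S"
    and "right_linked S" and "has_left_linked_pair (generated_forms S)"
  shows "Sigma_form S = \<one>\<^bsub>Iq 2\<^esub>"
proof -
  obtain a where a: "\<forall>A \<in> S. \<exists>b. b \<noteq> 0 \<and> isometric A (pfister [b] a)"
    using assms(3) unfolding right_linked_def by blast
  then obtain f where f: "\<And>A. A \<in> S \<Longrightarrow> f A \<noteq> 0 \<and> isometric A (pfister [f A] a)" by metis
  let ?g = "\<lambda>T. pfister_class a (prod f T)"
  have nz: "prod f V \<noteq> 0" if "V \<subseteq> S" for V using that f by (induction V rule: infinite_finite_induct) auto
  have gen: "generated_subgroup S = (\<lambda>T. coset3 (?g T)) ` Pow S"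
    by (rule generated_subgroup_right_linked[OF assms(1) f])
  \<comment> \<open>The prescribed order is the number of subsets, so no element of the subgroup
    arises from two of them, and the sum over the subgroup becomes a sum over
    \<open>Pow S\<close>.\<close>
  have "inj_on (\<lambda>T. coset3 (?g T)) (Pow S)"
    using assms(1,2) unfolding gen by (intro eq_card_imp_inj_on) (auto simp: card_Pow)
  then have "Sigma_form S = finprod (Iq 2) (\<lambda>T. pfister_rep (coset3 (?g T))) (Pow S)"
    unfolding Sigma_form_def gen using nz
    by (intro Iq2.finprod_reindex) (auto simp: pfister_rep_coset3 pfister_class_Iq2)
  also have "\<dots> = finprod (Iq 2) ?g (Pow S)"
    using nz by (intro Iq2.finprod_cong') (auto simp: pfister_rep_coset3 pfister_class_Iq2)
  finally have Sigma: "Sigma_form S = finprod (Iq 2) ?g (Pow S)" .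
  \<comment> \<open>Uniqueness lifts an equality modulo \<open>Iq_set 3\<close> to the Witt group,
    so the linked pair may be replaced by products of the chosen scalars.\<close>
  have rep: "\<exists>T \<subseteq> S. witt_class A = ?g T \<and> A \<in> even_forms" if "A \<in> generated_forms S" for A
  proof -
    have A: "pfister_form 2 A" "class_mod_Iq3 A \<in> generated_subgroup S"
      using that by (auto simp: generated_forms_def)
    then obtain T where T: "T \<subseteq> S" "class_mod_Iq3 A = coset3 (?g T)" unfolding gen by blast
    obtain b p where b: "b \<noteq> 0" "isometric A (pfister [b] p)" by (rule pfister_form_2E[OF A(1)])
    have eq: "coset3 (pfister_class p b) = coset3 (?g T)"
      using T(2) witt_class_pfister[OF b(2,1)] unfolding class_mod_Iq3_eq by simp
    have "witt_class A = pfister_rep (coset3 (pfister_class p b))"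
      unfolding pfister_rep_coset3[OF b(1)] by (rule witt_class_pfister[OF b(2,1)])
    also have "\<dots> = ?g T"
      unfolding eq by (rule pfister_rep_coset3[OF nz[OF T(1)]])
    finally show ?thesis using T(1) pfister_form_2_class(1)[OF b(2,1)] by blast
  qed
  obtain A B k where AB: "A \<in> generated_forms S" "B \<in> generated_forms S" "\<not> isometric A B"
    "\<not> hyperbolic A" "\<not> hyperbolic B" and k: "k \<noteq> 0"
    and link: "\<exists>p. isometric A (pfister [k] p)" "\<exists>q. isometric B (pfister [k] q)"
    using assms(4) unfolding has_left_linked_pair_def left_linked_def by blast
  obtain p q where pq: "isometric A (pfister [k] p)" "isometric B (pfister [k] q)" using link by blast
  obtain T where T: "T \<subseteq> S" "witt_class A = ?g T" "A \<in> even_forms" using rep[OF AB(1)] by blast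
  obtain U where U: "U \<subseteq> S" "witt_class B = ?g U" "B \<in> even_forms" using rep[OF AB(2)] by blast
  have T': "?g T = pfister_class p k" using T(2) witt_class_pfister[OF pq(1) k] by simp
  have U': "?g U = pfister_class q k" using U(2) witt_class_pfister[OF pq(2) k] by simp
  have "T \<noteq> {}"
    using witt_class_one_imp_hyperbolic[OF T(3)] T(2) AB(4) by (auto simp: pfister_class_one)
  have "U \<noteq> {}"
    using witt_class_one_imp_hyperbolic[OF U(3)] U(2) AB(5) by (auto simp: pfister_class_one)
  have "dim_row A = dim_row B" using isometric_dim[OF pq(1)] isometric_dim[OF pq(2)] by simp
  then have "T \<noteq> U"
    using witt_class_eq_imp_isometric[OF T(3) U(3)] T(2) U(2) AB(3) by auto
  \<comment> \<open>Distinct nonempty sets are independent under symmetric difference. Up to an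
    exchange there is an element of one outside the other, as the two pairings require.\<close>
  then consider i where "i \<in> T" "i \<notin> U" | i where "i \<in> U" "i \<notin> T" by blast
  then have "finprod (Iq 2) ?g (Pow S) = \<one>\<^bsub>Iq 2\<^esub>"
  proof cases
    case 1
    moreover obtain j where "j \<in> U" using \<open>U \<noteq> {}\<close> by blast
    ultimately show ?thesis using finprod_linked[OF assms(1) _ T(1) U(1) _ _ _ k T' U'] f by blast
  next
    case 2
    moreover obtain j where "j \<in> T" using \<open>T \<noteq> {}\<close> by blast
    ultimately show ?thesis using finprod_linked[OF assms(1) _ U(1) T(1) _ _ _ k U' T'] f by blast
  qed
  then show ?thesis using Sigma by simp
qed

end

theorem corollary8p9:
  fixes S :: "'a::field mat set" and s :: nat
  assumes "CHAR('a) = 2"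
    and "finite S" and "card S = s"
    and "\<And>A. A \<in> S \<Longrightarrow> pfister_form 2 A"
    and "card (generated_subgroup S) = 2 ^ s"
    and "right_linked S"
    and "has_left_linked_pair (generated_forms S)"
  shows "Sigma_form S = \<one>\<^bsub>Iq 2\<^esub>"
proof -
  interpret char_two_field "TYPE('a)"
    using of_nat_CHAR[where ?'a = 'a] assms(1) by unfold_locales simp
  show ?thesis using right_linked_Sigma_form[of S] assms by simp
qed

end
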